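(* Let $R\in\{\mathbb{Q},\mathbb{R}\}$. Let $(V,d_V)$ and $(W,d_W)$ be two dissimilarity functions on non-empty finite sets $V$ and $W$. Then, for all $n\ge 0$, \[d_B\big(\mathrm{Dgm}_n(V,d_V),\mathrm{Dgm}_n(W,d_W)\big)\le 2\, d_{\mathrm{CD}}\big((V,d_V),(W,d_W)\big)\] and \[d_B\big(\mathrm{Dgm}_n^{\mathrm{Dir}}(V,d_V),\mathrm{Dgm}_n^{\mathrm{Dir}}(W,d_W)\big)\le 2\, d_{\mathrm{CD}}\big((V,d_V),(W,d_W)\big).\]
   Context: **Dissimilarity functions.** A dissimilarity function $(V,d_V)$ on a finite set $V$ is an arbitrary function $d_V\colon V\times V\to\mathbb{R}$ (no symmetry, triangle inequality, or vanishing on the diagonal is required). For a non-empty relation $\theta\subseteq V\times W$, its distortion is $\mathrm{dis}(\theta)=\max_{(v_1,w_1),(v_2,w_2)\in\theta}|d_V(v_1,v_2)-d_W(w_1,w_2)|$. A correspondence is a relation $\theta\subseteq V\times W$ whose projections to $V$ and to $W$ are both surjective; $\mathcal{R}(V,W)$ is the set of correspondences. The correspondence distortion distance is $d_{\mathrm{CD}}((V,d_V),(W,d_W))=\frac12\min_{\theta\in\mathcal{R}(V,W)}\mathrm{dis}(\theta)$. **Directed simplicial complexes and homology.** A directed simplicial complex $X$ on a finite vertex set is a family of tuples $(x_0,\dots,x_n)$, $n\ge 0$, of vertices such that, for $n\geq 1$, if $(x_0,\dots,x_n)\in X$ then $(x_0,\dots,\widehat{x_i},\dots,x_n)\in X$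 for all $i$ ($\widehat{x_i}$ means $x_i$ is omitted). Repetitions of vertices are allowed; the vertex set is taken to consist of the vertices occurring in some simplex. Tuples of length $n+1$ are $n$-simplices. $C_n(X,R)$ is the free $R$-module with basis the elementary $n$-chains $[x_0,\dots,x_n]$, one for each $n$-simplex $(x_0,\dots,x_n)\in X$; $\partial_n[x_0,\dots,x_n]=\sum_{i=0}^n(-1)^i[x_0,\dots,\widehat{x_i},\dots,x_n]$ for $n>0$, $\partial_0=0$; $Z_n(X,R)=\ker\partial_n$, $B_n(X,R)=\operatorname{Im}\partial_{n+1}$, $H_n(X,R)=Z_n(X,R)/B_n(X,R)$. The set of directed cycles $Z_n^{\mathrm{Dir}}(X,R)$ consists of all cycles $\sum_i\lambda_ic_i\in Z_n(X,R)$ with each $c_i$ an elementary $n$-chain and each $\lambda_i\ge0$; $H_n^{\mathrm{Dir}}(X,R)$ is the $R$-submodule of $H_n(X,R)$ generated by the classes of directed cycles. Inclusions of complexes induce maps on $H_n$ which restrict to $H_n^{\mathrm{Dir}}$. **Directed Rips filtration.** For $\delta\in\mathbb{R}$, $\mathcal{R}^{\mathrm{Dir}}(V,d_V)_\delta$ is the directed simplicial complex with $(v_0,\dots,v_n)\in\mathcal{R}^{\mathrm{Dir}}(V,d_V)_\delta$ if and only if $d_V(v_i,v_j)\le\delta$ for all $0\le i\le j\le n$. The persistence vector spaces (indexed by $\delta\in\mathbb{R}$, with maps induced by inclusions) $\mathcal{H}_n(V,d_V)=\{H_n(\mathcal{R}^{\mathrm{Dir}}(V,d_V)_\delta,R)\}_\delta$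 and $\mathcal{H}_n^{\mathrm{Dir}}(V,d_V)=\{H_n^{\mathrm{Dir}}(\mathcal{R}^{\mathrm{Dir}}(V,d_V)_\delta,R)\}_\delta$ are the undirected and directed $n$-dimensional persistence modules; $\mathrm{Dgm}_n(V,d_V)$ and $\mathrm{Dgm}_n^{\mathrm{Dir}}(V,d_V)$ are their persistence diagrams. **Persistence diagrams.** Let $\mathcal{V}=(\{V^\delta\},\{\nu_\delta^{\delta'}\})$ be a persistence vector space over $\mathbb{R}$ with all $V^\delta$ finite-dimensional and for which there are $\delta_0<\dots<\delta_m$ such that $V^\delta=0$ for $\delta<\delta_0$, and $\nu_\delta^{\delta'}$ is an isomorphism whenever $\delta\le\delta'$ both lie in some $[\delta_{i-1},\delta_i)$ or both lie in $[\delta_m,\infty)$. Index it by $\mathbb{N}$ as $V^{\delta_0}\to V^{\delta_1}\to\cdots\to V^{\delta_m}\to V^{\delta_m}\to\cdots$ (identity maps after index $m$). Choose compatible bases $B_i$ of $V^{\delta_i}$: the map $\nu_i\colon V^{\delta_i}\to V^{\delta_{i+1}}$ satisfies $\nu_i(B_i)\subseteq B_{i+1}\cup\{0\}$, $\operatorname{rank}\nu_i=|\nu_i(B_i)\cap B_{i+1}|$, and each element of $\operatorname{Im}(\nu_i)\cap B_{i+1}$ is the image of exactly one element of $B_i$. Let $L=\{(b,i): i>0, b\in B_i, b\notin\operatorname{Im}\nu_{i-1}\}\cup\{(b,0):b\in B_0\}$, and for $(b,i)\in L$ let $\ell(b,i)\in\mathbb{N}\cup\{+\infty\}$ be the supremum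 of the $j\ge i$ such that the image of $b$ in $V^{\delta_j}$ lies in $B_j$. The persistence diagram $\mathrm{Dgm}(\mathcal{V})$ is the multiset in $\overline{\mathbb{R}}^2$, $\overline{\mathbb{R}}=\mathbb{R}\cup\{\pm\infty\}$, having for each $(b,i)\in L$ one point $(\delta_i,\delta_{j+1})$ if $\ell(b,i)=j<\infty$, and one point $(\delta_i,+\infty)$ if $\ell(b,i)=+\infty$. It is independent of choices. (The modules above satisfy these finiteness conditions.) **Bottleneck distance.** For multisets $A,B$ in $\overline{\mathbb{R}}^2$, $d_B(A,B)=\inf_\varphi\sup_{a\in A\cup\Delta^\infty}\|a-\varphi(a)\|_\infty$, where $\Delta^\infty$ is the multiset of all points of the diagonal of $\overline{\mathbb{R}}^2$, each with infinite multiplicity, $\varphi$ ranges over bijections of multisets $A\cup\Delta^\infty\to B\cup\Delta^\infty$, and $\|\cdot\|_\infty$ is the $\ell^\infty$-norm (with $|\infty-\infty|=0$). *)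

theory Defs
  imports
    "Jordan_Normal_Form.VS_Connect"
    "HOL-Algebra.QuotRing"
    "HOL-Library.Poly_Mapping"
    "HOL-Library.Extended_Nat"
    "HOL-Library.Extended_Real"
begin

section \<open>Dissimilarity functions and the correspondence distortion distance\<close>

text \<open>A dissimilarity function on a finite set \<open>V\<close> is any \<open>d :: 'v \<Rightarrow> 'v \<Rightarrow> real\<close>; only its
  values on \<open>V \<times> V\<close> are ever used.\<close>

definition distortion ::
  "('v \<Rightarrow> 'v \<Rightarrow> real) \<Rightarrow> ('w \<Rightarrow> 'w \<Rightarrow> real) \<Rightarrow> ('v \<times> 'w) set \<Rightarrow> real" where
  "distortion dV dW \<theta> =
     Max {\<bar>dV v1 v2 - dW w1 w2\<bar> | v1 w1 v2 w2. (v1, w1) \<in> \<theta> \<and> (v2, w2) \<in> \<theta>}"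

definition correspondences :: "'v set \<Rightarrow> 'w set \<Rightarrow> ('v \<times> 'w) set set" where
  "correspondences V W = {\<theta>. \<theta> \<subseteq> V \<times> W \<and> fst ` \<theta> = V \<and> snd ` \<theta> = W}"

definition corr_dist ::
  "'v set \<Rightarrow> ('v \<Rightarrow> 'v \<Rightarrow> real) \<Rightarrow> 'w set \<Rightarrow> ('w \<Rightarrow> 'w \<Rightarrow> real) \<Rightarrow> real" where
  "corr_dist V dV W dW = 1 / 2 * Min (distortion dV dW ` correspondences V W)"


section \<open>Directed simplicial complexes and their homology\<close>

definition omit :: "nat \<Rightarrow> 'v list \<Rightarrow> 'v list" where
  "omit i xs = take i xs @ drop (Suc i) xs"

definition directed_simplicial_complex :: "'v list set \<Rightarrow> bool" where
  "directed_simplicial_complex X \<longleftrightarrow>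
     finite (\<Union>xs\<in>X. set xs) \<and> [] \<notin> X \<and>
     (\<forall>xs\<in>X. length xs \<ge> 2 \<longrightarrow> (\<forall>i<length xs. omit i xs \<in> X))"

text \<open>The free module on the \<open>n\<close>-simplices, with elementary chains
  \<open>Poly_Mapping.single xs 1\<close>. The multiplicative fields of the module record are irrelevant.\<close>

definition chain_module ::
  "nat \<Rightarrow> 'v list set \<Rightarrow> ('k::field, 'v list \<Rightarrow>\<^sub>0 'k) module" where
  "chain_module n X =
     \<lparr>carrier = {c. Poly_Mapping.keys c \<subseteq> {xs \<in> X. length xs = n + 1}},
      mult = undefined, one = undefined, zero = 0, add = (+),
      smult = (\<lambda>a. Poly_Mapping.map ((*) a))\<rparr>"

definition boundary :: "nat \<Rightarrow> ('v list \<Rightarrow>\<^sub>0 'k::field) \<Rightarrow> ('v list \<Rightarrow>\<^sub>0 'k)" where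
  "boundary n c =
     (if n = 0 then 0
      else \<Sum>xs\<in>Poly_Mapping.keys c. \<Sum>i\<le>n.
             Poly_Mapping.single (omit i xs) (Poly_Mapping.lookup c xs * (-1) ^ i))"

definition cycles :: "nat \<Rightarrow> 'v list set \<Rightarrow> ('v list \<Rightarrow>\<^sub>0 'k::field) set" where
  "cycles n X = {c \<in> carrier (chain_module n X). boundary n c = 0}"

definition boundaries :: "nat \<Rightarrow> 'v list set \<Rightarrow> ('v list \<Rightarrow>\<^sub>0 'k::field) set" where
  "boundaries n X = boundary (n + 1) ` carrier (chain_module (n + 1) X)"

text \<open>Quotient of a module by a submodule, on the set of additive cosets; the scalar
  multiplication is set up like \<^const>\<open>rcoset_mult\<close> for quotient rings.\<close>

definition quotient_module :: "('k, 'a) module \<Rightarrow> 'a set \<Rightarrow> ('k, 'a set) module" where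
  "quotient_module M N =
     \<lparr>carrier = a_rcosets\<^bsub>M\<^esub> N, mult = undefined, one = undefined,
      zero = N, add = set_add M,
      smult = (\<lambda>a C. \<Union>x\<in>C. N +>\<^bsub>M\<^esub> (a \<odot>\<^bsub>M\<^esub> x))\<rparr>"

definition homology ::
  "nat \<Rightarrow> 'v list set \<Rightarrow> ('k::field, ('v list \<Rightarrow>\<^sub>0 'k) set) module" where
  "homology n X =
     quotient_module ((chain_module n X)\<lparr>carrier := cycles n X\<rparr>) (boundaries n X)"

definition homology_class ::
  "nat \<Rightarrow> 'v list set \<Rightarrow> ('v list \<Rightarrow>\<^sub>0 'k::field) \<Rightarrow> ('v list \<Rightarrow>\<^sub>0 'k) set" where
  "homology_class n X c = boundaries n X +>\<^bsub>chain_module n X\<^esub> c"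

definition directed_cycles ::
  "nat \<Rightarrow> 'v list set \<Rightarrow> ('v list \<Rightarrow>\<^sub>0 'k::linordered_field) set" where
  "directed_cycles n X = {c \<in> cycles n X. \<forall>xs. Poly_Mapping.lookup c xs \<ge> 0}"

definition directed_homology ::
  "nat \<Rightarrow> 'v list set \<Rightarrow> ('k::linordered_field, ('v list \<Rightarrow>\<^sub>0 'k) set) module" where
  "directed_homology n X =
     (homology n X)\<lparr>carrier :=
        LinearCombinations.module.span class_ring (homology n X) (homology_class n X ` directed_cycles n X)\<rparr>"

text \<open>The map on homology induced by an inclusion of some complex into \<open>Y\<close>: the class of a
  cycle is sent to the class of the same cycle in \<open>Y\<close>.\<close>

definition homology_incl ::
  "nat \<Rightarrow> 'v list set \<Rightarrow> ('v list \<Rightarrow>\<^sub>0 'k::field) set \<Rightarrow> ('v list \<Rightarrow>\<^sub>0 'k) set" where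
  "homology_incl n Y C = (\<Union>c\<in>C. homology_class n Y c)"

definition rips :: "'v set \<Rightarrow> ('v \<Rightarrow> 'v \<Rightarrow> real) \<Rightarrow> real \<Rightarrow> 'v list set" where
  "rips V d \<delta> =
     {xs. xs \<noteq> [] \<and> set xs \<subseteq> V \<and>
          (\<forall>j<length xs. \<forall>i\<le>j. d (xs ! i) (xs ! j) \<le> \<delta>)}"

lemma directed_simplicial_complex_rips:
  assumes "finite V" shows "directed_simplicial_complex (rips V d \<delta>)"
proof -
  have "omit i xs \<in> rips V d \<delta>" if xs: "xs \<in> rips V d \<delta>" "length xs \<ge> 2" "i < length xs" for i xs
  proof -
    let ?g = "\<lambda>k. if k < i then k else k+1"
    have l: "length (omit i xs) = length xs - 1" using xs by (auto simp: omit_def)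
    have n: "omit i xs ! k = xs ! ?g k" if "k < length xs - 1" for k
      using that xs by (auto simp: omit_def nth_append min_def)
    have "set (omit i xs) \<subseteq> V" using xs by (auto simp: omit_def rips_def dest: in_set_takeD in_set_dropD)
    moreover have "omit i xs \<noteq> []" using l xs by (metis One_nat_def diff_is_0_eq list.size(3) not_less_eq_eq numeral_2_eq_2)
    moreover have "d (omit i xs ! k) (omit i xs ! j) \<le> \<delta>" if "j < length (omit i xs)" "k \<le> j" for j k
    proof -
      have "d (xs ! ?g k) (xs ! ?g j) \<le> \<delta>" using xs that l unfolding rips_def by auto
      then show ?thesis using n that l by simp
    qed
    ultimately show ?thesis by (auto simp: rips_def)
  qed
  then show ?thesis using assms unfolding directed_simplicial_complex_def
    by (auto simp: rips_def intro: finite_subset)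
qed


section \<open>Persistence vector spaces and persistence diagrams\<close>

locale persistence_vector_space =
  fixes K :: "'k ring"
    and V :: "real \<Rightarrow> ('k, 'a) module"
    and \<nu> :: "real \<Rightarrow> real \<Rightarrow> 'a \<Rightarrow> 'a"
  assumes linear: "s \<le> t \<Longrightarrow> linear_map K (V s) (V t) (\<nu> s t)"
    and finite_dimensional: "vectorspace.fin_dim K (V t)"
    and map_refl: "x \<in> carrier (V t) \<Longrightarrow> \<nu> t t x = x"
    and map_trans:
      "\<lbrakk>r \<le> s; s \<le> t; x \<in> carrier (V r)\<rbrakk> \<Longrightarrow> \<nu> s t (\<nu> r s x) = \<nu> r t x"
begin

text \<open>The real numbers \<open>\<delta> 0 < \<dots> < \<delta> m\<close> are such that nothing happens before \<open>\<delta> 0\<close>, between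
  consecutive ones, or after \<open>\<delta> m\<close>.\<close>

definition critical_values :: "nat \<Rightarrow> (nat \<Rightarrow> real) \<Rightarrow> bool" where
  "critical_values m \<delta> \<longleftrightarrow>
     strict_mono_on {..m} \<delta> \<and>
     (\<forall>t<\<delta> 0. carrier (V t) = {\<zero>\<^bsub>V t\<^esub>}) \<and>
     (\<forall>s t. s \<le> t \<and>
        ((\<exists>i\<in>{1..m}. s \<in> {\<delta> (i - 1)..<\<delta> i} \<and> t \<in> {\<delta> (i - 1)..<\<delta> i}) \<or>
         (s \<in> {\<delta> m..} \<and> t \<in> {\<delta> m..})) \<longrightarrow>
        bij_betw (\<nu> s t) (carrier (V s)) (carrier (V t)))"

text \<open>Parameter value of index \<open>i\<close> in the sequence
  \<open>V\<^bsup>\<delta> 0\<^esup> \<rightarrow> \<dots> \<rightarrow> V\<^bsup>\<delta> m\<^esup> \<rightarrow> V\<^bsup>\<delta> m\<^esup> \<rightarrow> \<dots>\<close>; its maps beyond index \<open>m\<close> are \<open>\<nu> (\<delta> m) (\<delta> m)\<close>,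
  hence identities.\<close>

definition stage :: "nat \<Rightarrow> (nat \<Rightarrow> real) \<Rightarrow> nat \<Rightarrow> real" where
  "stage m \<delta> i = \<delta> (min i m)"

abbreviation space_at :: "nat \<Rightarrow> (nat \<Rightarrow> real) \<Rightarrow> nat \<Rightarrow> ('k, 'a) module" where
  "space_at m \<delta> i \<equiv> V (stage m \<delta> i)"

abbreviation map_at :: "nat \<Rightarrow> (nat \<Rightarrow> real) \<Rightarrow> nat \<Rightarrow> nat \<Rightarrow> 'a \<Rightarrow> 'a" where
  "map_at m \<delta> i j \<equiv> \<nu> (stage m \<delta> i) (stage m \<delta> j)"

definition image_at :: "nat \<Rightarrow> (nat \<Rightarrow> real) \<Rightarrow> nat \<Rightarrow> 'a set" where
  "image_at m \<delta> i = map_at m \<delta> i (i + 1) ` carrier (space_at m \<delta> i)"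

definition compatible_bases :: "nat \<Rightarrow> (nat \<Rightarrow> real) \<Rightarrow> (nat \<Rightarrow> 'a set) \<Rightarrow> bool" where
  "compatible_bases m \<delta> B \<longleftrightarrow>
     (\<forall>i. vectorspace.basis K (space_at m \<delta> i) (B i) \<and>
          map_at m \<delta> i (i + 1) ` B i \<subseteq> B (i + 1) \<union> {\<zero>\<^bsub>space_at m \<delta> (i + 1)\<^esub>} \<and>
          vectorspace.dim K ((space_at m \<delta> (i + 1))\<lparr>carrier := image_at m \<delta> i\<rparr>) =
            card (map_at m \<delta> i (i + 1) ` B i \<inter> B (i + 1)) \<and>
          (\<forall>b' \<in> image_at m \<delta> i \<inter> B (i + 1). \<exists>!b. b \<in> B i \<and> map_at m \<delta> i (i + 1) b = b'))"

definition births :: "nat \<Rightarrow> (nat \<Rightarrow> real) \<Rightarrow> (nat \<Rightarrow> 'a set) \<Rightarrow> ('a \<times> nat) set" where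
  "births m \<delta> B = {(b, i). i > 0 \<and> b \<in> B i \<and> b \<notin> image_at m \<delta> (i - 1)} \<union> {(b, 0) | b. b \<in> B 0}"

definition last_index ::
  "nat \<Rightarrow> (nat \<Rightarrow> real) \<Rightarrow> (nat \<Rightarrow> 'a set) \<Rightarrow> 'a \<times> nat \<Rightarrow> enat" where
  "last_index m \<delta> B = (\<lambda>(b, i). SUP j \<in> {j. i \<le> j \<and> map_at m \<delta> i j b \<in> B j}. enat j)"

definition diagram_of_bases ::
  "nat \<Rightarrow> (nat \<Rightarrow> real) \<Rightarrow> (nat \<Rightarrow> 'a set) \<Rightarrow> (ereal \<times> ereal) multiset" where
  "diagram_of_bases m \<delta> B =
     image_mset
       (\<lambda>(b, i). (ereal (\<delta> i),
          case last_index m \<delta> B (b, i) of enat j \<Rightarrow> ereal (\<delta> (j + 1)) | \<infinity> \<Rightarrow> \<infinity>))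
       (mset_set (births m \<delta> B))"

text \<open>The diagram does not depend on the choice of critical values and compatible bases.\<close>

definition persistence_diagram :: "(ereal \<times> ereal) multiset" where
  "persistence_diagram =
     (SOME D. \<exists>m \<delta> B. critical_values m \<delta> \<and> compatible_bases m \<delta> B \<and>
                      D = diagram_of_bases m \<delta> B)"

end

text \<open>The coefficient field is passed as a type argument, e.g. \<open>TYPE(rat)\<close>.\<close>

definition Dgm ::
  "'k::linordered_field itself \<Rightarrow> nat \<Rightarrow> 'v set \<Rightarrow> ('v \<Rightarrow> 'v \<Rightarrow> real)
     \<Rightarrow> (ereal \<times> ereal) multiset" where
  "Dgm R n V d =
     persistence_vector_space.persistence_diagram (class_ring :: 'k ring)
       (\<lambda>\<delta>. homology n (rips V d \<delta>))
       (\<lambda>\<delta> \<delta>'. homology_incl n (rips V d \<delta>'))"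

definition Dgm_dir ::
  "'k::linordered_field itself \<Rightarrow> nat \<Rightarrow> 'v set \<Rightarrow> ('v \<Rightarrow> 'v \<Rightarrow> real)
     \<Rightarrow> (ereal \<times> ereal) multiset" where
  "Dgm_dir R n V d =
     persistence_vector_space.persistence_diagram (class_ring :: 'k ring)
       (\<lambda>\<delta>. directed_homology n (rips V d \<delta>))
       (\<lambda>\<delta> \<delta>'. homology_incl n (rips V d \<delta>'))"


section \<open>Bottleneck distance\<close>

text \<open>The library's difference of extended reals has \<open>\<infinity> - \<infinity> = \<infinity>\<close>; here \<open>\<bar>\<infinity> - \<infinity>\<bar> = 0\<close>.\<close>

definition ereal_gap :: "ereal \<Rightarrow> ereal \<Rightarrow> ereal" where
  "ereal_gap x y = (if x = y then 0 else \<bar>x - y\<bar>)"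

definition linf_dist :: "ereal \<times> ereal \<Rightarrow> ereal \<times> ereal \<Rightarrow> ereal" where
  "linf_dist p q = max (ereal_gap (fst p) (fst q)) (ereal_gap (snd p) (snd q))"

text \<open>Multiplicity of a point in \<open>A \<union> \<Delta>\<^sup>\<infinity>\<close>, and the set of elements of this multiset, where the
  copies of a point \<open>p\<close> of multiplicity \<open>\<mu>\<close> are the pairs \<open>(p, k)\<close> with \<open>k < \<mu>\<close>.\<close>

definition mult_with_diagonal :: "(ereal \<times> ereal) multiset \<Rightarrow> ereal \<times> ereal \<Rightarrow> enat" where
  "mult_with_diagonal A p = enat (count A p) + (if fst p = snd p then \<infinity> else 0)"

definition elems_with_diagonal ::
  "(ereal \<times> ereal) multiset \<Rightarrow> ((ereal \<times> ereal) \<times> nat) set" where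
  "elems_with_diagonal A = {(p, k). enat k < mult_with_diagonal A p}"

definition bottleneck_dist ::
  "(ereal \<times> ereal) multiset \<Rightarrow> (ereal \<times> ereal) multiset \<Rightarrow> ereal" where
  "bottleneck_dist A B =
     (INF \<phi> \<in> {\<phi>. bij_betw \<phi> (elems_with_diagonal A) (elems_with_diagonal B)}.
        SUP a \<in> elems_with_diagonal A. linf_dist (fst a) (fst (\<phi> a)))"

end

theory Submission
  imports Defs
begin

text \<open>The homology of the complex at parameter \<open>t\<close> is \<open>Z t / B t\<close> for two subspaces \<open>B t \<subseteq> Z t\<close> of one
fixed chain space, both increasing in \<open>t\<close>, and the structure maps send the class of a cycle to the
class of the same cycle. Directed homology has this form too, with the same \<open>B t\<close> and with the sum of
\<open>B t\<close> and the span of the directed cycles as \<open>Z t\<close>. The argument is therefore carried out once, for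
increasing pairs \<open>B t \<subseteq> Z t\<close> in a vector space, and on representatives instead of classes.

A bar of such a family is a vector that enters \<open>Z\<close> at the birth time and enters \<open>B\<close> at the death time;
an \<open>interval_basis\<close> is a finite set of bars such that at each \<open>t\<close> the bars alive at \<open>t\<close> form a basis of
\<open>Z t\<close> modulo \<open>B t\<close>. Two finite chains of subspaces admit a common adapted basis
(\<open>adapted_basis_of_two_chains\<close>), and this yields compatible bases (\<open>compatible_bases_exist\<close>).
Conversely, whichever compatible bases define the diagram, representatives of their births form an
interval basis with that diagram (\<open>compatible_bases_interval_basis\<close>). So only interval bases have to be
compared.

Let \<open>\<epsilon>\<close> be the distortion of an optimal correspondence. Choosing related vertices gives maps
\<open>\<phi> : V \<rightarrow> W\<close> and \<open>\<psi> : W \<rightarrow> V\<close> whose induced chain maps shift the parameter by \<open>\<epsilon>\<close>; their composites are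
homologous to the identity after a shift by \<open>2\<epsilon>\<close>, by a prism operator (\<open>push_homologous_id\<close>). Chain
maps induced by vertex maps preserve nonnegative coefficients, so the same maps interleave the
directed homologies.

Interleaved families have close diagrams for a reason of linear algebra. Write the two maps as
matrices \<open>F\<close> and \<open>G\<close> in the interval bases. A nonzero entry \<open>F i j\<close> forces the birth and the death of
\<open>j\<close> to exceed those of \<open>i\<close> by at most \<open>\<epsilon>\<close>, and similarly for \<open>G\<close>; the entry \<open>(i, k)\<close> of
their product is that of the identity matrix whenever \<open>k\<close> is alive at time \<open>2\<epsilon>\<close> after the birth of a
bar \<open>i\<close>. Order a set \<open>J\<close> of bars longer than \<open>2\<epsilon>\<close> by birth
plus death. A bar \<open>j\<close> contributing to an entry \<open>(i, k)\<close> of the product with \<open>i \<le> k\<close> in this order must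
lie within \<open>\<epsilon>\<close> of \<open>i\<close> or of \<open>k\<close>. So the product taken only over the bars within \<open>\<epsilon>\<close> of some member of
\<open>J\<close> is still unitriangular, and there are at least \<open>card J\<close> such bars. This is Hall's condition, and it
gives an injective \<open>\<epsilon>\<close>-matching of the long bars (\<open>long_intervals_matching\<close>). The remaining bars are
within \<open>\<epsilon>\<close> of the diagonal. The resulting injections in both directions are merged by the
Schroeder--Bernstein construction into a bijection that moves every point by at most \<open>\<epsilon>\<close>
(\<open>bottleneck_dist_le\<close>).\<close>

section \<open>Combinatorial and linear-algebraic preliminaries\<close>

text \<open>Halmos and Vaughan: if every proper nonempty subset has a surplus of neighbours, any one element may
be matched arbitrarily; otherwise a tight subset splits the problem into two smaller ones.\<close>

lemma hall_marriage:
  fixes N :: "'a \<Rightarrow> 'b set"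
  assumes "finite A" "\<And>i. i \<in> A \<Longrightarrow> finite (N i)"
    and "\<And>J. J \<subseteq> A \<Longrightarrow> card J \<le> card (\<Union>(N ` J))"
  shows "\<exists>f. inj_on f A \<and> (\<forall>i\<in>A. f i \<in> N i)"
  using assms
proof (induction "card A" arbitrary: A N rule: less_induct)
  case less
  note fin = less.prems(1) and finN = less.prems(2) and hall = less.prems(3)
  show ?case
  proof (cases "A = {}")
    case True
    then show ?thesis by auto
  next
    case False
    show ?thesis
    proof (cases "\<forall>J. J \<subset> A \<and> J \<noteq> {} \<longrightarrow> card J < card (\<Union>(N ` J))")
      case strict: True
      obtain a where a: "a \<in> A" using False by auto
      have "card {a} \<le> card (N a)" using hall[of "{a}"] a by auto
      then obtain x where x: "x \<in> N a" by fastforce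
      let ?A = "A - {a}" and ?N = "\<lambda>i. N i - {x}"
      have "\<exists>f. inj_on f ?A \<and> (\<forall>i\<in>?A. f i \<in> ?N i)"
      proof (rule less.hyps)
        show "card ?A < card A" using fin a by (rule card_Diff1_less)
        show "finite ?A" using fin by auto
        show "finite (?N i)" if "i \<in> ?A" for i using finN that by auto
        fix J assume J: "J \<subseteq> ?A"
        show "card J \<le> card (\<Union>(?N ` J))"
        proof (cases "J = {}")
          case False
          have "J \<subset> A" using J a by auto
          then have "card J < card (\<Union>(N ` J))" using strict False by blast
          moreover have "\<Union>(?N ` J) = \<Union>(N ` J) - {x}" by auto
          moreover have "card (\<Union>(N ` J)) - 1 \<le> card (\<Union>(N ` J) - {x})"
            by (simp add: card_Diff_singleton_if)
          ultimately show ?thesis by simp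
        qed auto
      qed
      then obtain f where f: "inj_on f ?A" "\<forall>i\<in>?A. f i \<in> ?N i" by blast
      have "inj_on (f(a := x)) A"
        using f a unfolding inj_on_def by auto
      moreover have "\<forall>i\<in>A. (f(a := x)) i \<in> N i" using f x by auto
      ultimately show ?thesis by blast
    next
      case False
      then obtain K where K: "K \<subset> A" "K \<noteq> {}" "\<not> card K < card (\<Union>(N ` K))" by blast
      let ?U = "\<Union>(N ` K)"
      have finK: "finite K" using K fin by (meson finite_subset psubset_imp_subset)
      have cK: "card K = card ?U" using K hall[of K] by auto
      have "\<exists>f. inj_on f K \<and> (\<forall>i\<in>K. f i \<in> N i)"
      proof (rule less.hyps)
        show "card K < card A" using K fin by (simp add: psubset_card_mono)
        show "card J \<le> card (\<Union>(N ` J))" if "J \<subseteq> K" for J using hall[of J] that K by auto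
      qed (use finK finN K in auto)
      then obtain f where f: "inj_on f K" "\<forall>i\<in>K. f i \<in> N i" by blast
      let ?N = "\<lambda>i. N i - ?U"
      have "\<exists>g. inj_on g (A - K) \<and> (\<forall>i\<in>A - K. g i \<in> ?N i)"
      proof (rule less.hyps)
        show "card (A - K) < card A"
          using K fin finK by (intro psubset_card_mono) auto
        show "finite (A - K)" using fin by auto
        show "finite (?N i)" if "i \<in> A - K" for i using finN that by auto
        fix J assume J: "J \<subseteq> A - K"
        have finJ: "finite J" using J fin by (meson finite_Diff finite_subset)
        have "card J + card K = card (J \<union> K)"
          using finJ finK J by (subst card_Un_disjoint) auto
        also have "\<dots> \<le> card (\<Union>(N ` (J \<union> K)))" using hall[of "J \<union> K"] J K by auto
        also have "\<Union>(N ` (J \<union> K)) = \<Union>(?N ` J) \<union> ?U" by auto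
        also have "card \<dots> \<le> card (\<Union>(?N ` J)) + card ?U" by (rule card_Un_le)
        finally show "card J \<le> card (\<Union>(?N ` J))" using cK by simp
      qed
      then obtain g where g: "inj_on g (A - K)" "\<forall>i\<in>A - K. g i \<in> ?N i" by blast
      let ?h = "\<lambda>i. if i \<in> K then f i else g i"
      have "inj_on ?h A"
      proof (rule inj_onI)
        fix i j assume ij: "i \<in> A" "j \<in> A" "?h i = ?h j"
        have sep: "g b \<noteq> f a" if "a \<in> K" "b \<in> A - K" for a b
          using f g that by (metis DiffD2 UN_I)
        show "i = j"
          using ij sep[of i j] sep[of j i] inj_onD[OF f(1), of i j] inj_onD[OF g(1), of i j]
          by (cases "i \<in> K"; cases "j \<in> K") auto
      qed
      moreover have "\<forall>i\<in>A. ?h i \<in> N i" using f g by auto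
      ultimately show ?thesis by blast
    qed
  qed
qed

text \<open>The bijection of the Schroeder--Bernstein theorem agrees at each point with \<open>f\<close> or with the inverse
of \<open>g\<close>, so it respects every relation that both injections respect.\<close>

lemma schroeder_bernstein_relation:
  assumes f: "inj_on f X" "f ` X \<subseteq> Y" and g: "inj_on g Y" "g ` Y \<subseteq> X"
    and Ef: "\<And>x. x \<in> X \<Longrightarrow> E x (f x)" and Eg: "\<And>y. y \<in> Y \<Longrightarrow> E (g y) y"
  shows "\<exists>h. bij_betw h X Y \<and> (\<forall>x\<in>X. E x (h x))"
proof -
  define S where "S = lfp (\<lambda>S. X - g ` (Y - f ` S))"
  have "mono (\<lambda>S. X - g ` (Y - f ` S))"
    by (rule monoI) (meson Diff_mono image_mono order_refl)
  then have S: "S = X - g ` (Y - f ` S)" unfolding S_def by (rule lfp_unfold)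
  define T where "T = Y - f ` S"
  have SX: "S \<subseteq> X" by (subst S) (rule Diff_subset)
  have gT: "g ` T = X - S" unfolding T_def using g(2) by (subst (2) S) blast
  have b1: "bij_betw f S (f ` S)" using f SX by (auto simp: bij_betw_def inj_on_subset)
  have "bij_betw g T (X - S)" using g gT by (auto simp: bij_betw_def T_def inj_on_subset)
  then have b2: "bij_betw (inv_into T g) (X - S) T" by (rule bij_betw_inv_into)
  let ?h = "\<lambda>x. if x \<in> S then f x else inv_into T g x"
  have "bij_betw ?h (S \<union> (X - S)) (f ` S \<union> T)"
    by (rule bij_betw_disjoint_Un[OF b1 b2]) (auto simp: T_def)
  moreover have "S \<union> (X - S) = X" "f ` S \<union> T = Y" using SX f(2) by (auto simp: T_def)
  moreover have "E x (?h x)" if x: "x \<in> X" for x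
  proof (cases "x \<in> S")
    case False
    then have "x \<in> g ` T" using gT x by auto
    then have "inv_into T g x \<in> T" "g (inv_into T g x) = x"
      by (auto simp: inv_into_into f_inv_into_f)
    then show ?thesis using Eg[of "inv_into T g x"] False by (auto simp: T_def)
  qed (use x Ef in auto)
  ultimately show ?thesis by (intro exI[of _ ?h]) simp
qed

text \<open>Gaussian elimination: an equation with a nonzero coefficient at \<open>a\<close> is used to eliminate the
unknown \<open>a\<close> from the others.\<close>

lemma underdetermined_system_solution:
  fixes F :: "'i \<Rightarrow> 'j \<Rightarrow> 'k::field"
  assumes "finite S" "finite A" "card S < card A"
  shows "\<exists>c. (\<exists>i\<in>A. c i \<noteq> 0) \<and> (\<forall>j\<in>S. (\<Sum>i\<in>A. c i * F i j) = 0)"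
  using assms
proof (induction S arbitrary: A F rule: finite_induct)
  case empty
  then have "A \<noteq> {}" by auto
  then show ?case by (intro exI[of _ "\<lambda>_. 1"]) auto
next
  case (insert s S)
  show ?case
  proof (cases "\<forall>i\<in>A. F i s = 0")
    case True
    have "card S < card A" using insert by auto
    then obtain c where "\<exists>i\<in>A. c i \<noteq> 0" "\<forall>j\<in>S. (\<Sum>i\<in>A. c i * F i j) = 0"
      using insert.IH[of A F] insert.prems by blast
    then show ?thesis using True by (intro exI[of _ c]) auto
  next
    case False
    then obtain a where a: "a \<in> A" "F a s \<noteq> 0" by auto
    let ?A = "A - {a}"
    have finA: "finite A" by fact
    define F' where "F' i j = F i j - F i s / F a s * F a j" for i j
    have "card S < card ?A" using insert a by simp
    then obtain c where c: "\<exists>i\<in>?A. c i \<noteq> 0" "\<forall>j\<in>S. (\<Sum>i\<in>?A. c i * F' i j) = 0"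
      using insert.IH[of ?A F'] finA by blast
    define e where "e = c(a := - (\<Sum>i\<in>?A. c i * F i s) / F a s)"
    have split: "(\<Sum>i\<in>A. e i * F i j) = e a * F a j + (\<Sum>i\<in>?A. c i * F i j)" for j
    proof -
      have "(\<Sum>i\<in>A. e i * F i j) = e a * F a j + (\<Sum>i\<in>?A. e i * F i j)"
        using a finA by (simp add: sum.remove)
      also have "(\<Sum>i\<in>?A. e i * F i j) = (\<Sum>i\<in>?A. c i * F i j)"
        by (rule sum.cong) (auto simp: e_def)
      finally show ?thesis .
    qed
    have "(\<Sum>i\<in>A. e i * F i s) = 0" using a by (subst split) (simp add: e_def)
    moreover have "(\<Sum>i\<in>A. e i * F i j) = 0" if "j \<in> S" for j
    proof -
      have "(\<Sum>i\<in>A. e i * F i j)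
          = - ((\<Sum>i\<in>?A. c i * F i s) / F a s) * F a j + (\<Sum>i\<in>?A. c i * F i j)"
        by (subst split) (simp add: e_def)
      also have "\<dots> = (\<Sum>i\<in>?A. c i * F' i j)"
        by (simp add: F'_def algebra_simps sum_subtractf sum_distrib_left sum_distrib_right sum_divide_distrib)
      finally show ?thesis using c that by simp
    qed
    moreover have "\<exists>i\<in>A. e i \<noteq> 0" using c by (auto simp: e_def)
    ultimately show ?thesis by (intro exI[of _ e]) auto
  qed
qed

text \<open>The hypothesis says that the product of an \<open>A\<close>-by-\<open>S\<close> and an \<open>S\<close>-by-\<open>A\<close> matrix is unitriangular up to
the order of the index set, hence invertible, so its rank \<open>card A\<close> is at most \<open>card S\<close>. Indices with
equal \<open>\<alpha>\<close> are covered by the hypothesis in both directions, so ties are harmless.\<close>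

lemma card_le_of_triangular_product:
  fixes F :: "'i \<Rightarrow> 'j \<Rightarrow> 'k::field" and \<alpha> :: "'i \<Rightarrow> real"
  assumes "finite A" "finite S"
    and tri: "\<And>i k. i \<in> A \<Longrightarrow> k \<in> A \<Longrightarrow> \<alpha> i \<le> \<alpha> k \<Longrightarrow>
      (\<Sum>j\<in>S. F i j * G j k) = (if i = k then 1 else 0)"
  shows "card A \<le> card S"
proof (rule ccontr)
  assume "\<not> card A \<le> card S"
  then obtain c where c: "\<exists>i\<in>A. c i \<noteq> 0" "\<forall>j\<in>S. (\<Sum>i\<in>A. c i * F i j) = 0"
    using underdetermined_system_solution[of S A F] assms by auto
  let ?C = "{i\<in>A. c i \<noteq> 0}"
  have "finite ?C" "?C \<noteq> {}" using c assms by auto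
  then have "Max (\<alpha> ` ?C) \<in> \<alpha> ` ?C" by (intro Max_in) auto
  then obtain k where k: "k \<in> ?C" "Max (\<alpha> ` ?C) = \<alpha> k" by auto
  have max: "\<alpha> i \<le> \<alpha> k" if "i \<in> ?C" for i
    unfolding k(2)[symmetric] using \<open>finite ?C\<close> that by (intro Max_ge finite_imageI imageI)
  \<comment> \<open>A row combination killed by \<open>F\<close> is killed by the product, but its entry at the last index \<open>k\<close>
    of its support is \<open>c k\<close>.\<close>
  have "0 = (\<Sum>j\<in>S. (\<Sum>i\<in>A. c i * F i j) * G j k)" using c(2) by simp
  also have "\<dots> = (\<Sum>j\<in>S. \<Sum>i\<in>A. c i * (F i j * G j k))"
    by (simp add: sum_distrib_right mult.assoc)
  also have "\<dots> = (\<Sum>i\<in>A. \<Sum>j\<in>S. c i * (F i j * G j k))" by (rule sum.swap)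
  also have "\<dots> = (\<Sum>i\<in>A. c i * (\<Sum>j\<in>S. F i j * G j k))" by (simp add: sum_distrib_left)
  also have "\<dots> = (\<Sum>i\<in>A. if i = k then c i else 0)"
  proof (rule sum.cong[OF refl])
    fix i assume i: "i \<in> A"
    show "c i * (\<Sum>j\<in>S. F i j * G j k) = (if i = k then c i else 0)"
    proof (cases "c i = 0")
      case False
      then show ?thesis using tri[of i k] i k(1) max[of i] by auto
    qed auto
  qed
  also have "\<dots> = c k" using k(1) assms by simp
  finally show False using k(1) by simp
qed

section \<open>Interleaved families of subquotients\<close>

locale subquotient_filtration = vector_space scale
  for scale :: "'k::field \<Rightarrow> 'e::ab_group_add \<Rightarrow> 'e" (infixr \<open>*s\<close> 75) +
  fixes Z B :: "real \<Rightarrow> 'e set"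
  assumes subspace_Z: "subspace (Z t)" and subspace_B: "subspace (B t)"
    and Z_mono: "s \<le> t \<Longrightarrow> Z s \<subseteq> Z t" and B_mono: "s \<le> t \<Longrightarrow> B s \<subseteq> B t"
    and B_le_Z: "B t \<subseteq> Z t"

definition alive :: "'i set \<Rightarrow> ('i \<Rightarrow> real) \<Rightarrow> ('i \<Rightarrow> ereal) \<Rightarrow> real \<Rightarrow> 'i set" where
  "alive L \<beta> d t = {i\<in>L. \<beta> i \<le> t \<and> ereal t < d i}"

context subquotient_filtration
begin

text \<open>A decomposition of the family \<open>Z t / B t\<close> into interval modules, expressed by representatives: a
single vector \<open>z i\<close> represents the bar \<open>i\<close> at all times at which it is alive.\<close>

definition interval_basis ::
  "'i set \<Rightarrow> ('i \<Rightarrow> real) \<Rightarrow> ('i \<Rightarrow> ereal) \<Rightarrow> ('i \<Rightarrow> 'e) \<Rightarrow> bool" where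
  "interval_basis L \<beta> d z \<longleftrightarrow>
     finite L \<and> (\<forall>i\<in>L. ereal (\<beta> i) < d i) \<and>
     (\<forall>i\<in>L. \<forall>t. \<beta> i \<le> t \<longrightarrow> z i \<in> Z t) \<and>
     (\<forall>i\<in>L. \<forall>t. d i \<le> ereal t \<longrightarrow> z i \<in> B t) \<and>
     (\<forall>t. \<forall>x\<in>Z t. \<exists>c. x - (\<Sum>i\<in>alive L \<beta> d t. c i *s z i) \<in> B t) \<and>
     (\<forall>t c. (\<Sum>i\<in>alive L \<beta> d t. c i *s z i) \<in> B t \<longrightarrow> (\<forall>i\<in>alive L \<beta> d t. c i = 0))"

lemma B_sumI: "(\<And>i. i \<in> A \<Longrightarrow> f i \<in> B t) \<Longrightarrow> (\<Sum>i\<in>A. f i) \<in> B t"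
  by (rule subspace_sum[OF subspace_B])

lemma B_cancel_left: "y \<in> B t \<Longrightarrow> x = y + w \<Longrightarrow> x \<in> B t \<Longrightarrow> w \<in> B t"
  using subspace_diff[OF subspace_B, of x t y] by simp

lemma B_diff_trans: "x - y \<in> B t \<Longrightarrow> y - w \<in> B t \<Longrightarrow> x - w \<in> B t"
  using subspace_add[OF subspace_B, of "x - y" t "y - w"] by simp

end

locale interleaving =
  M: subquotient_filtration s1 Z B + N: subquotient_filtration s2 Z' B'
  for s1 :: "'k::field \<Rightarrow> 'e::ab_group_add \<Rightarrow> 'e" (infixr \<open>*s1\<close> 75) and Z B
    and s2 :: "'k \<Rightarrow> 'f::ab_group_add \<Rightarrow> 'f" (infixr \<open>*s2\<close> 75) and Z' B' +
  fixes f :: "'e \<Rightarrow> 'f" and g :: "'f \<Rightarrow> 'e" and \<epsilon> :: real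
  assumes eps: "\<epsilon> \<ge> 0"
    and lin_f: "Vector_Spaces.linear s1 s2 f" and lin_g: "Vector_Spaces.linear s2 s1 g"
    and f_Z: "x \<in> Z t \<Longrightarrow> f x \<in> Z' (t + \<epsilon>)" and f_B: "x \<in> B t \<Longrightarrow> f x \<in> B' (t + \<epsilon>)"
    and g_Z: "y \<in> Z' t \<Longrightarrow> g y \<in> Z (t + \<epsilon>)" and g_B: "y \<in> B' t \<Longrightarrow> g y \<in> B (t + \<epsilon>)"
    and gf: "x \<in> Z t \<Longrightarrow> g (f x) - x \<in> B (t + 2 * \<epsilon>)"
    and fg: "y \<in> Z' t \<Longrightarrow> f (g y) - y \<in> B' (t + 2 * \<epsilon>)"

lemma interleaving_swap:
  assumes "interleaving s1 Z B s2 Z' B' f g \<epsilon>"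
  shows "interleaving s2 Z' B' s1 Z B g f \<epsilon>"
  using assms unfolding interleaving_def interleaving_axioms_def by auto

context interleaving
begin

text \<open>Expanding the image of a bar at its birth gives the conditions on births, as only bars alive at that
time occur. The condition on deaths comes from following the image until the bar \<open>i\<close> dies: the image
then bounds, so no bar still alive can have a nonzero coefficient.\<close>

lemma matrix_of_morphism:
  assumes M: "M.interval_basis L \<beta> d z" and N: "N.interval_basis L' \<beta>' d' z'"
  shows "\<exists>F. \<forall>i\<in>L. (\<forall>j. F i j \<noteq> 0 \<longrightarrow> j \<in> L' \<and> \<beta>' j \<le> \<beta> i + \<epsilon> \<and>
            ereal (\<beta> i + \<epsilon>) < d' j \<and> d' j \<le> d i + ereal \<epsilon>) \<and>
          f (z i) - (\<Sum>j\<in>L'. F i j *s2 z' j) \<in> B' (\<beta> i + \<epsilon>)"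
proof -
  interpret f: Vector_Spaces.linear s1 s2 f by (rule lin_f)
  have "\<exists>G. (\<forall>j. G j \<noteq> 0 \<longrightarrow> j \<in> L' \<and> \<beta>' j \<le> \<beta> i + \<epsilon> \<and>
            ereal (\<beta> i + \<epsilon>) < d' j \<and> d' j \<le> d i + ereal \<epsilon>) \<and>
          f (z i) - (\<Sum>j\<in>L'. G j *s2 z' j) \<in> B' (\<beta> i + \<epsilon>)" if i: "i \<in> L" for i
  proof -
    let ?s = "\<beta> i + \<epsilon>" and ?A = "alive L' \<beta>' d' (\<beta> i + \<epsilon>)"
    have finL': "finite L'" using N by (simp add: N.interval_basis_def)
    have "z i \<in> Z (\<beta> i)" using M i by (simp add: M.interval_basis_def)
    then have "f (z i) \<in> Z' ?s" by (rule f_Z)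
    then obtain c where c: "f (z i) - (\<Sum>j\<in>?A. c j *s2 z' j) \<in> B' ?s"
      using N unfolding N.interval_basis_def by metis
    define G where "G j = (if j \<in> ?A then c j else 0)" for j
    have sumG: "(\<Sum>j\<in>L'. G j *s2 z' j) = (\<Sum>j\<in>?A. c j *s2 z' j)"
      by (rule sum.mono_neutral_cong_right) (auto simp: finL' G_def alive_def)
    have "d' j \<le> d i + ereal \<epsilon>" if j: "G j \<noteq> 0" for j
    proof (rule ccontr)
      assume not: "\<not> d' j \<le> d i + ereal \<epsilon>"
      then obtain r where r: "d i = ereal r"
        using M i by (cases "d i") (auto simp: M.interval_basis_def)
      have jA: "j \<in> ?A" using j by (auto simp: G_def split: if_splits)
      have br: "\<beta> i < r" using M i r by (auto simp: M.interval_basis_def)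
      let ?C = "alive L' \<beta>' d' (r + \<epsilon>)"
      have "z i \<in> B r" using M i r by (auto simp: M.interval_basis_def)
      then have fB: "f (z i) \<in> B' (r + \<epsilon>)" by (rule f_B)
      have "B' ?s \<subseteq> B' (r + \<epsilon>)" using br by (intro N.B_mono) auto
      then have "(\<Sum>j\<in>L'. G j *s2 z' j) \<in> B' (r + \<epsilon>)"
        using N.subspace_diff[OF N.subspace_B fB, of "f (z i) - (\<Sum>j\<in>L'. G j *s2 z' j)"]
          c sumG by auto
      moreover have "(\<Sum>j\<in>L' - ?C. G j *s2 z' j) \<in> B' (r + \<epsilon>)"
      proof (rule N.B_sumI)
        fix k assume k: "k \<in> L' - ?C"
        show "G k *s2 z' k \<in> B' (r + \<epsilon>)"
        proof (cases "k \<in> ?A")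
          case True
          then have "d' k \<le> ereal (r + \<epsilon>)" using k br by (auto simp: alive_def)
          then have "z' k \<in> B' (r + \<epsilon>)" using N k by (auto simp: N.interval_basis_def)
          then show ?thesis by (rule N.subspace_scale[OF N.subspace_B])
        next
          case False
          then show ?thesis using N.subspace_0[OF N.subspace_B] by (simp add: G_def)
        qed
      qed
      moreover have "(\<Sum>j\<in>L'. G j *s2 z' j)
          = (\<Sum>j\<in>L' - ?C. G j *s2 z' j) + (\<Sum>j\<in>?C. G j *s2 z' j)"
        by (rule sum.subset_diff) (auto simp: alive_def finL')
      ultimately have "(\<Sum>j\<in>?C. G j *s2 z' j) \<in> B' (r + \<epsilon>)"
        by (rule N.B_cancel_left[rotated 2])
      then have "\<forall>k\<in>?C. G k = 0" using N unfolding N.interval_basis_def by blast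
      moreover have "j \<in> ?C" using jA not r br by (auto simp: alive_def)
      ultimately show False using j by auto
    qed
    then show ?thesis using c sumG
      by (intro exI[of _ G]) (auto simp: G_def alive_def split: if_splits)
  qed
  then show ?thesis by metis
qed

text \<open>Both sides are coefficients of \<open>z i\<close> modulo \<open>B\<close> at time \<open>\<beta> i + 2 * \<epsilon>\<close>: the composite of the two
maps is the identity there.\<close>

lemma product_of_morphism_matrices:
  assumes M: "M.interval_basis L \<beta> d z" and N: "N.interval_basis L' \<beta>' d' z'"
    and i: "i \<in> L"
    and F: "\<And>j. F i j \<noteq> 0 \<Longrightarrow> j \<in> L' \<and> \<beta>' j \<le> \<beta> i + \<epsilon>"
      "f (z i) - (\<Sum>j\<in>L'. F i j *s2 z' j) \<in> B' (\<beta> i + \<epsilon>)"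
    and G: "\<And>j k. j \<in> L' \<Longrightarrow> G j k \<noteq> 0 \<Longrightarrow> \<beta> k \<le> \<beta>' j + \<epsilon>"
      "\<And>j. j \<in> L' \<Longrightarrow> g (z' j) - (\<Sum>k\<in>L. G j k *s1 z k) \<in> B (\<beta>' j + \<epsilon>)"
    and k: "k \<in> alive L \<beta> d (\<beta> i + 2 * \<epsilon>)"
  shows "(\<Sum>j\<in>L'. F i j * G j k) = (if i = k then 1 else 0)"
proof -
  interpret g: Vector_Spaces.linear s2 s1 g by (rule lin_g)
  let ?s = "\<beta> i + 2 * \<epsilon>"
  let ?C = "alive L \<beta> d ?s"
  define P where "P k = (\<Sum>j\<in>L'. F i j * G j k)" for k
  define Q where "Q k = P k - (if i = k then 1 else 0)" for k
  have finL: "finite L" "finite L'" using M N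
    by (auto simp: N.interval_basis_def M.interval_basis_def)
  have "z i \<in> Z (\<beta> i)" using M i by (simp add: M.interval_basis_def)
  then have a1: "g (f (z i)) - z i \<in> B ?s" by (rule gf)
  have "g (f (z i) - (\<Sum>j\<in>L'. F i j *s2 z' j)) \<in> B (\<beta> i + \<epsilon> + \<epsilon>)"
    by (rule g_B[OF F(2)])
  then have a2: "g (f (z i)) - (\<Sum>j\<in>L'. F i j *s1 g (z' j)) \<in> B ?s"
    by (simp add: g.diff g.sum g.scale add.assoc)
  have "(\<Sum>j\<in>L'. F i j *s1 (g (z' j) - (\<Sum>k\<in>L. G j k *s1 z k))) \<in> B ?s"
  proof (rule M.B_sumI)
    fix j assume j: "j \<in> L'"
    show "F i j *s1 (g (z' j) - (\<Sum>k\<in>L. G j k *s1 z k)) \<in> B ?s"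
    proof (cases "F i j = 0")
      case True
      then show ?thesis using M.subspace_0[OF M.subspace_B] by simp
    next
      case False
      then have "B (\<beta>' j + \<epsilon>) \<subseteq> B ?s" using F(1)[of j] by (intro M.B_mono) auto
      then show ?thesis using G(2)[OF j] by (auto intro: M.subspace_scale[OF M.subspace_B])
    qed
  qed
  also have "(\<Sum>j\<in>L'. F i j *s1 (g (z' j) - (\<Sum>k\<in>L. G j k *s1 z k)))
      = (\<Sum>j\<in>L'. F i j *s1 g (z' j)) - (\<Sum>j\<in>L'. \<Sum>k\<in>L. (F i j * G j k) *s1 z k)"
    by (simp add: M.scale_right_diff_distrib M.scale_sum_right sum_subtractf)
  also have "(\<Sum>j\<in>L'. \<Sum>k\<in>L. (F i j * G j k) *s1 z k) = (\<Sum>k\<in>L. P k *s1 z k)"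
    by (subst sum.swap) (simp add: P_def M.scale_sum_left)
  finally have a3: "(\<Sum>j\<in>L'. F i j *s1 g (z' j)) - (\<Sum>k\<in>L. P k *s1 z k) \<in> B ?s" .
  have "(\<Sum>k\<in>L. P k *s1 z k) - z i \<in> B ?s"
    using M.subspace_diff[OF M.subspace_B a1 M.B_diff_trans[OF a2 a3]] by simp
  moreover have "(\<Sum>k\<in>L. Q k *s1 z k) = (\<Sum>k\<in>L. P k *s1 z k) - z i"
  proof -
    have "(\<Sum>k\<in>L. Q k *s1 z k)
        = (\<Sum>k\<in>L. P k *s1 z k) - (\<Sum>k\<in>L. if i = k then z k else 0)"
      unfolding sum_subtractf[symmetric] Q_def
      by (rule sum.cong) (auto simp: M.scale_left_diff_distrib)
    then show ?thesis using i finL by simp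
  qed
  ultimately have Q: "(\<Sum>k\<in>L. Q k *s1 z k) \<in> B ?s" by simp
  have "(\<Sum>k\<in>L - ?C. Q k *s1 z k) \<in> B ?s"
  proof (rule M.B_sumI)
    fix k assume k: "k \<in> L - ?C"
    \<comment> \<open>A bar that is not alive at \<open>?s\<close> has already died, or it is not yet born and its coefficient
      vanishes.\<close>
    show "Q k *s1 z k \<in> B ?s"
    proof (cases "\<beta> k \<le> ?s")
      case True
      then have "z k \<in> B ?s" using k M by (auto simp: alive_def M.interval_basis_def)
      then show ?thesis by (rule M.subspace_scale[OF M.subspace_B])
    next
      case False
      have "F i j * G j k = 0" if "j \<in> L'" for j
      proof (rule ccontr)
        assume "F i j * G j k \<noteq> 0"
        then show False using F(1)[of j] G(1)[OF that, of k] False by auto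
      qed
      then have "P k = 0" unfolding P_def by (intro sum.neutral) auto
      moreover have "i \<noteq> k" using False eps by auto
      ultimately show ?thesis using M.subspace_0[OF M.subspace_B] by (simp add: Q_def)
    qed
  qed
  moreover have "(\<Sum>k\<in>L. Q k *s1 z k) = (\<Sum>k\<in>L - ?C. Q k *s1 z k) + (\<Sum>k\<in>?C. Q k *s1 z k)"
    by (rule sum.subset_diff) (auto simp: alive_def finL)
  ultimately have "(\<Sum>k\<in>?C. Q k *s1 z k) \<in> B ?s"
    using Q by (rule M.B_cancel_left)
  then have "\<forall>k\<in>?C. Q k = 0" using M unfolding M.interval_basis_def by blast
  then show ?thesis using k by (auto simp: Q_def P_def)
qed

end

text \<open>If \<open>F i j\<close> and \<open>G j k\<close> are nonzero and \<open>j\<close> is close to neither \<open>i\<close> nor \<open>k\<close>, then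
\<open>\<beta>' j + \<tau>' j\<close> is smaller than \<open>\<beta> i + \<tau> i\<close> and larger than \<open>\<beta> k + \<tau> k\<close>. Hence, for
\<open>\<beta> i + \<tau> i \<le> \<beta> k + \<tau> k\<close>, only the close bars contribute to the product, and the rank bound for
triangular products is Hall's condition.\<close>

lemma matching_of_triangular_matrices:
  fixes F :: "'i \<Rightarrow> 'j \<Rightarrow> 'k::field" and \<beta> \<tau> :: "'i \<Rightarrow> real" and \<beta>' \<tau>' :: "'j \<Rightarrow> real"
  assumes "finite A" "finite L'" and eps: "\<epsilon> \<ge> 0"
    and long: "\<And>i. i \<in> A \<Longrightarrow> \<beta> i + 2 * \<epsilon> < \<tau> i"
    and F: "\<And>i j. i \<in> A \<Longrightarrow> j \<in> L' \<Longrightarrow> F i j \<noteq> 0 \<Longrightarrow> \<beta>' j \<le> \<beta> i + \<epsilon> \<and> \<tau>' j \<le> \<tau> i + \<epsilon>"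
    and G: "\<And>j k. j \<in> L' \<Longrightarrow> k \<in> A \<Longrightarrow> G j k \<noteq> 0 \<Longrightarrow> \<beta> k \<le> \<beta>' j + \<epsilon> \<and> \<tau> k \<le> \<tau>' j + \<epsilon>"
    and prod: "\<And>i k. i \<in> A \<Longrightarrow> k \<in> A \<Longrightarrow> \<beta> k \<le> \<beta> i + 2 * \<epsilon> \<Longrightarrow> \<beta> i + 2 * \<epsilon> < \<tau> k \<Longrightarrow>
      (\<Sum>j\<in>L'. F i j * G j k) = (if i = k then 1 else 0)"
  shows "\<exists>m. inj_on m A \<and> (\<forall>i\<in>A. m i \<in> L' \<and> \<bar>\<beta> i - \<beta>' (m i)\<bar> \<le> \<epsilon> \<and> \<bar>\<tau> i - \<tau>' (m i)\<bar> \<le> \<epsilon>)"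
proof -
  define N where "N i = {j\<in>L'. \<bar>\<beta> i - \<beta>' j\<bar> \<le> \<epsilon> \<and> \<bar>\<tau> i - \<tau>' j\<bar> \<le> \<epsilon>}" for i
  have "card J \<le> card (\<Union>(N ` J))" if J: "J \<subseteq> A" for J
  proof (rule card_le_of_triangular_product[where F = F and G = G and \<alpha> = "\<lambda>i. \<beta> i + \<tau> i"])
    show "finite J" using J \<open>finite A\<close> by (rule finite_subset)
    have NL': "\<Union>(N ` J) \<subseteq> L'" by (auto simp: N_def)
    then show "finite (\<Union>(N ` J))" using \<open>finite L'\<close> by (rule finite_subset)
    fix i k assume i: "i \<in> J" and k: "k \<in> J" and le: "\<beta> i + \<tau> i \<le> \<beta> k + \<tau> k"
    have ik: "i \<in> A" "k \<in> A" using i k J by auto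
    have zero: "F i j * G j k = 0" if j: "j \<in> L' - \<Union>(N ` J)" for j
    proof (rule ccontr)
      assume "F i j * G j k \<noteq> 0"
      then have "\<beta>' j \<le> \<beta> i + \<epsilon>" "\<tau>' j \<le> \<tau> i + \<epsilon>" "\<beta> k \<le> \<beta>' j + \<epsilon>" "\<tau> k \<le> \<tau>' j + \<epsilon>"
        using F[of i j] G[of j k] ik j by auto
      moreover have "\<not> (\<bar>\<beta> i - \<beta>' j\<bar> \<le> \<epsilon> \<and> \<bar>\<tau> i - \<tau>' j\<bar> \<le> \<epsilon>)"
        "\<not> (\<bar>\<beta> k - \<beta>' j\<bar> \<le> \<epsilon> \<and> \<bar>\<tau> k - \<tau>' j\<bar> \<le> \<epsilon>)"
        using j i k by (auto simp: N_def)
      ultimately show False using le by linarith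
    qed
    have "(\<Sum>j\<in>\<Union>(N ` J). F i j * G j k) = (\<Sum>j\<in>L'. F i j * G j k)"
      by (rule sum.mono_neutral_left) (use zero NL' assms in auto)
    also have "\<dots> = (if i = k then 1 else 0)"
    proof (cases "\<beta> k \<le> \<beta> i + 2 * \<epsilon> \<and> \<beta> i + 2 * \<epsilon> < \<tau> k")
      case True
      then show ?thesis using prod ik by blast
    next
      case False
      \<comment> \<open>A long bar \<open>k\<close> that is dead by this time would precede \<open>i\<close> in the order.\<close>
    have "\<not> \<tau> k \<le> \<beta> i + 2 * \<epsilon>" using long[OF ik(1)] long[OF ik(2)] le by linarith
      then have far: "\<beta> i + 2 * \<epsilon> < \<beta> k" using False by auto
      have "F i j * G j k = 0" if j: "j \<in> L'" for j
        using F[of i j] G[of j k] ik j far by (cases "F i j = 0"; cases "G j k = 0") auto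
      moreover have "i \<noteq> k" using far eps by auto
      ultimately show ?thesis by simp
    qed
    finally show "(\<Sum>j\<in>\<Union>(N ` J). F i j * G j k) = (if i = k then 1 else 0)" .
  qed
  moreover have "finite (N i)" for i using assms by (simp add: N_def)
  ultimately obtain m where "inj_on m A" "\<forall>i\<in>A. m i \<in> N i"
    using hall_marriage[OF \<open>finite A\<close>] by metis
  then show ?thesis unfolding N_def by blast
qed

text \<open>Infinite death times are replaced by a real number \<open>T\<close> so that births and deaths can be added. If
\<open>T\<close> exceeds all finite deaths by more than \<open>\<epsilon>\<close>, closeness of truncated deaths is closeness of deaths.\<close>

definition truncate :: "real \<Rightarrow> ereal \<Rightarrow> real" where
  "truncate T e = (if e = \<infinity> then T else real_of_ereal e)"

lemma truncation_bound:
  assumes "finite L" "\<epsilon> \<ge> 0"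
  shows "\<exists>T0. \<forall>T\<ge>T0. \<forall>i\<in>L. \<beta> i + 2 * \<epsilon> < T \<and> real_of_ereal (d i) + \<epsilon> < T"
proof (intro exI allI impI ballI)
  let ?h = "\<lambda>i. \<bar>\<beta> i\<bar> + \<bar>real_of_ereal (d i)\<bar>"
  fix T i assume T: "1 + 2 * \<epsilon> + sum ?h L \<le> T" and i: "i \<in> L"
  have "?h i \<le> sum ?h L" using i assms by (intro member_le_sum add_nonneg_nonneg abs_ge_zero)
  then show "\<beta> i + 2 * \<epsilon> < T \<and> real_of_ereal (d i) + \<epsilon> < T" using T assms by (intro conjI; linarith)
qed

lemma (in interleaving) long_intervals_matching:
  assumes M: "M.interval_basis L \<beta> d z" and N: "N.interval_basis L' \<beta>' d' z'"
  shows "\<exists>m. inj_on m {i\<in>L. ereal (\<beta> i + 2 * \<epsilon>) < d i} \<and>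
    (\<forall>i\<in>{i\<in>L. ereal (\<beta> i + 2 * \<epsilon>) < d i}. m i \<in> L' \<and>
       linf_dist (ereal (\<beta> i), d i) (ereal (\<beta>' (m i)), d' (m i)) \<le> ereal \<epsilon>)"
proof -
  obtain F where F: "\<forall>i\<in>L. (\<forall>j. F i j \<noteq> 0 \<longrightarrow> j \<in> L' \<and> \<beta>' j \<le> \<beta> i + \<epsilon> \<and>
            ereal (\<beta> i + \<epsilon>) < d' j \<and> d' j \<le> d i + ereal \<epsilon>) \<and>
          f (z i) - (\<Sum>j\<in>L'. F i j *s2 z' j) \<in> B' (\<beta> i + \<epsilon>)"
    using matrix_of_morphism[OF M N] by blast
  obtain G where G: "\<forall>j\<in>L'. (\<forall>k. G j k \<noteq> 0 \<longrightarrow> k \<in> L \<and> \<beta> k \<le> \<beta>' j + \<epsilon> \<and>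
            ereal (\<beta>' j + \<epsilon>) < d k \<and> d k \<le> d' j + ereal \<epsilon>) \<and>
          g (z' j) - (\<Sum>k\<in>L. G j k *s1 z k) \<in> B (\<beta>' j + \<epsilon>)"
    using interleaving.matrix_of_morphism[OF interleaving_swap[OF interleaving_axioms] N M] by blast
  have fin: "finite L" "finite L'" using M N
    by (auto simp: N.interval_basis_def M.interval_basis_def)
  have d: "d i \<noteq> -\<infinity>" if "i \<in> L" for i using M that by (auto simp: M.interval_basis_def)
  have d': "d' j \<noteq> -\<infinity>" if "j \<in> L'" for j using N that by (auto simp: N.interval_basis_def)
  obtain T1 where T1: "\<forall>T\<ge>T1. \<forall>i\<in>L. \<beta> i + 2 * \<epsilon> < T \<and> real_of_ereal (d i) + \<epsilon> < T"
    using truncation_bound[OF fin(1) eps] by metis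
  obtain T2 where T2: "\<forall>T\<ge>T2. \<forall>i\<in>L'. \<beta>' i + 2 * \<epsilon> < T \<and> real_of_ereal (d' i) + \<epsilon> < T"
    using truncation_bound[OF fin(2) eps] by metis
  define T where "T = max T1 T2"
  have T: "\<beta> i + 2 * \<epsilon> < T" "real_of_ereal (d i) + \<epsilon> < T" if "i \<in> L" for i
    using T1 that by (auto simp: T_def)
  have T': "real_of_ereal (d' j) + \<epsilon> < T" if "j \<in> L'" for j
    using T2 that by (auto simp: T_def)
  let ?A = "{i\<in>L. ereal (\<beta> i + 2 * \<epsilon>) < d i}"
  let ?\<tau> = "\<lambda>i. truncate T (d i)" and ?\<tau>' = "\<lambda>i. truncate T (d' i)"
  have "\<exists>m. inj_on m ?A \<and>
      (\<forall>i\<in>?A. m i \<in> L' \<and> \<bar>\<beta> i - \<beta>' (m i)\<bar> \<le> \<epsilon> \<and> \<bar>?\<tau> i - ?\<tau>' (m i)\<bar> \<le> \<epsilon>)"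
  proof (rule matching_of_triangular_matrices[where F = F and G = G])
    show "finite ?A" "finite L'" "\<epsilon> \<ge> 0" using fin eps by auto
    show "\<beta> i + 2 * \<epsilon> < ?\<tau> i" if "i \<in> ?A" for i
      using that d[of i] T[of i] by (cases "d i") (auto simp: truncate_def)
    show "\<beta>' j \<le> \<beta> i + \<epsilon> \<and> ?\<tau>' j \<le> ?\<tau> i + \<epsilon>" if "i \<in> ?A" "j \<in> L'" "F i j \<noteq> 0" for i j
    proof -
      have "\<beta>' j \<le> \<beta> i + \<epsilon>" "d' j \<le> d i + ereal \<epsilon>" using F that by auto
      then show ?thesis using d[of i] d'[of j] T'[of j] that eps
        by (cases "d i"; cases "d' j") (auto simp: truncate_def)
    qed
    show "\<beta> k \<le> \<beta>' j + \<epsilon> \<and> ?\<tau> k \<le> ?\<tau>' j + \<epsilon>" if "j \<in> L'" "k \<in> ?A" "G j k \<noteq> 0" for j k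
    proof -
      have "\<beta> k \<le> \<beta>' j + \<epsilon>" "d k \<le> d' j + ereal \<epsilon>" using G that by auto
      then show ?thesis using d[of k] d'[of j] T[of k] that eps
        by (cases "d k"; cases "d' j") (auto simp: truncate_def)
    qed
    fix i k assume i: "i \<in> ?A" and k: "k \<in> ?A"
      and le: "\<beta> k \<le> \<beta> i + 2 * \<epsilon>" and less: "\<beta> i + 2 * \<epsilon> < ?\<tau> k"
    have "k \<in> alive L \<beta> d (\<beta> i + 2 * \<epsilon>)"
      using k le less d[of k] by (cases "d k") (auto simp: alive_def truncate_def)
    then show "(\<Sum>j\<in>L'. F i j * G j k) = (if i = k then 1 else 0)"
      using i F G by (intro product_of_morphism_matrices[OF M N]) auto
  qed
  then obtain m where m: "inj_on m ?A"
    "\<forall>i\<in>?A. m i \<in> L' \<and> \<bar>\<beta> i - \<beta>' (m i)\<bar> \<le> \<epsilon> \<and> \<bar>?\<tau> i - ?\<tau>' (m i)\<bar> \<le> \<epsilon>"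
    by blast
  have "linf_dist (ereal (\<beta> i), d i) (ereal (\<beta>' (m i)), d' (m i)) \<le> ereal \<epsilon>" if i: "i \<in> ?A" for i
  proof -
    have mi: "m i \<in> L'" "\<bar>\<beta> i - \<beta>' (m i)\<bar> \<le> \<epsilon>" "\<bar>?\<tau> i - ?\<tau>' (m i)\<bar> \<le> \<epsilon>"
      using m i by auto
    have "ereal_gap (d i) (d' (m i)) \<le> ereal \<epsilon>"
      using mi(3) d[of i] d'[OF mi(1)] T[of i] T'[OF mi(1)] i eps
      by (cases "d i"; cases "d' (m i)") (auto simp: truncate_def ereal_gap_def)
    then show ?thesis using mi(2) eps by (auto simp: linf_dist_def ereal_gap_def)
  qed
  then show ?thesis using m by blast
qed

section \<open>From matchings of intervals to the bottleneck distance\<close>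

lemma count_image_mset_set:
  assumes "finite L"
  shows "count (image_mset p (mset_set L)) x = card {i\<in>L. p i = x}"
proof -
  have "p -` {x} \<inter> L = {i\<in>L. p i = x}" by auto
  then show ?thesis using assms by (simp add: count_image_mset)
qed

text \<open>Numbers the indices with the same image consecutively, which turns an indexed family into the copies
of the points of its multiset.\<close>

lemma copies_enumeration:
  assumes fin: "finite L"
  shows "\<exists>e. bij_betw (\<lambda>i. (p i, e i)) L {(x, k). k < count (image_mset p (mset_set L)) x}"
proof -
  have "\<exists>e. bij_betw e {i\<in>L. p i = x} {0..<card {i\<in>L. p i = x}}" for x
    using fin by (intro ex_bij_betw_finite_nat) auto
  then obtain e where e: "bij_betw (e x) {i\<in>L. p i = x} {0..<card {i\<in>L. p i = x}}" for x
    by metis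
  have "bij_betw (\<lambda>i. (p i, e (p i) i)) L {(x, k). k < card {i\<in>L. p i = x}}"
  proof (rule bij_betw_imageI)
    show "inj_on (\<lambda>i. (p i, e (p i) i)) L"
      using e by (auto simp: inj_on_def bij_betw_def)
    show "(\<lambda>i. (p i, e (p i) i)) ` L = {(x, k). k < card {i\<in>L. p i = x}}"
    proof (intro equalityI subsetI)
      fix y assume "y \<in> (\<lambda>i. (p i, e (p i) i)) ` L"
      then obtain i where i: "i \<in> L" "y = (p i, e (p i) i)" by auto
      then have "e (p i) i \<in> {0..<card {j\<in>L. p j = p i}}"
        using bij_betw_imp_surj_on[OF e[of "p i"]] by blast
      then show "y \<in> {(x, k). k < card {i\<in>L. p i = x}}" using i by simp
    next
      fix y assume "y \<in> {(x, k). k < card {i\<in>L. p i = x}}"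
      then obtain x k where y: "y = (x, k)" "k \<in> {0..<card {i\<in>L. p i = x}}" by auto
      then have "k \<in> e x ` {i\<in>L. p i = x}" using bij_betw_imp_surj_on[OF e[of x]] by simp
      then show "y \<in> (\<lambda>i. (p i, e (p i) i)) ` L" using y by auto
    qed
  qed
  then show ?thesis unfolding count_image_mset_set[OF fin] by (intro exI)
qed

lemma elems_with_diagonal_iff:
  "(x, k) \<in> elems_with_diagonal A \<longleftrightarrow> fst x = snd x \<or> k < count A x"
  by (simp add: elems_with_diagonal_def mult_with_diagonal_def)

text \<open>Matched points follow the matching and the others move to the diagonal. Points of the diagonal stay
in place, but their copies move to odd numbers; the even ones are free for the points that arrive.\<close>

lemma injection_of_matching:
  fixes p :: "'i \<Rightarrow> ereal \<times> ereal" and p' :: "'j \<Rightarrow> ereal \<times> ereal"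
  assumes fin: "finite L" "finite L'" and A: "A \<subseteq> L"
    and off: "\<And>i. i \<in> L \<Longrightarrow> fst (p i) \<noteq> snd (p i)"
      "\<And>j. j \<in> L' \<Longrightarrow> fst (p' j) \<noteq> snd (p' j)"
    and m: "inj_on m A" "\<And>i. i \<in> A \<Longrightarrow> m i \<in> L'"
      "\<And>i. i \<in> A \<Longrightarrow> linf_dist (p i) (p' (m i)) \<le> ereal \<epsilon>"
    and short: "\<And>i. i \<in> L - A \<Longrightarrow> \<exists>x. fst x = snd x \<and> linf_dist (p i) x \<le> ereal \<epsilon>"
    and eps: "\<epsilon> \<ge> 0"
  defines "D \<equiv> image_mset p (mset_set L)" and "D' \<equiv> image_mset p' (mset_set L')"
  shows "\<exists>f. inj_on f (elems_with_diagonal D) \<and>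
    f ` elems_with_diagonal D \<subseteq> elems_with_diagonal D' \<and>
    (\<forall>a\<in>elems_with_diagonal D. linf_dist (fst a) (fst (f a)) \<le> ereal \<epsilon>)"
proof -
  obtain e where e: "bij_betw (\<lambda>i. (p i, e i)) L {(x, k). k < count D x}"
    using copies_enumeration[OF fin(1)] unfolding D_def by blast
  obtain e' where e': "bij_betw (\<lambda>i. (p' i, e' i)) L' {(x, k). k < count D' x}"
    using copies_enumeration[OF fin(2)] unfolding D'_def by blast
  obtain idx :: "'i \<Rightarrow> nat" where idx: "inj_on idx L"
    using finite_imp_inj_to_nat_seg[OF fin(1)] by blast
  obtain q where q: "\<And>i. i \<in> L - A \<Longrightarrow> fst (q i) = snd (q i) \<and> linf_dist (p i) (q i) \<le> ereal \<epsilon>"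
    using short by metis
  let ?E = "elems_with_diagonal D" and ?E' = "elems_with_diagonal D'"
  define bar where "bar = inv_into L (\<lambda>i. (p i, e i))"
  define f where "f = (\<lambda>a. if fst (fst a) = snd (fst a) then (fst a, 2 * snd a + 1)
     else if bar a \<in> A then (p' (m (bar a)), e' (m (bar a))) else (q (bar a), 2 * idx (bar a)))"
  have bar: "bar a \<in> L \<and> (p (bar a), e (bar a)) = a" if "a \<in> ?E" "fst (fst a) \<noteq> snd (fst a)" for a
  proof -
    have "a \<in> (\<lambda>i. (p i, e i)) ` L"
      using that bij_betw_imp_surj_on[OF e] elems_with_diagonal_iff[of "fst a" "snd a" D]
      by (cases a) simp
    then show ?thesis unfolding bar_def
      using inv_into_into[of a "\<lambda>i. (p i, e i)" L] f_inv_into_f[of a "\<lambda>i. (p i, e i)" L] by simp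
  qed
  have copy: "(p' j, e' j) \<in> {(x, k). k < count D' x}" if "j \<in> L'" for j
    using bij_betw_apply[OF e' that] by simp
  \<comment> \<open>The three clauses of \<open>f\<close>: diagonal points, matched points, unmatched points.\<close>
  have cases: "(fst (fst a) = snd (fst a) \<and> f a = (fst a, 2 * snd a + 1)) \<or>
     (fst (fst a) \<noteq> snd (fst a) \<and> bar a \<in> A \<and> a = (p (bar a), e (bar a)) \<and>
        f a = (p' (m (bar a)), e' (m (bar a)))) \<or>
     (fst (fst a) \<noteq> snd (fst a) \<and> bar a \<in> L - A \<and> a = (p (bar a), e (bar a)) \<and>
        f a = (q (bar a), 2 * idx (bar a)))" if "a \<in> ?E" for a
    using bar[OF that] unfolding f_def by (cases "bar a \<in> A") auto
  have diag: "fst (fst (f a)) = snd (fst (f a)) \<longleftrightarrow> \<not> (fst (fst a) \<noteq> snd (fst a) \<and> bar a \<in> A)"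
    if "a \<in> ?E" for a
    using cases[OF that] off(2)[OF m(2)] q by auto
  have "inj_on f ?E"
  proof (rule inj_onI)
    fix a b assume ab: "a \<in> ?E" "b \<in> ?E" "f a = f b"
    have parity: "2 * (x::nat) + 1 \<noteq> 2 * y" for x y by presburger
    consider "fst (fst a) = snd (fst a)" "fst (fst b) = snd (fst b)"
      | "fst (fst a) \<noteq> snd (fst a)" "bar a \<in> A" "fst (fst b) \<noteq> snd (fst b)" "bar b \<in> A"
      | "fst (fst a) \<noteq> snd (fst a)" "bar a \<notin> A" "fst (fst b) \<noteq> snd (fst b)" "bar b \<notin> A"
      using diag[OF ab(1)] diag[OF ab(2)] ab(3) cases[OF ab(1)] cases[OF ab(2)] parity
      by (metis prod.inject)
    then show "a = b"
    proof cases
      case 1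
      then show ?thesis using ab(3) by (auto simp: f_def prod_eq_iff)
    next
      case 2
      then have "(p' (m (bar a)), e' (m (bar a))) = (p' (m (bar b)), e' (m (bar b)))"
        using ab(3) by (simp add: f_def)
      then have "m (bar a) = m (bar b)"
        by (rule inj_onD[OF bij_betw_imp_inj_on[OF e']]) (use 2 m(2) in auto)
      then have "bar a = bar b" using 2 m(1) by (auto dest: inj_onD)
      then show ?thesis using bar[OF ab(1)] bar[OF ab(2)] 2 by metis
    next
      case 3
      then have "idx (bar a) = idx (bar b)" using ab(3) by (simp add: f_def)
      then have "bar a = bar b" using 3 idx bar[OF ab(1)] bar[OF ab(2)] by (auto dest: inj_onD)
      then show ?thesis using bar[OF ab(1)] bar[OF ab(2)] 3 by metis
    qed
  qed
  moreover have "f a \<in> ?E'" if a: "a \<in> ?E" for a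
    using cases[OF a] copy[OF m(2)] q by (auto simp: elems_with_diagonal_iff)
  moreover have "linf_dist (fst a) (fst (f a)) \<le> ereal \<epsilon>" if a: "a \<in> ?E" for a
    using cases[OF a]
  proof (elim disjE conjE)
    assume "f a = (fst a, 2 * snd a + 1)"
    then show ?thesis using eps by (simp add: linf_dist_def ereal_gap_def)
  next
    assume "bar a \<in> A" and h: "a = (p (bar a), e (bar a))" "f a = (p' (m (bar a)), e' (m (bar a)))"
    then have "linf_dist (p (bar a)) (p' (m (bar a))) \<le> ereal \<epsilon>" by (intro m(3))
    then show ?thesis using h by (metis fst_conv)
  next
    assume "bar a \<in> L - A" and h: "a = (p (bar a), e (bar a))" "f a = (q (bar a), 2 * idx (bar a))"
    then have "linf_dist (p (bar a)) (q (bar a)) \<le> ereal \<epsilon>" using q by blast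
    then show ?thesis using h by (metis fst_conv)
  qed
  ultimately show ?thesis by (intro exI[of _ f]) auto
qed

lemma linf_dist_commute: "linf_dist x y = linf_dist y x"
proof -
  have "ereal_gap a b = ereal_gap b a" for a b
    by (cases a; cases b) (auto simp: ereal_gap_def)
  then show ?thesis by (simp add: linf_dist_def)
qed

text \<open>The nearest diagonal point has the midpoint of the interval as both coordinates.\<close>

lemma short_interval_near_diagonal:
  assumes "ereal \<beta> < d" "\<not> ereal (\<beta> + 2 * \<epsilon>) < d"
  shows "\<exists>x. fst x = snd x \<and> linf_dist (ereal \<beta>, d) x \<le> ereal \<epsilon>"
proof -
  obtain r where r: "d = ereal r" using assms by (cases d) auto
  let ?m = "ereal ((\<beta> + r) / 2)"
  have "\<bar>\<beta> - (\<beta> + r) / 2\<bar> \<le> \<epsilon>" "\<bar>r - (\<beta> + r) / 2\<bar> \<le> \<epsilon>" using assms r by (auto simp: field_simps abs_if)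
  moreover have "0 \<le> \<epsilon>" using assms r by auto
  ultimately have "linf_dist (ereal \<beta>, d) (?m, ?m) \<le> ereal \<epsilon>"
    using r by (auto simp: linf_dist_def ereal_gap_def)
  then show ?thesis by (intro exI[of _ "(?m, ?m)"]) auto
qed

lemma (in interleaving) interval_injection:
  assumes M: "M.interval_basis L \<beta> d z" and N: "N.interval_basis L' \<beta>' d' z'"
  defines "D \<equiv> image_mset (\<lambda>i. (ereal (\<beta> i), d i)) (mset_set L)"
    and "D' \<equiv> image_mset (\<lambda>i. (ereal (\<beta>' i), d' i)) (mset_set L')"
  shows "\<exists>f. inj_on f (elems_with_diagonal D) \<and>
    f ` elems_with_diagonal D \<subseteq> elems_with_diagonal D' \<and>
    (\<forall>a\<in>elems_with_diagonal D. linf_dist (fst a) (fst (f a)) \<le> ereal \<epsilon>)"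
proof -
  let ?A = "{i\<in>L. ereal (\<beta> i + 2 * \<epsilon>) < d i}"
  obtain m where m: "inj_on m ?A" "\<forall>i\<in>?A. m i \<in> L' \<and>
       linf_dist (ereal (\<beta> i), d i) (ereal (\<beta>' (m i)), d' (m i)) \<le> ereal \<epsilon>"
    using long_intervals_matching[OF M N] by blast
  have pos: "\<And>i. i \<in> L \<Longrightarrow> ereal (\<beta> i) < d i" "\<And>i. i \<in> L' \<Longrightarrow> ereal (\<beta>' i) < d' i"
    using M N by (auto simp: N.interval_basis_def M.interval_basis_def)
  show ?thesis unfolding D_def D'_def
  proof (rule injection_of_matching[where m = m and A = ?A])
    show "finite L" "finite L'" using M N
      by (auto simp: N.interval_basis_def M.interval_basis_def)
    show "\<exists>x. fst x = snd x \<and> linf_dist (ereal (\<beta> i), d i) x \<le> ereal \<epsilon>" if "i \<in> L - ?A" for i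
      using that pos by (intro short_interval_near_diagonal) auto
  qed (use m pos eps in \<open>auto simp: less_imp_neq\<close>)
qed

text \<open>The matchings of long bars in the two directions need not be inverse to each other. Each of them
extends to an injection of the full diagrams with the diagonal, and these merge into a bijection.\<close>

lemma (in interleaving) bottleneck_dist_le:
  assumes M: "M.interval_basis L \<beta> d z" and N: "N.interval_basis L' \<beta>' d' z'"
  shows "bottleneck_dist (image_mset (\<lambda>i. (ereal (\<beta> i), d i)) (mset_set L))
    (image_mset (\<lambda>i. (ereal (\<beta>' i), d' i)) (mset_set L')) \<le> ereal \<epsilon>"
    (is "bottleneck_dist ?D ?D' \<le> _")
proof -
  let ?E = "elems_with_diagonal ?D" and ?E' = "elems_with_diagonal ?D'"
  obtain f where f: "inj_on f ?E" "f ` ?E \<subseteq> ?E'"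
    "\<forall>a\<in>?E. linf_dist (fst a) (fst (f a)) \<le> ereal \<epsilon>"
    using interval_injection[OF M N] by blast
  obtain g where g: "inj_on g ?E'" "g ` ?E' \<subseteq> ?E"
    "\<forall>a\<in>?E'. linf_dist (fst a) (fst (g a)) \<le> ereal \<epsilon>"
    using interleaving.interval_injection[OF interleaving_swap[OF interleaving_axioms] N M] by blast
  have "\<exists>h. bij_betw h ?E ?E' \<and> (\<forall>a\<in>?E. linf_dist (fst a) (fst (h a)) \<le> ereal \<epsilon>)"
    using f(3) g(3) linf_dist_commute
    by (intro schroeder_bernstein_relation[OF f(1,2) g(1,2)]) metis+
  then obtain h where "bij_betw h ?E ?E'" "\<forall>a\<in>?E. linf_dist (fst a) (fst (h a)) \<le> ereal \<epsilon>"
    by blast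
  then show ?thesis unfolding bottleneck_dist_def
    by (intro INF_lower2[of h]) (auto intro: SUP_least)
qed

section \<open>Subquotients as vector spaces of cosets\<close>

definition coset :: "'e::ab_group_add set \<Rightarrow> 'e \<Rightarrow> 'e set" where
  "coset B x = (\<lambda>b. b + x) ` B"

lemma (in vector_space) coset_eq_coset_iff:
  assumes B: "subspace B"
  shows "coset B x = coset B y \<longleftrightarrow> x - y \<in> B"
proof
  assume "coset B x = coset B y"
  moreover have "x \<in> coset B x" unfolding coset_def using subspace_0[OF B] by force
  ultimately obtain b where "b \<in> B" "x = b + y" by (auto simp: coset_def)
  then show "x - y \<in> B" by simp
next
  have sub: "coset B u \<subseteq> coset B v" if "u - v \<in> B" for u v
  proof
    fix w assume "w \<in> coset B u"
    then obtain b where "b \<in> B" "w = b + u" by (auto simp: coset_def)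
    then have "w = (b + (u - v)) + v" "b + (u - v) \<in> B"
      using subspace_add[OF B _ that] by auto
    then show "w \<in> coset B v" unfolding coset_def by blast
  qed
  assume "x - y \<in> B"
  moreover from this have "y - x \<in> B" using subspace_neg[OF B] by fastforce
  ultimately show "coset B x = coset B y" using sub by (intro equalityI) auto
qed

locale subquotient = vector_space scale
  for scale :: "'k::field \<Rightarrow> 'e::ab_group_add \<Rightarrow> 'e" (infixr \<open>*s\<close> 75) +
  fixes Z B :: "'e set" and M :: "('k, 'e set) module"
  assumes subspace_Z: "subspace Z" and subspace_B: "subspace B" and B_le_Z: "B \<subseteq> Z"
    and carrier_M: "carrier M = coset B ` Z" and zero_M: "\<zero>\<^bsub>M\<^esub> = B"
    and add_M: "x \<in> Z \<Longrightarrow> y \<in> Z \<Longrightarrow> coset B x \<oplus>\<^bsub>M\<^esub> coset B y = coset B (x + y)"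
    and smult_M: "x \<in> Z \<Longrightarrow> a \<odot>\<^bsub>M\<^esub> coset B x = coset B (a *s x)"
begin

lemmas coset_eq_iff = coset_eq_coset_iff[OF subspace_B]

lemma coset_0: "coset B 0 = B" by (simp add: coset_def)

lemma coset_eq_zero_iff: "coset B x = \<zero>\<^bsub>M\<^esub> \<longleftrightarrow> x \<in> B"
  using coset_eq_iff[of x 0] by (simp add: coset_0 zero_M)

lemma vectorspace_M: "vectorspace (class_ring :: 'k ring) M"
proof (rule vs_criteria)
  show "field (class_ring :: 'k ring)" by (rule class_field)
  show "\<zero>\<^bsub>M\<^esub> \<in> carrier M"
    unfolding carrier_M zero_M using coset_0 subspace_0[OF subspace_Z] by (metis imageI)
  show "\<forall>v\<in>carrier M. \<exists>neg_v\<in>carrier M. v \<oplus>\<^bsub>M\<^esub> neg_v = \<zero>\<^bsub>M\<^esub>"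
  proof
    fix v assume "v \<in> carrier M"
    then obtain x where "x \<in> Z" "v = coset B x" by (auto simp: carrier_M)
    then show "\<exists>w\<in>carrier M. v \<oplus>\<^bsub>M\<^esub> w = \<zero>\<^bsub>M\<^esub>"
      using add_M[of x "- x"] subspace_neg[OF subspace_Z]
      by (intro bexI[of _ "coset B (- x)"]) (auto simp: carrier_M zero_M coset_0)
  qed
  show "\<forall>v\<in>carrier M. v \<oplus>\<^bsub>M\<^esub> \<zero>\<^bsub>M\<^esub> = v"
  proof
    fix v assume "v \<in> carrier M"
    then obtain x where "x \<in> Z" "v = coset B x" by (auto simp: carrier_M)
    then show "v \<oplus>\<^bsub>M\<^esub> \<zero>\<^bsub>M\<^esub> = v"
      using add_M[of x 0] subspace_0[OF subspace_Z] by (simp add: zero_M coset_0)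
  qed
qed (use subspace_add[OF subspace_Z] subspace_scale[OF subspace_Z] in
    \<open>auto simp: carrier_M add_M smult_M algebra_simps scale_left_distrib scale_right_distrib\<close>)

lemma finsum_coset:
  assumes "finite I" "\<And>i. i \<in> I \<Longrightarrow> h i \<in> Z"
  shows "(\<Oplus>\<^bsub>M\<^esub>i\<in>I. coset B (h i)) = coset B (\<Sum>i\<in>I. h i)"
  using assms
proof (induction I rule: finite_induct)
  case empty
  interpret V: vectorspace "class_ring :: 'k ring" M by (rule vectorspace_M)
  show ?case by (simp add: zero_M coset_0)
next
  case (insert i I)
  interpret V: vectorspace "class_ring :: 'k ring" M by (rule vectorspace_M)
  have "(\<Oplus>\<^bsub>M\<^esub>i\<in>insert i I. coset B (h i)) = coset B (h i) \<oplus>\<^bsub>M\<^esub> (\<Oplus>\<^bsub>M\<^esub>i\<in>I. coset B (h i))"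
    using insert by (intro V.M.finsum_insert) (auto simp: carrier_M)
  then show ?case using insert subspace_sum[OF subspace_Z, of I h] by (simp add: add_M)
qed

lemma lincomb_coset:
  assumes "finite A" "\<And>C. C \<in> A \<Longrightarrow> r C \<in> Z \<and> coset B (r C) = C"
  shows "LinearCombinations.module.lincomb M c A = coset B (\<Sum>C\<in>A. c C *s r C)"
proof -
  interpret V: vectorspace "class_ring :: 'k ring" M by (rule vectorspace_M)
  have "V.lincomb c A = (\<Oplus>\<^bsub>M\<^esub>C\<in>A. coset B (c C *s r C))"
    unfolding V.lincomb_def
  proof (rule V.M.finsum_cong')
    show "(\<lambda>C. coset B (c C *s r C)) \<in> A \<rightarrow> carrier M"
      using assms subspace_scale[OF subspace_Z] by (auto simp: carrier_M)
    show "c C \<odot>\<^bsub>M\<^esub> C = coset B (c C *s r C)" if "C \<in> A" for C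
      using assms(2)[OF that] smult_M by metis
  qed simp
  also have "\<dots> = coset B (\<Sum>C\<in>A. c C *s r C)"
    using assms subspace_scale[OF subspace_Z] by (intro finsum_coset) auto
  finally show ?thesis .
qed

lemma gen_set_iff:
  assumes fin: "finite A" and r: "\<And>C. C \<in> A \<Longrightarrow> r C \<in> Z \<and> coset B (r C) = C"
  shows "LinearCombinations.module.span (class_ring :: 'k ring) M A = carrier M \<longleftrightarrow>
    (\<forall>x\<in>Z. \<exists>c. x - (\<Sum>C\<in>A. c C *s r C) \<in> B)"
proof -
  interpret V: vectorspace "class_ring :: 'k ring" M by (rule vectorspace_M)
  have AM: "A \<subseteq> carrier M" using r by (force simp: carrier_M)
  have lc: "V.lincomb c A = coset B (\<Sum>C\<in>A. c C *s r C)" for c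
    by (rule lincomb_coset[OF fin r])
  have sumZ: "(\<Sum>C\<in>A. c C *s r C) \<in> Z" for c
    using r by (intro subspace_sum[OF subspace_Z] subspace_scale[OF subspace_Z]) auto
  have "V.span A = {V.lincomb a A | a. a \<in> A \<rightarrow> carrier (class_ring :: 'k ring)}"
    by (rule V.finite_span[OF fin AM])
  also have "\<dots> = range (\<lambda>c. coset B (\<Sum>C\<in>A. c C *s r C))"
    by (auto simp: lc)
  finally have span: "V.span A = range (\<lambda>c. coset B (\<Sum>C\<in>A. c C *s r C))" .
  have "V.gen_set A \<longleftrightarrow> carrier M \<subseteq> range (\<lambda>c. coset B (\<Sum>C\<in>A. c C *s r C))"
    unfolding span using sumZ by (auto simp: carrier_M)
  also have "\<dots> \<longleftrightarrow> (\<forall>x\<in>Z. \<exists>c. x - (\<Sum>C\<in>A. c C *s r C) \<in> B)"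
    by (simp add: carrier_M image_subset_iff image_iff coset_eq_iff)
  finally show ?thesis .
qed

text \<open>Translates bases of the quotient, which are sets of cosets, into statements about representatives
modulo \<open>B\<close>.\<close>

lemma basis_iff:
  assumes fin: "finite A" and r: "\<And>C. C \<in> A \<Longrightarrow> r C \<in> Z \<and> coset B (r C) = C"
  shows "vectorspace.basis (class_ring :: 'k ring) M A \<longleftrightarrow>
    (\<forall>x\<in>Z. \<exists>c. x - (\<Sum>C\<in>A. c C *s r C) \<in> B) \<and>
    (\<forall>c. (\<Sum>C\<in>A. c C *s r C) \<in> B \<longrightarrow> (\<forall>C\<in>A. c C = 0))"
proof -
  interpret V: vectorspace "class_ring :: 'k ring" M by (rule vectorspace_M)
  have AM: "A \<subseteq> carrier M" using r by (force simp: carrier_M)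
  have lc: "V.lincomb c A = coset B (\<Sum>C\<in>A. c C *s r C)" for c
    by (rule lincomb_coset[OF fin r])
  have "V.lin_indpt A \<longleftrightarrow> (\<forall>c. V.lincomb c A = \<zero>\<^bsub>M\<^esub> \<longrightarrow> (\<forall>C\<in>A. c C = 0))"
  proof
    assume li: "V.lin_indpt A"
    show "\<forall>c. V.lincomb c A = \<zero>\<^bsub>M\<^esub> \<longrightarrow> (\<forall>C\<in>A. c C = 0)"
      using V.lin_dep_crit[OF fin order_refl] li by fastforce
  next
    assume "\<forall>c. V.lincomb c A = \<zero>\<^bsub>M\<^esub> \<longrightarrow> (\<forall>C\<in>A. c C = 0)"
    then show "V.lin_indpt A" using V.finite_lin_indpt2[OF fin AM] by auto
  qed
  then have li: "V.lin_indpt A \<longleftrightarrow> (\<forall>c. (\<Sum>C\<in>A. c C *s r C) \<in> B \<longrightarrow> (\<forall>C\<in>A. c C = 0))"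
    by (simp add: lc coset_eq_zero_iff)
  have gen: "V.gen_set A \<longleftrightarrow> (\<forall>x\<in>Z. \<exists>c. x - (\<Sum>C\<in>A. c C *s r C) \<in> B)"
    by (rule gen_set_iff[OF fin r])
  show ?thesis unfolding V.basis_def using gen li AM by blast
qed

text \<open>The preceding criterion for a family that is given by its representatives; independence modulo \<open>B\<close>
also makes their cosets distinct.\<close>

lemma basis_of_family:
  assumes fin: "finite X" and XZ: "X \<subseteq> Z" and span: "\<And>x. x \<in> Z \<Longrightarrow> \<exists>c. x - (\<Sum>y\<in>X. c y *s y) \<in> B"
    and indep: "\<And>c y. (\<Sum>y\<in>X. c y *s y) \<in> B \<Longrightarrow> y \<in> X \<Longrightarrow> c y = 0"
  shows "inj_on (coset B) X" "vectorspace.basis (class_ring :: 'k ring) M (coset B ` X)"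
proof -
  show inj: "inj_on (coset B) X"
  proof (rule inj_onI, rule ccontr)
    fix x y assume xy: "x \<in> X" "y \<in> X" "coset B x = coset B y" "x \<noteq> y"
    define c where "c w = (if w = x then 1 else if w = y then -1 else (0::'k))" for w
    have "(\<Sum>w\<in>X. c w *s w) = (\<Sum>w\<in>{x, y}. c w *s w)"
      using xy fin by (intro sum.mono_neutral_right) (auto simp: c_def)
    also have "\<dots> = x - y" using xy by (simp add: c_def)
    finally have "(\<Sum>w\<in>X. c w *s w) \<in> B" using xy by (simp add: coset_eq_iff)
    from indep[OF this xy(1)] show False by (simp add: c_def)
  qed
  let ?r = "inv_into X (coset B)"
  have r: "?r (coset B x) = x" if "x \<in> X" for x using inj that by simp
  have sum: "(\<Sum>C\<in>coset B ` X. c C *s ?r C) = (\<Sum>x\<in>X. c (coset B x) *s x)" for c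
    by (subst sum.reindex[OF inj]) (auto intro!: sum.cong simp: r)
  show "vectorspace.basis (class_ring :: 'k ring) M (coset B ` X)"
  proof (subst basis_iff[where r = ?r])
    show "?r C \<in> Z \<and> coset B (?r C) = C" if "C \<in> coset B ` X" for C
      using that XZ r by auto
    show "(\<forall>x\<in>Z. \<exists>c. x - (\<Sum>C\<in>coset B ` X. c C *s ?r C) \<in> B) \<and>
      (\<forall>c. (\<Sum>C\<in>coset B ` X. c C *s ?r C) \<in> B \<longrightarrow> (\<forall>C\<in>coset B ` X. c C = 0))"
    proof (intro conjI ballI allI impI)
      fix x assume "x \<in> Z"
      then obtain c where "x - (\<Sum>y\<in>X. c y *s y) \<in> B" using span by blast
      moreover have "(\<Sum>C\<in>coset B ` X. c (?r C) *s ?r C) = (\<Sum>y\<in>X. c y *s y)"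
        by (subst sum.reindex[OF inj]) (auto intro!: sum.cong simp: r)
      ultimately show "\<exists>c. x - (\<Sum>C\<in>coset B ` X. c C *s ?r C) \<in> B"
        by (intro exI[of _ "\<lambda>C. c (?r C)"]) simp
    next
      fix c C assume "(\<Sum>C\<in>coset B ` X. c C *s ?r C) \<in> B" "C \<in> coset B ` X"
      then show "c C = 0" using indep[of "\<lambda>x. c (coset B x)"] unfolding sum by auto
    qed
  qed (use fin in auto)
qed

text \<open>The cosets of a basis of \<open>Z\<close> generate the quotient. Several basis vectors may share a coset, and
their coefficients are then added.\<close>

lemma fin_dim_M:
  assumes "finite S" "Z \<subseteq> span S"
  shows "vectorspace.fin_dim (class_ring :: 'k ring) M"
proof -
  interpret V: vectorspace "class_ring :: 'k ring" M by (rule vectorspace_M)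
  obtain X where X: "X \<subseteq> Z" "independent X" "Z \<subseteq> span X"
    using maximal_independent_subset by blast
  have finX: "finite X"
    using independent_span_bound[OF assms(1) X(2)] X(1) assms(2) by blast
  let ?A = "coset B ` X" and ?r = "inv_into X (coset B)"
  have r: "?r C \<in> X" "coset B (?r C) = C" if "C \<in> ?A" for C
    using that by (auto simp: inv_into_into f_inv_into_f)
  have "\<exists>c. x - (\<Sum>C\<in>?A. c C *s ?r C) \<in> B" if x: "x \<in> Z" for x
  proof -
    have "x \<in> range (\<lambda>u. \<Sum>v\<in>X. u v *s v)" using x X(3) span_finite[OF finX] by auto
    then obtain u where u: "x = (\<Sum>y\<in>X. u y *s y)" by auto
    define c where "c C = (\<Sum>y\<in>{y\<in>X. coset B y = C}. u y)" for C
    have "(\<Sum>C\<in>?A. c C *s ?r C) = (\<Sum>C\<in>?A. \<Sum>y\<in>{y\<in>X. coset B y = C}. u y *s ?r (coset B y))"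
      by (auto simp: c_def scale_sum_left intro!: sum.cong)
    also have "\<dots> = (\<Sum>y\<in>X. u y *s ?r (coset B y))"
      using finX by (intro sum.group) auto
    finally have "x - (\<Sum>C\<in>?A. c C *s ?r C) = (\<Sum>y\<in>X. u y *s (y - ?r (coset B y)))"
      unfolding u by (simp add: scale_right_diff_distrib sum_subtractf)
    also have "\<dots> \<in> B"
    proof (intro subspace_sum[OF subspace_B] subspace_scale[OF subspace_B])
      fix y assume "y \<in> X"
      then have "coset B (?r (coset B y)) = coset B y" by (intro r) auto
      then show "y - ?r (coset B y) \<in> B" using coset_eq_iff by metis
    qed
    finally show ?thesis by blast
  qed
  then have "V.gen_set ?A" using finX X(1) r by (subst gen_set_iff[where r = ?r]) auto
  moreover have "?A \<subseteq> carrier M" using X by (auto simp: carrier_M)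
  ultimately show ?thesis using finX unfolding V.fin_dim_def by blast
qed

lemma basis_finite:
  assumes "vectorspace.fin_dim (class_ring :: 'k ring) M"
    and "vectorspace.basis (class_ring :: 'k ring) M A"
  shows "finite A" "A \<subseteq> carrier M" "\<zero>\<^bsub>M\<^esub> \<notin> A"
proof -
  interpret V: vectorspace "class_ring :: 'k ring" M by (rule vectorspace_M)
  show "finite A" "A \<subseteq> carrier M" "\<zero>\<^bsub>M\<^esub> \<notin> A"
    using assms V.fin_dim_li_fin V.vs_zero_lin_dep unfolding V.basis_def by blast+
qed

end

section \<open>Persistent subquotients and their interval bases\<close>

locale persistent_subquotient = subquotient_filtration scale Z B
  for scale :: "'k::field \<Rightarrow> 'e::ab_group_add \<Rightarrow> 'e" (infixr \<open>*s\<close> 75) and Z B +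
  fixes M :: "real \<Rightarrow> ('k, 'e set) module" and \<nu> :: "real \<Rightarrow> real \<Rightarrow> 'e set \<Rightarrow> 'e set"
    and S :: "'e set"
  assumes subquotient_M: "subquotient scale (Z t) (B t) (M t)"
    and \<nu>_coset: "s \<le> t \<Longrightarrow> x \<in> Z s \<Longrightarrow> \<nu> s t (coset (B s) x) = coset (B t) x"
    and finite_S: "finite S" and Z_span: "Z t \<subseteq> span S"
begin

lemmas coset_eq_iff = subquotient.coset_eq_iff[OF subquotient_M]
  and coset_eq_zero_iff = subquotient.coset_eq_zero_iff[OF subquotient_M]
  and carrier_M = subquotient.carrier_M[OF subquotient_M]
  and fin_dim_M = subquotient.fin_dim_M[OF subquotient_M finite_S Z_span]
lemmas basis_M = subquotient.basis_finite[OF subquotient_M fin_dim_M]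

lemma linear_map_\<nu>:
  assumes "s \<le> t"
  shows "linear_map (class_ring :: 'k ring) (M s) (M t) (\<nu> s t)"
proof -
  have vs: "vectorspace (class_ring :: 'k ring) (M t)" for t
    by (rule subquotient.vectorspace_M[OF subquotient_M])
  have sub: "x \<in> Z t" if "x \<in> Z s" for x using that Z_mono[OF assms] by auto
  have "\<nu> s t \<in> LinearCombinations.module_hom (class_ring :: 'k ring) (M s) (M t)"
    unfolding LinearCombinations.module_hom_def
    by (auto simp: carrier_M \<nu>_coset[OF assms] sub subquotient.add_M[OF subquotient_M]
        subquotient.smult_M[OF subquotient_M] subspace_add[OF subspace_Z] subspace_scale[OF subspace_Z])
  then show ?thesis
    using vs by (auto simp: linear_map_def mod_hom_def mod_hom_axioms_def vectorspace_def)
qed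

lemma persistence_vector_space_M: "persistence_vector_space (class_ring :: 'k ring) M \<nu>"
proof (rule persistence_vector_space.intro)
  fix s t :: real assume "s \<le> t"
  then show "linear_map (class_ring :: 'k ring) (M s) (M t) (\<nu> s t)" by (rule linear_map_\<nu>)
next
  show "vectorspace.fin_dim (class_ring :: 'k ring) (M t)" for t by (rule fin_dim_M)
  show "\<nu> t t x = x" if "x \<in> carrier (M t)" for t x
    using that by (auto simp: carrier_M \<nu>_coset)
  fix r s t x assume h: "r \<le> s" "s \<le> t" "x \<in> carrier (M r)"
  then obtain y where y: "y \<in> Z r" "x = coset (B r) y" by (auto simp: carrier_M)
  then have "y \<in> Z s" using Z_mono[OF h(1)] by auto
  then show "\<nu> s t (\<nu> r s x) = \<nu> r t x"
    unfolding y(2) \<nu>_coset[OF h(1) y(1)] \<nu>_coset[OF order_trans[OF h(1,2)] y(1)]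
    by (rule \<nu>_coset[OF h(2)])
qed

sublocale P: persistence_vector_space "class_ring :: 'k ring" M \<nu>
  by (rule persistence_vector_space_M)

lemma stage_mono:
  assumes "strict_mono_on {..m} \<delta>" "i \<le> j"
  shows "P.stage m \<delta> i \<le> P.stage m \<delta> j"
proof (cases "min i m = min j m")
  case False
  then have "min i m < min j m" using assms(2) by auto
  then show ?thesis
    using strict_mono_onD[OF assms(1) _ _ \<open>min i m < min j m\<close>]
    by (simp add: P.stage_def less_imp_le del: min_less_iff_conj)
qed (simp add: P.stage_def)

lemma map_at_coset:
  assumes "strict_mono_on {..m} \<delta>" "i \<le> j" "x \<in> Z (P.stage m \<delta> i)"
  shows "P.map_at m \<delta> i j (coset (B (P.stage m \<delta> i)) x) = coset (B (P.stage m \<delta> j)) x"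
  using assms by (intro \<nu>_coset stage_mono)

text \<open>Each basis element traces back to exactly one birth: it is either new at its stage or the image of
a unique earlier basis element. Along the way an element is dead as soon as its representative lies in
\<open>B\<close>, because basis elements are nonzero.\<close>

lemma births_basis:
  assumes sm: "strict_mono_on {..m} \<delta>" and cb: "P.compatible_bases m \<delta> Bs"
    and z: "\<And>b i. (b, i) \<in> P.births m \<delta> Bs \<Longrightarrow>
      z (b, i) \<in> Z (P.stage m \<delta> i) \<and> coset (B (P.stage m \<delta> i)) (z (b, i)) = b"
  shows "bij_betw (\<lambda>l. coset (B (P.stage m \<delta> k)) (z l))
      {l \<in> P.births m \<delta> Bs. snd l \<le> k \<and> z l \<notin> B (P.stage m \<delta> k)} (Bs k)"
    and "l \<in> P.births m \<delta> Bs \<Longrightarrow> snd l \<le> k \<Longrightarrow>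
      coset (B (P.stage m \<delta> k)) (z l) \<in> Bs k \<longleftrightarrow> z l \<notin> B (P.stage m \<delta> k)"
proof -
  let ?T = "P.stage m \<delta>" and ?L = "P.births m \<delta> Bs"
  let ?cos = "\<lambda>k. coset (B (?T k))"
  note mono = stage_mono[OF sm]
  note cbi = spec[OF cb[unfolded P.compatible_bases_def]]
  have basis: "vectorspace.basis class_ring (M (?T i)) (Bs i)" for i
    by (rule cbi[THEN conjunct1])
  have sub: "P.map_at m \<delta> i (i + 1) ` Bs i \<subseteq> Bs (i + 1) \<union> {\<zero>\<^bsub>M (?T (i + 1))\<^esub>}" for i
    by (rule cbi[THEN conjunct2, THEN conjunct1])
  have uniq: "\<exists>!b. b \<in> Bs i \<and> P.map_at m \<delta> i (i + 1) b = b'"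
    if "b' \<in> P.image_at m \<delta> i \<inter> Bs (i + 1)" for i b'
    by (rule bspec[OF cbi[THEN conjunct2, THEN conjunct2, THEN conjunct2] that])
  have nz: "\<zero>\<^bsub>M (?T i)\<^esub> \<notin> Bs i" and BsM: "Bs i \<subseteq> carrier (M (?T i))" for i
    using basis_M[OF basis] by auto
  have zZ: "z l \<in> Z (?T k)" if "l \<in> ?L" "snd l \<le> k" for l k
    using z[of "fst l" "snd l"] that Z_mono[OF mono[of "snd l" k]] by auto
  have zb: "?cos (snd l) (z l) = fst l" if "l \<in> ?L" for l using z[of "fst l" "snd l"] that by auto
  have bB: "fst l \<in> Bs (snd l)" if "l \<in> ?L" for l using that by (auto simp: P.births_def)
  have zero: "?cos k x = \<zero>\<^bsub>M (?T k)\<^esub> \<longleftrightarrow> x \<in> B (?T k)" for k x by (rule coset_eq_zero_iff)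
  have push: "P.map_at m \<delta> k (Suc k) (?cos k x) = ?cos (Suc k) x" if "x \<in> Z (?T k)" for k x
    using map_at_coset[OF sm, of k "Suc k" x] that by simp
  have Bmono: "B (?T k) \<subseteq> B (?T (Suc k))" for k using B_mono mono by simp
  have in_basis: "?cos k (z l) \<in> Bs k \<union> {\<zero>\<^bsub>M (?T k)\<^esub>}" if "l \<in> ?L" "snd l \<le> k" for l k
    using that(2)
  proof (induction k rule: dec_induct)
    case base
    then show ?case using zb bB that by auto
  next
    case (step k)
    have zk: "z l \<in> Z (?T k)" using zZ that step by auto
    from step.IH show ?case
    proof
      assume "?cos k (z l) \<in> Bs k"
      then show ?thesis using sub[of k] push[OF zk] by auto
    next
      assume "?cos k (z l) \<in> {\<zero>\<^bsub>M (?T k)\<^esub>}"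
      then show ?thesis using Bmono[of k] zero by auto
    qed
  qed
  then show alive: "?cos k (z l) \<in> Bs k \<longleftrightarrow> z l \<notin> B (?T k)" if "l \<in> ?L" "snd l \<le> k" for l k
    using that nz[of k] zero[of k "z l"] by (metis Un_iff singletonD)
  show "bij_betw (\<lambda>l. ?cos k (z l)) {l \<in> ?L. snd l \<le> k \<and> z l \<notin> B (?T k)} (Bs k)"
  proof (induction k)
    case 0
    show ?case
    proof (rule bij_betw_imageI)
      show "inj_on (\<lambda>l. ?cos 0 (z l)) {l \<in> ?L. snd l \<le> 0 \<and> z l \<notin> B (?T 0)}"
      proof (rule inj_onI)
        fix l l' assume h: "l \<in> {l \<in> ?L. snd l \<le> 0 \<and> z l \<notin> B (?T 0)}"
          "l' \<in> {l \<in> ?L. snd l \<le> 0 \<and> z l \<notin> B (?T 0)}" "?cos 0 (z l) = ?cos 0 (z l')"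
        then have "fst l = fst l'" using zb[of l] zb[of l'] by simp
        then show "l = l'" using h by (simp add: prod_eq_iff)
      qed
      show "(\<lambda>l. ?cos 0 (z l)) ` {l \<in> ?L. snd l \<le> 0 \<and> z l \<notin> B (?T 0)} = Bs 0"
      proof (intro equalityI subsetI)
        fix b assume "b \<in> Bs 0"
        then have l: "(b, 0) \<in> ?L" by (auto simp: P.births_def)
        then have "?cos 0 (z (b, 0)) = b" using zb by fastforce
        moreover have "z (b, 0) \<notin> B (?T 0)" using alive[OF l, of 0] \<open>b \<in> Bs 0\<close> calculation by auto
        ultimately show "b \<in> (\<lambda>l. ?cos 0 (z l)) ` {l \<in> ?L. snd l \<le> 0 \<and> z l \<notin> B (?T 0)}"
          using l by (intro image_eqI[of _ _ "(b, 0)"]) auto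
      qed (use alive in auto)
    qed
  next
    case (Suc k)
    let ?A = "\<lambda>k. {l \<in> ?L. snd l \<le> k \<and> z l \<notin> B (?T k)}"
    have new: "?cos (Suc k) (z l) \<notin> P.image_at m \<delta> k" if "l \<in> ?L" "snd l = Suc k" for l
      using that zb[of l] by (auto simp: P.births_def)
    have old: "l \<in> ?A k \<and> ?cos k (z l) \<in> Bs k \<and>
        P.map_at m \<delta> k (Suc k) (?cos k (z l)) = ?cos (Suc k) (z l) \<and>
        ?cos (Suc k) (z l) \<in> P.image_at m \<delta> k \<inter> Bs (Suc k)"
      if "l \<in> ?A (Suc k)" "snd l \<le> k" for l
    proof -
      have lA: "l \<in> ?A k" using that Bmono by auto
      then have Bk: "?cos k (z l) \<in> Bs k" using alive by auto
      have p: "P.map_at m \<delta> k (Suc k) (?cos k (z l)) = ?cos (Suc k) (z l)"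
        using that by (intro push zZ) auto
      moreover have "?cos (Suc k) (z l) \<in> P.image_at m \<delta> k"
        unfolding P.image_at_def using Bk BsM[of k] p by auto
      ultimately show ?thesis using lA Bk alive[of l "Suc k"] that by auto
    qed
    show ?case
    proof (rule bij_betw_imageI)
      show "inj_on (\<lambda>l. ?cos (Suc k) (z l)) (?A (Suc k))"
      proof (rule inj_onI)
        fix l l' assume h: "l \<in> ?A (Suc k)" "l' \<in> ?A (Suc k)" "?cos (Suc k) (z l) = ?cos (Suc k) (z l')"
        consider "snd l = Suc k" "snd l' = Suc k" | "snd l \<le> k" "snd l' \<le> k"
          using h old[of l] old[of l'] new[of l] new[of l'] by (auto simp: le_Suc_eq)
        then show "l = l'"
        proof cases
          case 1
          then have "fst l = fst l'" using h zb[of l] zb[of l'] by simp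
          then show ?thesis using 1 by (simp add: prod_eq_iff)
        next
          case 2
          then have "?cos k (z l) = ?cos k (z l')"
            using uniq[of "?cos (Suc k) (z l)" k] old[of l] old[of l'] h by auto
          then show ?thesis using Suc.IH old[of l] old[of l'] h 2
            by (auto simp: bij_betw_def dest: inj_onD)
        qed
      qed
      show "(\<lambda>l. ?cos (Suc k) (z l)) ` ?A (Suc k) = Bs (Suc k)"
      proof (intro equalityI subsetI)
        fix b assume b: "b \<in> Bs (Suc k)"
        show "b \<in> (\<lambda>l. ?cos (Suc k) (z l)) ` ?A (Suc k)"
        proof (cases "b \<in> P.image_at m \<delta> k")
          case False
          then have l: "(b, Suc k) \<in> ?L" using b by (auto simp: P.births_def)
          then have "?cos (Suc k) (z (b, Suc k)) = b" using zb by fastforce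
          then show ?thesis using l alive[OF l, of "Suc k"] b
            by (intro image_eqI[of _ _ "(b, Suc k)"]) auto
        next
          case True
          then obtain b0 where b0: "b0 \<in> Bs k" "P.map_at m \<delta> k (Suc k) b0 = b"
            using uniq[of b k] b by auto
          have "b0 \<in> (\<lambda>l. ?cos k (z l)) ` ?A k"
            using bij_betw_imp_surj_on[OF Suc.IH] b0 by simp
          then obtain l where l: "l \<in> ?A k" "?cos k (z l) = b0" by blast
          then have "?cos (Suc k) (z l) = b" using push[OF zZ[of l k]] b0 by auto
          then show ?thesis using l alive[of l "Suc k"] b by (intro image_eqI[of _ _ l]) auto
        qed
      qed (use alive in auto)
    qed
  qed
qed


text \<open>After the index \<open>m\<close> the structure maps are identities, so nothing new is born.\<close>

lemma births_le:
  assumes cb: "P.compatible_bases m \<delta> Bs" and b: "(b, i) \<in> P.births m \<delta> Bs"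
  shows "i \<le> m"
proof (rule ccontr)
  assume i: "\<not> i \<le> m"
  have "vectorspace.basis class_ring (M (P.stage m \<delta> i)) (Bs i)"
    by (rule spec[OF cb[unfolded P.compatible_bases_def], THEN conjunct1])
  then have "b \<in> carrier (M (P.stage m \<delta> i))"
    using basis_M(2) b by (auto simp: P.births_def)
  moreover have st: "P.stage m \<delta> (i - 1) = P.stage m \<delta> i" using i by (simp add: P.stage_def)
  ultimately have "P.map_at m \<delta> (i - 1) (i - 1 + 1) b = b"
    using i P.map_refl[of b "P.stage m \<delta> i"] by simp
  then have "b \<in> P.image_at m \<delta> (i - 1)"
    unfolding P.image_at_def st using \<open>b \<in> carrier _\<close> i st by (metis Suc_eq_plus1 image_eqI)
  then show False using b i by (auto simp: P.births_def)
qed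

text \<open>The last index of a bar is the last stage before its representative enters \<open>B\<close>. It is smaller than
\<open>m\<close> when it is finite, so that \<open>\<delta> (Suc j)\<close> is one of the chosen critical values.\<close>

lemma bar_end:
  assumes sm: "strict_mono_on {..m} \<delta>"
    and l: "(b, i) \<in> P.births m \<delta> Bs" and z: "z \<in> Z (P.stage m \<delta> i)" "coset (B (P.stage m \<delta> i)) z = b"
    and alive: "\<And>k. i \<le> k \<Longrightarrow> coset (B (P.stage m \<delta> k)) z \<in> Bs k \<longleftrightarrow> z \<notin> B (P.stage m \<delta> k)"
  shows "(P.last_index m \<delta> Bs (b, i) = \<infinity> \<and> (\<forall>k. z \<notin> B (P.stage m \<delta> k))) \<or>
    (\<exists>j. P.last_index m \<delta> Bs (b, i) = enat j \<and> i \<le> j \<and> j < m \<and>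
       z \<notin> B (P.stage m \<delta> j) \<and> z \<in> B (P.stage m \<delta> (Suc j)))"
proof -
  let ?T = "P.stage m \<delta>"
  have bB: "b \<in> Bs i" using l by (auto simp: P.births_def)
  have B_closed: "z \<in> B (?T k')" if "z \<in> B (?T k)" "k \<le> k'" for k k'
    using B_mono[OF stage_mono[OF sm that(2)]] that by auto
  have "P.map_at m \<delta> i j b = coset (B (?T j)) z" if "i \<le> j" for j
    using map_at_coset[OF sm that z(1)] z(2) by simp
  then have set: "{j. i \<le> j \<and> P.map_at m \<delta> i j b \<in> Bs j} = {j. i \<le> j \<and> z \<notin> B (?T j)}"
    using alive by auto
  have last: "P.last_index m \<delta> Bs (b, i) = (SUP j \<in> {j. i \<le> j \<and> z \<notin> B (?T j)}. enat j)"
    unfolding P.last_index_def set[symmetric] by simp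
  have zi: "z \<notin> B (?T i)" using alive[of i] bB z by simp
  show ?thesis
  proof (cases "\<exists>k. z \<in> B (?T k)")
    case False
    have "enat n \<le> (SUP j \<in> {j. i \<le> j \<and> z \<notin> B (?T j)}. enat j)" for n
      using False by (intro SUP_upper2[of "max i n"]) auto
    then have "P.last_index m \<delta> Bs (b, i) = \<infinity>"
      unfolding last by (metis enat_ile enat_ord_simps(1) infinity_ileE not_infinity_eq not_less_eq_eq order_refl)
    then show ?thesis using False by auto
  next
    case True
    define k where "k = (LEAST k. z \<in> B (?T k))"
    have k: "z \<in> B (?T k)" using True unfolding k_def by (metis LeastI_ex)
    have before: "z \<notin> B (?T j)" if "j < k" for j using that not_less_Least unfolding k_def by blast
    have "i < k" using zi B_closed[OF k, of i] by (metis not_le_imp_less)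
    have "k \<le> m"
    proof (rule ccontr)
      assume "\<not> k \<le> m"
      then have "z \<in> B (?T m)" using k by (simp add: P.stage_def)
      then show False using before[of m] \<open>\<not> k \<le> m\<close> by auto
    qed
    obtain j where j: "k = Suc j" using \<open>i < k\<close> by (cases k) auto
    have set': "{j. i \<le> j \<and> z \<notin> B (?T j)} = {i..j}"
    proof -
      have iff: "z \<notin> B (?T x) \<longleftrightarrow> x \<le> j" for x
        using before[of x] B_closed[OF k, of x] j by (metis less_Suc_eq_le not_less)
      show ?thesis by (rule Set.set_eqI) (simp only: iff mem_Collect_eq atLeastAtMost_iff)
    qed
    have "(SUP j \<in> {i..j}. enat j) = enat j"
      using \<open>i < k\<close> j by (intro antisym SUP_least SUP_upper) auto
    then show ?thesis unfolding last set' using j k \<open>i < k\<close> \<open>k \<le> m\<close> before[of j] by auto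
  qed
qed

text \<open>The basis condition on \<open>Bs k\<close>, carried over to the bars alive at stage \<open>k\<close> along the bijection of
\<open>births_basis\<close>.\<close>

lemma alive_basis_iff:
  assumes sm: "strict_mono_on {..m} \<delta>" and cb: "P.compatible_bases m \<delta> Bs"
    and z: "\<And>b i. (b, i) \<in> P.births m \<delta> Bs \<Longrightarrow>
      z (b, i) \<in> Z (P.stage m \<delta> i) \<and> coset (B (P.stage m \<delta> i)) (z (b, i)) = b"
  defines "A \<equiv> \<lambda>k. {l \<in> P.births m \<delta> Bs. snd l \<le> k \<and> z l \<notin> B (P.stage m \<delta> k)}"
  shows "finite (A k)"
    and "x \<in> Z (P.stage m \<delta> k) \<Longrightarrow> \<exists>c. x - (\<Sum>l\<in>A k. c l *s z l) \<in> B (P.stage m \<delta> k)"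
    and "(\<Sum>l\<in>A k. c l *s z l) \<in> B (P.stage m \<delta> k) \<Longrightarrow> l \<in> A k \<Longrightarrow> c l = 0"
proof -
  let ?T = "P.stage m \<delta>"
  let ?cos = "\<lambda>l. coset (B (?T k)) (z l)"
  have bij: "bij_betw ?cos (A k) (Bs k)" unfolding A_def by (rule births_basis(1)[OF sm cb z])
  have basis: "vectorspace.basis class_ring (M (?T k)) (Bs k)"
    by (rule spec[OF cb[unfolded P.compatible_bases_def], THEN conjunct1])
  have finB: "finite (Bs k)" by (rule basis_M(1)[OF basis])
  then show "finite (A k)" using bij_betw_finite[OF bij] by simp
  define r where "r C = z (inv_into (A k) ?cos C)" for C
  have rl: "r (?cos l) = z l" if "l \<in> A k" for l
    unfolding r_def using inv_into_f_f[OF bij_betw_imp_inj_on[OF bij] that] by simp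
  have zZ: "z l \<in> Z (?T k)" if "l \<in> A k" for l
    using that z[of "fst l" "snd l"] Z_mono[OF stage_mono[OF sm, of "snd l" k]] by (auto simp: A_def)
  have rC: "r C \<in> Z (?T k) \<and> coset (B (?T k)) (r C) = C" if "C \<in> Bs k" for C
  proof -
    have "C \<in> ?cos ` A k" using that bij_betw_imp_surj_on[OF bij] by simp
    then obtain l where "l \<in> A k" "C = ?cos l" by blast
    then show ?thesis using rl zZ by simp
  qed
  have iff: "(\<forall>x\<in>Z (?T k). \<exists>c. x - (\<Sum>C\<in>Bs k. c C *s r C) \<in> B (?T k)) \<and>
      (\<forall>c. (\<Sum>C\<in>Bs k. c C *s r C) \<in> B (?T k) \<longrightarrow> (\<forall>C\<in>Bs k. c C = 0))"
    by (rule subquotient.basis_iff[OF subquotient_M finB, THEN iffD1, OF _ basis]) (rule rC)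
  have sum: "(\<Sum>C\<in>Bs k. c C *s r C) = (\<Sum>l\<in>A k. c (?cos l) *s z l)" for c
  proof -
    have "(\<Sum>C\<in>Bs k. c C *s r C) = (\<Sum>l\<in>A k. c (?cos l) *s r (?cos l))"
      by (rule sum.reindex_bij_betw[OF bij, symmetric])
    then show ?thesis using rl by simp
  qed
  show "\<exists>c. x - (\<Sum>l\<in>A k. c l *s z l) \<in> B (?T k)" if "x \<in> Z (?T k)"
  proof -
    from bspec[OF conjunct1[OF iff] that]
    obtain c where "x - (\<Sum>C\<in>Bs k. c C *s r C) \<in> B (?T k)" by (rule exE)
    then show ?thesis unfolding sum by (intro exI[of _ "\<lambda>l. c (?cos l)"])
  qed
  show "c l = 0" if c: "(\<Sum>l\<in>A k. c l *s z l) \<in> B (?T k)" and l: "l \<in> A k"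
  proof -
    let ?c = "\<lambda>C. c (inv_into (A k) ?cos C)"
    have inv: "inv_into (A k) ?cos (?cos l) = l" if "l \<in> A k" for l
      by (rule inv_into_f_f[OF bij_betw_imp_inj_on[OF bij] that])
    have "(\<Sum>C\<in>Bs k. ?c C *s r C) = (\<Sum>l\<in>A k. c l *s z l)"
      unfolding sum by (rule sum.cong) (simp_all add: inv)
    with c have "(\<Sum>C\<in>Bs k. ?c C *s r C) \<in> B (?T k)" by (simp only:)
    then have "\<forall>C\<in>Bs k. ?c C = 0" by (rule conjunct2[OF iff, rule_format, THEN ballI])
    then have "?c (?cos l) = 0" by (rule bspec) (rule bij_betw_apply[OF bij l])
    then show ?thesis using inv[OF l] by simp
  qed
qed

text \<open>At a critical value this is the description of the bars alive at a stage. Between critical values the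
structure map is bijective, which means that \<open>Z t\<close> is the sum of \<open>Z (\<delta> k)\<close> and \<open>B t\<close>, and that
\<open>Z (\<delta> k)\<close> meets \<open>B t\<close> in \<open>B (\<delta> k)\<close> only; so the basis persists.\<close>

lemma compatible_bases_interval_basis:
  assumes cv: "P.critical_values m \<delta>" and cb: "P.compatible_bases m \<delta> Bs"
  shows "\<exists>\<beta> d z. interval_basis (P.births m \<delta> Bs) \<beta> d z \<and>
    P.diagram_of_bases m \<delta> Bs = image_mset (\<lambda>l. (ereal (\<beta> l), d l)) (mset_set (P.births m \<delta> Bs))"
proof -
  let ?T = "P.stage m \<delta>" and ?L = "P.births m \<delta> Bs"
  have sm: "strict_mono_on {..m} \<delta>" using cv by (simp add: P.critical_values_def)
  have T: "?T k = \<delta> k" if "k \<le> m" for k using that by (simp add: P.stage_def)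
  have \<delta>_less: "\<delta> j < \<delta> k" if "j < k" "k \<le> m" for j k
    using strict_mono_onD[OF sm, of j k] that by simp
  have \<delta>_le: "\<delta> j \<le> \<delta> k" if "j \<le> k" "k \<le> m" for j k
    using \<delta>_less[of j k] that by (cases "j = k") auto
  have "\<exists>x. x \<in> Z (?T (snd l)) \<and> coset (B (?T (snd l))) x = fst l" if "l \<in> ?L" for l
  proof -
    have "vectorspace.basis class_ring (M (?T (snd l))) (Bs (snd l))"
      by (rule spec[OF cb[unfolded P.compatible_bases_def], THEN conjunct1])
    then have "fst l \<in> carrier (M (?T (snd l)))"
      using basis_M(2) that by (force simp: P.births_def)
    then show ?thesis by (auto simp: carrier_M)
  qed
  then obtain z where z0: "\<And>l. l \<in> ?L \<Longrightarrow>
      z l \<in> Z (?T (snd l)) \<and> coset (B (?T (snd l))) (z l) = fst l"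
    by metis
  then have z: "z (b, i) \<in> Z (?T i) \<and> coset (B (?T i)) (z (b, i)) = b" if "(b, i) \<in> ?L" for b i
    using that by fastforce
  define A where "A k = {l \<in> ?L. snd l \<le> k \<and> z l \<notin> B (?T k)}" for k
  note A = alive_basis_iff[OF sm cb z, folded A_def]
  define \<beta> where "\<beta> l = \<delta> (snd l)" for l :: "'e set \<times> nat"
  define d where "d l = (case P.last_index m \<delta> Bs l of enat j \<Rightarrow> ereal (\<delta> (j + 1)) | \<infinity> \<Rightarrow> \<infinity>)" for l
  have le_m: "snd l \<le> m" if "l \<in> ?L" for l using births_le[OF cb, of "fst l" "snd l"] that by simp
  have zZ: "z l \<in> Z (?T k)" if "l \<in> ?L" "snd l \<le> k" for l k
    using z0[OF that(1)] Z_mono[OF stage_mono[OF sm that(2)]] by auto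
  have bar: "(d l = \<infinity> \<and> (\<forall>k. z l \<notin> B (?T k))) \<or>
    (\<exists>j. d l = ereal (\<delta> (Suc j)) \<and> snd l \<le> j \<and> j < m \<and> z l \<notin> B (?T j) \<and> z l \<in> B (?T (Suc j)))"
    if l: "l \<in> ?L" for l
  proof -
    have l': "(fst l, snd l) \<in> ?L" using l by simp
    have "coset (B (?T k)) (z l) \<in> Bs k \<longleftrightarrow> z l \<notin> B (?T k)" if "snd l \<le> k" for k
      by (rule births_basis(2)[OF sm cb z l that])
    from bar_end[OF sm l' _ _ this] z0[OF l] show ?thesis
      unfolding d_def by (auto simp: Suc_eq_plus1[symmetric])
  qed
  have B_closed: "z l \<in> B (?T k')" if "z l \<in> B (?T k)" "k \<le> k'" for l k k'
    using B_mono[OF stage_mono[OF sm that(2)]] that by auto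
  have d_iff: "ereal (\<delta> k) < d l \<longleftrightarrow> z l \<notin> B (?T k)" if "l \<in> ?L" "k \<le> m" for l k
    using bar[OF that(1)]
  proof (elim disjE exE conjE)
    fix j assume j: "d l = ereal (\<delta> (Suc j))" "j < m" "z l \<notin> B (?T j)" "z l \<in> B (?T (Suc j))"
    show ?thesis
    proof (cases "k \<le> j")
      case True
      then show ?thesis using j B_closed[of l k j] \<delta>_less[of k "Suc j"] by auto
    next
      case False
      then show ?thesis using j B_closed[OF j(4), of k] \<delta>_le[of "Suc j" k] that(2) by auto
    qed
  qed auto
  have finL: "finite ?L"
  proof (rule finite_subset)
    have "finite (Bs i)" for i
      using basis_M(1) spec[OF cb[unfolded P.compatible_bases_def], THEN conjunct1] by blast
    then show "finite (\<Union>i\<le>m. Bs i \<times> {i})" by blast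
    show "?L \<subseteq> (\<Union>i\<le>m. Bs i \<times> {i})"
    proof
      fix l assume "l \<in> ?L"
      then show "l \<in> (\<Union>i\<le>m. Bs i \<times> {i})" using le_m[of l] by (auto simp: P.births_def)
    qed
  qed
  have basis_at: "(\<forall>x\<in>Z t. \<exists>c. x - (\<Sum>l\<in>alive ?L \<beta> d t. c l *s z l) \<in> B t) \<and>
     (\<forall>c. (\<Sum>l\<in>alive ?L \<beta> d t. c l *s z l) \<in> B t \<longrightarrow> (\<forall>l\<in>alive ?L \<beta> d t. c l = 0))" for t
  proof (cases "t < \<delta> 0")
    case True
    then have "carrier (M t) = {\<zero>\<^bsub>M t\<^esub>}" using cv by (simp add: P.critical_values_def)
    then have "x \<in> B t" if "x \<in> Z t" for x
      using imageI[OF that, of "coset (B t)"] coset_eq_zero_iff[of t x] by (simp add: carrier_M)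
    moreover have empty: "alive ?L \<beta> d t = {}"
      using True \<delta>_le[of 0] le_m by (force simp: alive_def \<beta>_def)
    ultimately show ?thesis by simp
  next
    case False
    \<comment> \<open>The stage that \<open>t\<close> belongs to.\<close>
    define k where "k = Max {k. k \<le> m \<and> \<delta> k \<le> t}"
    have fink: "finite {k. k \<le> m \<and> \<delta> k \<le> t}" by (rule finite_subset[of _ "{..m}"]) auto
    have "k \<in> {k. k \<le> m \<and> \<delta> k \<le> t}"
      unfolding k_def using False by (intro Max_in fink) (auto intro!: exI[of _ 0])
    then have k: "k \<le> m" "\<delta> k \<le> t" by auto
    have next_k: "t < \<delta> j" if "k < j" "j \<le> m" for j
      using Max_ge[OF fink, of j] that unfolding k_def[symmetric] by force
    have "bij_betw (\<nu> (\<delta> k) t) (carrier (M (\<delta> k))) (carrier (M t))"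
    proof -
      have "(\<exists>i\<in>{1..m}. \<delta> k \<in> {\<delta> (i - 1)..<\<delta> i} \<and> t \<in> {\<delta> (i - 1)..<\<delta> i}) \<or>
         (\<delta> k \<in> {\<delta> m..} \<and> t \<in> {\<delta> m..})"
      proof (cases "k = m")
        case False
        then have "t < \<delta> (Suc k)" "\<delta> k < \<delta> (Suc k)" using k next_k \<delta>_less by auto
        then show ?thesis using k False by (intro disjI1 bexI[of _ "Suc k"]) auto
      qed (use k in auto)
      then show ?thesis using cv k(2) unfolding P.critical_values_def by blast
    qed
    then have inj: "inj_on (\<nu> (\<delta> k) t) (carrier (M (\<delta> k)))"
      and surj: "\<nu> (\<delta> k) t ` carrier (M (\<delta> k)) = carrier (M t)" by (auto simp: bij_betw_def)
    have alive: "alive ?L \<beta> d t = A k"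
    proof -
      have "l \<in> alive ?L \<beta> d t \<longleftrightarrow> l \<in> A k" if l: "l \<in> ?L" for l
      proof -
        have "\<beta> l \<le> t \<longleftrightarrow> snd l \<le> k"
          using next_k[of "snd l"] le_m[OF l] \<delta>_le[of "snd l" k] k unfolding \<beta>_def by force
        moreover have "ereal t < d l \<longleftrightarrow> ereal (\<delta> k) < d l"
          using bar[OF l]
        proof (elim disjE exE conjE)
          fix j assume "d l = ereal (\<delta> (Suc j))" "j < m"
          then show ?thesis
            using next_k[of "Suc j"] \<delta>_le[of "Suc j" k] k by (cases "Suc j \<le> k") auto
        qed auto
        ultimately show ?thesis using d_iff[OF l k(1)] l by (auto simp: alive_def A_def)
      qed
      then show ?thesis by (auto simp: alive_def A_def)
    qed
    have Bkt: "B (\<delta> k) \<subseteq> B t" using B_mono k by simp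
    show ?thesis unfolding alive
    proof (intro conjI ballI allI impI)
      fix x assume "x \<in> Z t"
      then have "coset (B t) x \<in> \<nu> (\<delta> k) t ` carrier (M (\<delta> k))" unfolding surj by (auto simp: carrier_M)
      then obtain y where y: "y \<in> Z (\<delta> k)" "coset (B t) x = coset (B t) y"
        using \<nu>_coset[OF k(2)] by (auto simp: carrier_M)
      obtain c where c: "y - (\<Sum>l\<in>A k. c l *s z l) \<in> B (\<delta> k)" using A(2)[of y k] y T k by auto
      have "x - y \<in> B t" using y(2) by (simp only: coset_eq_iff)
      from B_diff_trans[OF this subsetD[OF Bkt c]]
      show "\<exists>c. x - (\<Sum>l\<in>A k. c l *s z l) \<in> B t" by blast
    next
      fix c l assume c: "(\<Sum>l\<in>A k. c l *s z l) \<in> B t" and l: "l \<in> A k"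
      let ?w = "\<Sum>l\<in>A k. c l *s z l"
      have wZ: "?w \<in> Z (\<delta> k)"
        using zZ[of _ k] T[OF k(1)]
        by (intro subspace_sum[OF subspace_Z] subspace_scale[OF subspace_Z]) (auto simp: A_def)
      have "\<nu> (\<delta> k) t (coset (B (\<delta> k)) ?w) = \<nu> (\<delta> k) t (coset (B (\<delta> k)) 0)"
        using \<nu>_coset[OF k(2) wZ] \<nu>_coset[OF k(2), of 0] c subspace_0[OF subspace_Z]
        by (simp add: coset_eq_iff)
      then have "coset (B (\<delta> k)) ?w = coset (B (\<delta> k)) 0"
        by (rule inj_onD[OF inj]) (use wZ subspace_0[OF subspace_Z] in \<open>auto simp: carrier_M\<close>)
      then have "?w \<in> B (?T k)" using T[OF k(1)] by (simp add: coset_eq_iff)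
      then show "c l = 0" using A(3) l by blast
    qed
  qed
  have "interval_basis ?L \<beta> d z"
    unfolding interval_basis_def
  proof (intro conjI)
    show "finite ?L" by (rule finL)
    show "\<forall>l\<in>?L. ereal (\<beta> l) < d l"
    proof
      fix l assume l: "l \<in> ?L"
      have "coset (B (?T (snd l))) (z l) \<in> Bs (snd l)" using z0[OF l] l by (auto simp: P.births_def)
      then have "z l \<notin> B (?T (snd l))" using births_basis(2)[OF sm cb z l order_refl] by simp
      then show "ereal (\<beta> l) < d l" using d_iff[OF l le_m[OF l]] by (simp add: \<beta>_def)
    qed
    show "\<forall>l\<in>?L. \<forall>t. \<beta> l \<le> t \<longrightarrow> z l \<in> Z t"
      using z0 le_m T Z_mono unfolding \<beta>_def by (metis subsetD)
    show "\<forall>l\<in>?L. \<forall>t. d l \<le> ereal t \<longrightarrow> z l \<in> B t"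
    proof (intro ballI allI impI)
      fix l t assume l: "l \<in> ?L" "d l \<le> ereal t"
      from bar[OF l(1)] obtain j where j: "d l = ereal (\<delta> (Suc j))" "j < m" "z l \<in> B (?T (Suc j))"
        using l(2) by auto
      then show "z l \<in> B t" using B_mono[of "\<delta> (Suc j)" t] T[of "Suc j"] l(2) by auto
    qed
  qed (use basis_at in auto)
  moreover have "P.diagram_of_bases m \<delta> Bs = image_mset (\<lambda>l. (ereal (\<beta> l), d l)) (mset_set ?L)"
    unfolding P.diagram_of_bases_def
    by (intro image_mset_cong) (auto simp: \<beta>_def d_def split: prod.splits)
  ultimately show ?thesis by blast
qed

end

section \<open>Bases adapted to two chains of subspaces\<close>

context vector_space
begin

text \<open>The basis is extended inside \<open>U' \<inter> D 0\<close>, then inside \<open>U' \<inter> D 1\<close>, and so on. A vector of \<open>U' \<inter> D k\<close>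
is a combination of new basis vectors, all of which lie in \<open>D k\<close>, and of old ones. The old part thus
lies in \<open>U \<inter> D k\<close>, where the old basis is already adapted.\<close>

lemma extend_adapted_basis:
  assumes U: "subspace U" and U': "subspace U'" and UU': "U \<subseteq> U'"
    and D: "\<And>j. subspace (D j)" "\<And>i j. i \<le> j \<Longrightarrow> D i \<subseteq> D (j::nat)"
    and X: "independent X" "X \<subseteq> U" "U \<subseteq> span X" "\<And>j. j < n \<Longrightarrow> U \<inter> D j \<subseteq> span (X \<inter> D j)"
  shows "\<exists>Y. X \<subseteq> Y \<and> independent Y \<and> Y \<subseteq> U' \<and> U' \<subseteq> span Y \<and> Y \<inter> U = X \<and>
    (\<forall>j<n. U' \<inter> D j \<subseteq> span (Y \<inter> D j))"
proof -
  have "\<exists>Y. X \<subseteq> Y \<and> independent Y \<and> Y \<subseteq> U' \<and> (\<forall>j<k. U' \<inter> D j \<subseteq> span (Y \<inter> D j)) \<and>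
      (\<forall>y\<in>Y - X. \<exists>j<k. y \<in> D j)" if "k \<le> n" for k
    using that
  proof (induction k)
    case 0
    then show ?case using X UU' by (intro exI[of _ X]) auto
  next
    case (Suc k)
    then obtain Y where Y: "X \<subseteq> Y" "independent Y" "Y \<subseteq> U'"
      "\<forall>j<k. U' \<inter> D j \<subseteq> span (Y \<inter> D j)" "\<forall>y\<in>Y - X. \<exists>j<k. y \<in> D j" by auto
    obtain E where E: "Y \<subseteq> E" "E \<subseteq> Y \<union> (U' \<inter> D k)" "independent E" "Y \<union> (U' \<inter> D k) \<subseteq> span E"
      using maximal_independent_subset_extend[OF _ Y(2), of "Y \<union> (U' \<inter> D k)"] by auto
    have new: "E - X \<subseteq> D k"
    proof
      fix y assume y: "y \<in> E - X"
      show "y \<in> D k"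
      proof (cases "y \<in> Y")
        case True
        then obtain j where "j < k" "y \<in> D j" using Y(5) y by auto
        then show ?thesis using D(2)[of j k] by auto
      qed (use y E in auto)
    qed
    have "U' \<inter> D k \<subseteq> span (E \<inter> D k)"
    proof
      fix z assume z: "z \<in> U' \<inter> D k"
      have "E = X \<union> (E - X)" using Y E by auto
      then have "z \<in> span (X \<union> (E - X))" using z E by auto
      then obtain x w where xw: "x \<in> span X" "w \<in> span (E - X)" "z = x + w"
        unfolding span_Un by auto
      have "w \<in> D k" using span_minimal[OF new D(1)] xw by auto
      then have "x \<in> D k" using subspace_diff[OF D(1), of z k w] z xw by simp
      moreover have "x \<in> U" using span_minimal[OF X(2) U] xw by auto
      ultimately have "x \<in> span (X \<inter> D k)" using X(4)[of k] Suc.prems by auto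
      moreover have "span (X \<inter> D k) \<subseteq> span (E \<inter> D k)" "span (E - X) \<subseteq> span (E \<inter> D k)"
        using Y E new by (auto intro!: span_mono)
      ultimately show "z \<in> span (E \<inter> D k)" using xw by (auto intro: span_add)
    qed
    moreover have "U' \<inter> D j \<subseteq> span (E \<inter> D j)" if "j < k" for j
    proof -
      have "span (Y \<inter> D j) \<subseteq> span (E \<inter> D j)" using E by (intro span_mono) auto
      then show ?thesis using Y(4) that by blast
    qed
    ultimately have "\<forall>j<Suc k. U' \<inter> D j \<subseteq> span (E \<inter> D j)" by (auto simp: less_Suc_eq)
    moreover have "\<forall>y\<in>E - X. \<exists>j<Suc k. y \<in> D j" using new by auto
    ultimately show ?case using Y E by (intro exI[of _ E]) auto
  qed
  from this[OF order_refl] obtain Y where Y: "X \<subseteq> Y" "independent Y" "Y \<subseteq> U'"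
      "\<forall>j<n. U' \<inter> D j \<subseteq> span (Y \<inter> D j)" by (elim exE conjE)
  obtain E where E: "Y \<subseteq> E" "E \<subseteq> U'" "independent E" "U' \<subseteq> span E"
    using maximal_independent_subset_extend[OF Y(3,2)] by auto
  have "U' \<inter> D j \<subseteq> span (E \<inter> D j)" if "j < n" for j
  proof -
    have "span (Y \<inter> D j) \<subseteq> span (E \<inter> D j)" using E by (intro span_mono) auto
    then show ?thesis using Y(4) that by blast
  qed
  moreover have "E \<inter> U \<subseteq> X"
  proof
    fix y assume y: "y \<in> E \<inter> U"
    show "y \<in> X"
    proof (rule ccontr)
      assume "y \<notin> X"
      then have "span X \<subseteq> span (E - {y})" using Y E by (intro span_mono) auto
      then have "y \<in> span (E - {y})" using y X by auto
      then show False using E(3) y unfolding dependent_def by blast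
    qed
  qed
  ultimately show ?thesis using Y E X by (intro exI[of _ E]) auto
qed

text \<open>Extends an adapted basis from each member of the chain \<open>C\<close> to the next. Since the new vectors lie
outside the old subspace, adaptedness to the earlier members of \<open>C\<close> is preserved.\<close>

lemma adapted_basis_of_two_chains:
  fixes C D :: "nat \<Rightarrow> 'b set"
  assumes C: "\<And>j. subspace (C j)" "\<And>i j. i \<le> j \<Longrightarrow> C i \<subseteq> C j"
    and D: "\<And>j. subspace (D j)" "\<And>i j. i \<le> j \<Longrightarrow> D i \<subseteq> D j"
  shows "\<exists>X. independent X \<and> X \<subseteq> C m \<and> (\<forall>i\<le>m. C i \<subseteq> span (X \<inter> C i)) \<and>
    (\<forall>j<n. C m \<inter> D j \<subseteq> span (X \<inter> D j))"
proof (induction m)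
  case 0
  obtain Y where "independent Y" "Y \<subseteq> C 0" "C 0 \<subseteq> span Y" "\<forall>j<n. C 0 \<inter> D j \<subseteq> span (Y \<inter> D j)"
    using extend_adapted_basis[of "{0}" "C 0" D "{}" n] C D
    by (auto simp: subspace_0 independent_empty)
  then show ?case by (intro exI[of _ Y]) (auto simp: Int_absorb2)
next
  case (Suc m)
  then obtain X where X: "independent X" "X \<subseteq> C m" "\<forall>i\<le>m. C i \<subseteq> span (X \<inter> C i)"
    "\<forall>j<n. C m \<inter> D j \<subseteq> span (X \<inter> D j)" by blast
  have CX: "C m \<subseteq> span X" using X(3) span_mono[of "X \<inter> C m" X] by blast
  obtain Y where Y: "X \<subseteq> Y" "independent Y" "Y \<subseteq> C (Suc m)" "C (Suc m) \<subseteq> span Y" "Y \<inter> C m = X"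
      "\<forall>j<n. C (Suc m) \<inter> D j \<subseteq> span (Y \<inter> D j)"
    using extend_adapted_basis[where D = D and n = n, OF C(1)[of m] C(1)[of "Suc m"]
        C(2)[of m "Suc m"] D X(1,2) CX] X(4)
    by auto
  have "C i \<subseteq> span (Y \<inter> C i)" if "i \<le> Suc m" for i
  proof (cases "i = Suc m")
    case True
    then show ?thesis using Y by (simp add: Int_absorb2)
  next
    case False
    then have "i \<le> m" using that by simp
    moreover have "X \<inter> C i \<subseteq> Y \<inter> C i" using Y by auto
    ultimately show ?thesis using X(3) span_mono by blast
  qed
  then show ?case using Y by (intro exI[of _ Y]) auto
qed

lemma sum_in_span_of_disjoint:
  assumes X: "independent X" "finite X" and PQ: "P \<subseteq> X" "Q \<subseteq> X" "P \<inter> Q = {}"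
    and c: "(\<Sum>y\<in>P. scale (c y) y) \<in> span Q" and y: "y \<in> P"
  shows "c y = 0"
proof -
  have fin: "finite P" "finite Q" using X PQ by (auto intro: finite_subset)
  obtain e where e: "(\<Sum>y\<in>P. scale (c y) y) = (\<Sum>y\<in>Q. scale (e y) y)"
    using c unfolding span_finite[OF fin(2)] by auto
  let ?u = "\<lambda>y. if y \<in> P then c y else - e y"
  have "(\<Sum>y\<in>P \<union> Q. scale (?u y) y) = (\<Sum>y\<in>P. scale (?u y) y) + (\<Sum>y\<in>Q. scale (?u y) y)"
    using fin PQ by (intro sum.union_disjoint) auto
  also have "(\<Sum>y\<in>P. scale (?u y) y) = (\<Sum>y\<in>P. scale (c y) y)" by (rule sum.cong) auto
  also have "(\<Sum>y\<in>Q. scale (?u y) y) = (\<Sum>y\<in>Q. - scale (e y) y)"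
    using PQ by (intro sum.cong) auto
  finally have zero: "(\<Sum>y\<in>P \<union> Q. scale (?u y) y) = 0" by (simp add: sum_negf e)
  have "?u y = 0"
    by (rule independentD[OF X(1) _ _ zero]) (use fin PQ y in auto)
  then show ?thesis using y by simp
qed

end

section \<open>Existence of compatible bases\<close>

context persistent_subquotient
begin

text \<open>For a basis \<open>X\<close> adapted to both chains, the elements of \<open>X\<close> in \<open>Z t\<close> but not in \<open>B t\<close> represent a basis
of \<open>Z t / B t\<close>, and the structure maps send these representatives to themselves.\<close>

lemma compatible_bases_exist:
  assumes sm: "strict_mono_on {..m} \<delta>"
  shows "\<exists>Bs. P.compatible_bases m \<delta> Bs"
proof -
  let ?T = "P.stage m \<delta>"
  note mono = stage_mono[OF sm]
  have Zm: "Z (?T i) \<subseteq> Z (?T j)" and Bm: "B (?T i) \<subseteq> B (?T j)" if "i \<le> j" for i j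
    using that Z_mono B_mono mono by auto
  obtain X where X: "independent X" "X \<subseteq> Z (?T m)" "\<forall>i\<le>m. Z (?T i) \<subseteq> span (X \<inter> Z (?T i))"
    "\<forall>j<Suc m. Z (?T m) \<inter> B (?T j) \<subseteq> span (X \<inter> B (?T j))"
    using adapted_basis_of_two_chains[of "\<lambda>i. Z (?T i)" "\<lambda>i. B (?T i)" m "Suc m"]
      subspace_Z subspace_B Zm Bm by metis
  have stage_min: "?T (min i m) = ?T i" for i by (simp add: P.stage_def)
  have finX: "finite X"
    using independent_span_bound[OF finite_S X(1)] X(2) Z_span by blast
  have ZX: "Z (?T i) \<subseteq> span (X \<inter> Z (?T i))" for i
    using X(3)[rule_format, of "min i m"] by (simp add: stage_min)
  have BX: "B (?T i) \<subseteq> span (X \<inter> B (?T i))" for i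
  proof -
    have "B (?T (min i m)) \<subseteq> Z (?T m)"
      by (rule order_trans[OF B_le_Z Zm]) simp
    then show ?thesis using X(4)[rule_format, OF le_imp_less_Suc[OF min.cobounded2[of i m]]]
      by (simp add: stage_min Int_absorb1)
  qed
  have BspanX: "span (X \<inter> B (?T i)) \<subseteq> B (?T i)" for i
    by (rule span_minimal[OF _ subspace_B]) auto
  \<comment> \<open>The set \<open>U i j\<close> represents a basis of the image of stage \<open>i\<close> in stage \<open>j\<close>.\<close>
  define U where "U i j = X \<inter> Z (?T i) - B (?T j)" for i j
  have finU: "finite (U i j)" for i j using finX by (simp add: U_def)
  have gen: "\<exists>c. x - (\<Sum>y\<in>U i j. c y *s y) \<in> B (?T j)" if "x \<in> Z (?T i)" for i j x
  proof -
    have "X \<inter> Z (?T i) \<subseteq> U i j \<union> (X \<inter> B (?T j))" by (auto simp: U_def)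
    then have "x \<in> span (U i j \<union> (X \<inter> B (?T j)))" using ZX that span_mono by blast
    then obtain u w where uw: "u \<in> span (U i j)" "w \<in> span (X \<inter> B (?T j))" "x = u + w"
      unfolding span_Un by auto
    then obtain c where "u = (\<Sum>y\<in>U i j. c y *s y)" unfolding span_finite[OF finU] by auto
    then show ?thesis using uw BspanX by (intro exI[of _ c]) auto
  qed
  have indep: "c y = 0" if "(\<Sum>y\<in>U i j. c y *s y) \<in> B (?T j)" "y \<in> U i j" for c y i j
    by (rule sum_in_span_of_disjoint[OF X(1) finX, of "U i j" "X \<inter> B (?T j)"])
      (use that BX[of j] in \<open>auto simp: U_def\<close>)
  define Bs where "Bs i = coset (B (?T i)) ` U i i" for i
  have push: "P.map_at m \<delta> i (i + 1) (coset (B (?T i)) x) = coset (B (?T (i + 1))) x"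
    if "x \<in> Z (?T i)" for i x
    using map_at_coset[OF sm _ that] by simp
  have basis: "inj_on (coset (B (?T i))) (U i i)" "vectorspace.basis class_ring (M (?T i)) (Bs i)" for i
  proof -
    have "U i i \<subseteq> Z (?T i)" by (auto simp: U_def)
    note family = subquotient.basis_of_family[OF subquotient_M finU this]
    show "inj_on (coset (B (?T i))) (U i i)"
      by (rule family(1); (erule gen | erule (1) indep))
    show "vectorspace.basis class_ring (M (?T i)) (Bs i)"
      unfolding Bs_def by (rule family(2); (erule gen | erule (1) indep))
  qed
  have zero: "coset (B (?T i)) x = \<zero>\<^bsub>M (?T i)\<^esub> \<longleftrightarrow> x \<in> B (?T i)" for i x
    by (rule coset_eq_zero_iff)
  have UU: "U i (i + 1) \<subseteq> U i i" "U i (i + 1) \<subseteq> U (i + 1) (i + 1)" for i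
    using Zm[of i "i + 1"] Bm[of i "i + 1"] by (auto simp: U_def)
  have image: "P.image_at m \<delta> i = coset (B (?T (i + 1))) ` Z (?T i)" for i
    unfolding P.image_at_def carrier_M image_image by (rule image_cong[OF refl push])
  have hit: "P.map_at m \<delta> i (i + 1) ` Bs i \<inter> Bs (i + 1) = coset (B (?T (i + 1))) ` U i (i + 1)" for i
  proof (intro equalityI subsetI)
    fix b assume "b \<in> P.map_at m \<delta> i (i + 1) ` Bs i \<inter> Bs (i + 1)"
    then obtain x where x: "x \<in> U i i" "b = coset (B (?T (i + 1))) x" "b \<in> Bs (i + 1)"
      using push by (auto simp: Bs_def U_def)
    have "b \<noteq> \<zero>\<^bsub>M (?T (i + 1))\<^esub>" using basis_M(3)[OF basis(2)] x by blast
    then show "b \<in> coset (B (?T (i + 1))) ` U i (i + 1)" using x zero by (auto simp: U_def)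
  next
    fix b assume "b \<in> coset (B (?T (i + 1))) ` U i (i + 1)"
    then obtain x where x: "x \<in> U i (i + 1)" "b = coset (B (?T (i + 1))) x" by auto
    then have "coset (B (?T i)) x \<in> Bs i" "b \<in> Bs (i + 1)" using UU[of i] by (auto simp: Bs_def)
    moreover have "P.map_at m \<delta> i (i + 1) (coset (B (?T i)) x) = b" using x push by (auto simp: U_def)
    ultimately show "b \<in> P.map_at m \<delta> i (i + 1) ` Bs i \<inter> Bs (i + 1)" by blast
  qed
  have "P.compatible_bases m \<delta> Bs"
    unfolding P.compatible_bases_def
  proof (intro allI conjI ballI)
    fix i
    show "vectorspace.basis class_ring (M (?T i)) (Bs i)" by (rule basis)
    show "P.map_at m \<delta> i (i + 1) ` Bs i \<subseteq> Bs (i + 1) \<union> {\<zero>\<^bsub>M (?T (i + 1))\<^esub>}"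
    proof
      fix b assume "b \<in> P.map_at m \<delta> i (i + 1) ` Bs i"
      then obtain x where x: "x \<in> U i i" "b = coset (B (?T (i + 1))) x"
        using push by (auto simp: Bs_def U_def)
      then show "b \<in> Bs (i + 1) \<union> {\<zero>\<^bsub>M (?T (i + 1))\<^esub>}"
        using zero[of "i + 1" x] Zm[of i "i + 1"] by (auto simp: Bs_def U_def)
    qed
    let ?t = "?T (i + 1)"
    let ?Z = "{x + y |x y. x \<in> Z (?T i) \<and> y \<in> B ?t}"
    let ?M = "M ?t\<lparr>carrier := P.image_at m \<delta> i\<rparr>"
    have ZZ: "?Z \<subseteq> Z ?t"
      using Zm[of i "i + 1"] B_le_Z[of ?t] subspace_add[OF subspace_Z[of ?t]] by fastforce
    have Z_sum: "x + 0 \<in> ?Z" if "x \<in> Z (?T i)" for x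
      using that subspace_0[OF subspace_B[of ?t]] by blast
    \<comment> \<open>The image of the structure map is again a subquotient, of the sum of \<open>Z\<close> at the earlier
      stage and \<open>B\<close> at the later one.\<close>
    have sq: "subquotient scale ?Z (B ?t) ?M"
    proof (intro_locales, unfold subquotient_axioms_def, intro conjI allI impI)
      show "subspace ?Z" by (rule subspace_sums[OF subspace_Z subspace_B])
      show "subspace (B ?t)" by (rule subspace_B)
      show "B ?t \<subseteq> ?Z" using subspace_0[OF subspace_Z[of "?T i"]] by force
      show "carrier ?M = coset (B ?t) ` ?Z"
      proof -
        have "coset (B ?t) ` ?Z = coset (B ?t) ` Z (?T i)"
        proof (intro equalityI subsetI)
          fix C assume "C \<in> coset (B ?t) ` ?Z"
          then obtain x y where "x \<in> Z (?T i)" "y \<in> B ?t" "C = coset (B ?t) (x + y)" by auto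
          moreover from this have "C = coset (B ?t) x" by (simp add: coset_eq_iff)
          ultimately show "C \<in> coset (B ?t) ` Z (?T i)" by blast
        qed (use Z_sum in force)
        then show ?thesis using image by simp
      qed
      show "\<zero>\<^bsub>?M\<^esub> = B ?t" using subquotient.zero_M[OF subquotient_M] by simp
      show "coset (B ?t) x \<oplus>\<^bsub>?M\<^esub> coset (B ?t) y = coset (B ?t) (x + y)"
        if "x \<in> ?Z" "y \<in> ?Z" for x y
        using subquotient.add_M[OF subquotient_M, of x ?t y] that ZZ by (simp add: subset_iff)
      show "a \<odot>\<^bsub>?M\<^esub> coset (B ?t) x = coset (B ?t) (a *s x)" if "x \<in> ?Z" for a x
        using subquotient.smult_M[OF subquotient_M, of x ?t a] that ZZ by (simp add: subset_iff)
    qed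
    have gen': "\<exists>c. x - (\<Sum>y\<in>U i (i + 1). c y *s y) \<in> B ?t" if x: "x \<in> ?Z" for x
    proof -
      obtain u w where uw: "u \<in> Z (?T i)" "w \<in> B ?t" "x = u + w" using x by blast
      obtain c where "u - (\<Sum>y\<in>U i (i + 1). c y *s y) \<in> B ?t" using gen[OF uw(1)] by blast
      then have "u - (\<Sum>y\<in>U i (i + 1). c y *s y) + w \<in> B ?t"
        using subspace_add[OF subspace_B] uw by blast
      then show ?thesis using uw by (intro exI[of _ c]) (simp add: algebra_simps)
    qed
    have "U i (i + 1) \<subseteq> ?Z" using Z_sum by (force simp: U_def)
    note family = subquotient.basis_of_family[OF sq finU this]
    have b: "vectorspace.basis class_ring ?M (coset (B ?t) ` U i (i + 1))"
      by (rule family(2); (erule gen' | erule (1) indep))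
    show "vectorspace.dim class_ring ?M = card (P.map_at m \<delta> i (i + 1) ` Bs i \<inter> Bs (i + 1))"
      unfolding hit
      by (rule vectorspace.dim_basis[OF subquotient.vectorspace_M[OF sq] _ b]) (simp add: finU)
    fix b' assume b': "b' \<in> P.image_at m \<delta> i \<inter> Bs (i + 1)"
    then obtain x z where x: "x \<in> U (i + 1) (i + 1)" "b' = coset (B ?t) x"
      and z: "z \<in> Z (?T i)" "b' = coset (B ?t) z" unfolding image Bs_def by auto
    have "x \<in> Z (?T i)"
    proof (rule ccontr)
      assume "x \<notin> Z (?T i)"
      have "x - z \<in> B ?t" using x z coset_eq_iff by metis
      have "(X \<inter> Z (?T i)) \<union> (X \<inter> B ?t) \<subseteq> X - {x}"
        using x \<open>x \<notin> Z (?T i)\<close> by (auto simp: U_def)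
      then have "span (X \<inter> Z (?T i)) \<subseteq> span (X - {x})" "span (X \<inter> B ?t) \<subseteq> span (X - {x})"
        by (auto intro!: span_mono)
      then have "z \<in> span (X - {x})" "x - z \<in> span (X - {x})"
        using ZX[of i] BX[of "i + 1"] z \<open>x - z \<in> B ?t\<close> by blast+
      then have "x \<in> span (X - {x})" using span_add[of z _ "x - z"] by simp
      then show False using X(1) x unfolding dependent_def by (auto simp: U_def)
    qed
    then have xU: "x \<in> U i (i + 1)" using x by (auto simp: U_def)
    show "\<exists>!b. b \<in> Bs i \<and> P.map_at m \<delta> i (i + 1) b = b'"
    proof (intro ex1I conjI)
      show "coset (B (?T i)) x \<in> Bs i" using xU UU by (auto simp: Bs_def)
      show "P.map_at m \<delta> i (i + 1) (coset (B (?T i)) x) = b'" using push x xU by (auto simp: U_def)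
      fix b assume h: "b \<in> Bs i \<and> P.map_at m \<delta> i (i + 1) b = b'"
      then obtain y where y: "y \<in> U i i" "b = coset (B (?T i)) y" by (auto simp: Bs_def)
      then have yb: "coset (B ?t) y = b'" using h push by (auto simp: U_def)
      moreover have "x \<notin> B ?t" using x by (auto simp: U_def)
      ultimately have "y \<notin> B ?t" using x zero[of "i + 1"] by metis
      then have "y \<in> U (i + 1) (i + 1)" using y Zm[of i "i + 1"] by (auto simp: U_def)
      then have "y = x" using inj_onD[OF basis(1)[of "i + 1"]] yb x by auto
      then show "b = coset (B (?T i)) x" using y by simp
    qed
  qed
  then show ?thesis by blast
qed

lemma persistence_diagram_interval_basis:
  assumes cv: "P.critical_values m \<delta>"
  shows "\<exists>(L :: ('e set \<times> nat) set) \<beta> d z. interval_basis L \<beta> d z \<and>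
    P.persistence_diagram = image_mset (\<lambda>l. (ereal (\<beta> l), d l)) (mset_set L)"
proof -
  have "strict_mono_on {..m} \<delta>" using cv by (simp add: P.critical_values_def)
  then obtain Bs where "P.compatible_bases m \<delta> Bs" using compatible_bases_exist by blast
  then have "\<exists>D m \<delta> Bs. P.critical_values m \<delta> \<and> P.compatible_bases m \<delta> Bs \<and>
      D = P.diagram_of_bases m \<delta> Bs" using cv by blast
  then have "\<exists>m \<delta> Bs. P.critical_values m \<delta> \<and> P.compatible_bases m \<delta> Bs \<and>
      P.persistence_diagram = P.diagram_of_bases m \<delta> Bs"
    unfolding P.persistence_diagram_def by (rule someI_ex)
  then obtain m \<delta> Bs where h: "P.critical_values m \<delta>" "P.compatible_bases m \<delta> Bs"
    "P.persistence_diagram = P.diagram_of_bases m \<delta> Bs" by (elim exE conjE)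
  from compatible_bases_interval_basis[OF h(1,2)] show ?thesis
    unfolding h(3) by (elim exE conjE) (intro exI conjI)
qed

end

section \<open>Linear maps between chain spaces\<close>

definition chain_scale :: "'k::field \<Rightarrow> ('a \<Rightarrow>\<^sub>0 'k) \<Rightarrow> ('a \<Rightarrow>\<^sub>0 'k)" where
  "chain_scale a = Poly_Mapping.map ((*) a)"

lemma lookup_chain_scale [simp]:
  "Poly_Mapping.lookup (chain_scale a c) x = a * Poly_Mapping.lookup c x"
  by (simp add: chain_scale_def Poly_Mapping.map.rep_eq when_def)

interpretation chain: vector_space "chain_scale :: 'k::field \<Rightarrow> ('a \<Rightarrow>\<^sub>0 'k) \<Rightarrow> ('a \<Rightarrow>\<^sub>0 'k)"
  by unfold_locales (auto intro!: poly_mapping_eqI simp: lookup_add algebra_simps)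

interpretation chain_pair: vector_space_pair
  "chain_scale :: 'k::field \<Rightarrow> ('a \<Rightarrow>\<^sub>0 'k) \<Rightarrow> ('a \<Rightarrow>\<^sub>0 'k)"
  "chain_scale :: 'k::field \<Rightarrow> ('b \<Rightarrow>\<^sub>0 'k) \<Rightarrow> ('b \<Rightarrow>\<^sub>0 'k)" ..

abbreviation simplex :: "'a \<Rightarrow> ('a \<Rightarrow>\<^sub>0 'k::field)" where
  "simplex x \<equiv> Poly_Mapping.single x 1"

abbreviation chain_linear :: "(('a \<Rightarrow>\<^sub>0 'k::field) \<Rightarrow> ('b \<Rightarrow>\<^sub>0 'k)) \<Rightarrow> bool" where
  "chain_linear f \<equiv> Vector_Spaces.linear chain_scale chain_scale f"

lemma chain_linearI:
  assumes "\<And>c c'. f (c + c') = f c + f c'" "\<And>a c. f (chain_scale a c) = chain_scale a (f c)"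
  shows "chain_linear f"
  using assms by unfold_locales auto

lemma chain_linear_simps:
  assumes "chain_linear f"
  shows "f (c + c') = f c + f c'" "f (c - c') = f c - f c'" "f 0 = 0"
    "f (chain_scale a c) = chain_scale a (f c)" "f (\<Sum>i\<in>I. h i) = (\<Sum>i\<in>I. f (h i))"
proof -
  interpret f: Vector_Spaces.linear chain_scale chain_scale f by fact
  show "f (c + c') = f c + f c'" "f (c - c') = f c - f c'" "f 0 = 0"
    "f (chain_scale a c) = chain_scale a (f c)" "f (\<Sum>i\<in>I. h i) = (\<Sum>i\<in>I. f (h i))"
    by (fact f.add f.diff f.zero f.scale f.sum)+
qed

definition chain_extend :: "('a \<Rightarrow> ('b \<Rightarrow>\<^sub>0 'k::field)) \<Rightarrow> ('a \<Rightarrow>\<^sub>0 'k) \<Rightarrow> ('b \<Rightarrow>\<^sub>0 'k)" where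
  "chain_extend \<phi> c = (\<Sum>x\<in>Poly_Mapping.keys c. chain_scale (Poly_Mapping.lookup c x) (\<phi> x))"

lemma chain_extend_superset:
  assumes "finite A" "Poly_Mapping.keys c \<subseteq> A"
  shows "chain_extend \<phi> c = (\<Sum>x\<in>A. chain_scale (Poly_Mapping.lookup c x) (\<phi> x))"
  unfolding chain_extend_def using assms
  by (intro sum.mono_neutral_left) (auto simp: in_keys_iff)

lemma linear_chain_extend:
  fixes \<phi> :: "'a \<Rightarrow> ('b \<Rightarrow>\<^sub>0 'k::field)"
  shows "chain_linear (chain_extend \<phi>)"
proof (rule chain_linearI)
  fix c c' :: "'a \<Rightarrow>\<^sub>0 'k" and a
  let ?A = "Poly_Mapping.keys c \<union> Poly_Mapping.keys c'"
  have "Poly_Mapping.keys (c + c') \<subseteq> ?A" by (rule Poly_Mapping.keys_add)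
  then show "chain_extend \<phi> (c + c') = chain_extend \<phi> c + chain_extend \<phi> c'"
    by (subst (1 2 3) chain_extend_superset[of ?A])
      (auto simp: lookup_add chain.scale_left_distrib sum.distrib)
  have "Poly_Mapping.keys (chain_scale a c) \<subseteq> Poly_Mapping.keys c" by (auto simp: in_keys_iff)
  then show "chain_extend \<phi> (chain_scale a c) = chain_scale a (chain_extend \<phi> c)"
    by (subst chain_extend_superset[of "Poly_Mapping.keys c"])
      (auto simp: chain_extend_def chain.scale_sum_right)
qed

lemma chain_extend_simplex [simp]: "chain_extend \<phi> (simplex x) = \<phi> x"
  by (simp add: chain_extend_def)

lemma chain_sum_of_simplices: "c = (\<Sum>x\<in>Poly_Mapping.keys c. chain_scale (Poly_Mapping.lookup c x) (simplex x))"
proof (rule poly_mapping_eqI)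
  fix y
  have "(\<Sum>x\<in>Poly_Mapping.keys c. Poly_Mapping.lookup c x * Poly_Mapping.lookup (simplex x) y)
      = (\<Sum>x\<in>Poly_Mapping.keys c. if x = y then Poly_Mapping.lookup c y else 0)"
    by (rule sum.cong) (auto simp: lookup_single when_def)
  also have "\<dots> = Poly_Mapping.lookup c y" by (auto simp: in_keys_iff)
  finally show "Poly_Mapping.lookup c y = Poly_Mapping.lookup
      (\<Sum>x\<in>Poly_Mapping.keys c. chain_scale (Poly_Mapping.lookup c x) (simplex x)) y"
    by (simp add: lookup_sum)
qed

lemma chain_linear_eqI:
  assumes f: "chain_linear f" and g: "chain_linear g" and eq: "\<And>x. f (simplex x) = g (simplex x)"
  shows "f c = g c"
  by (subst (1 2) chain_sum_of_simplices) (simp add: chain_linear_simps[OF f] chain_linear_simps[OF g] eq)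

lemma chain_linear_compose: "chain_linear f \<Longrightarrow> chain_linear g \<Longrightarrow> chain_linear (\<lambda>c. g (f c))"
  by (rule chain_linearI) (simp_all add: chain_linear_simps)

lemma chain_linear_diff: "chain_linear f \<Longrightarrow> chain_linear g \<Longrightarrow> chain_linear (\<lambda>c. f c - g c)"
  by (rule chain_linearI) (simp_all add: chain_linear_simps chain.scale_right_diff_distrib)

lemma chain_linear_add: "chain_linear f \<Longrightarrow> chain_linear g \<Longrightarrow> chain_linear (\<lambda>c. f c + g c)"
  by (rule chain_linearI) (simp_all add: chain_linear_simps chain.scale_right_distrib)

lemma chain_linear_id: "chain_linear (\<lambda>c. c)"
  by (rule chain_linearI) simp_all

lemma keys_chain_scale: "Poly_Mapping.keys (chain_scale a c) \<subseteq> Poly_Mapping.keys c"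
  by (auto simp: in_keys_iff)

lemma keys_chain_extend:
  "Poly_Mapping.keys (chain_extend \<phi> c) \<subseteq> (\<Union>x\<in>Poly_Mapping.keys c. Poly_Mapping.keys (\<phi> x))"
  unfolding chain_extend_def
  by (intro order_trans[OF keys_sum] UN_mono order_refl keys_chain_scale)

section \<open>The augmented boundary and the prism operator\<close>

text \<open>The cone with apex \<open>x\<close>.\<close>

definition prepend :: "'a \<Rightarrow> ('a list \<Rightarrow>\<^sub>0 'k::field) \<Rightarrow> ('a list \<Rightarrow>\<^sub>0 'k)" where
  "prepend x = chain_extend (\<lambda>xs. simplex (x # xs))"

text \<open>The augmented boundary of a simplex: the empty tuple counts as a simplex and is the boundary of every
vertex. With it the recursion is uniform, and all identities below follow by induction on the tuple.\<close>

primrec faces :: "'a list \<Rightarrow> ('a list \<Rightarrow>\<^sub>0 'k::field)" where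
  "faces [] = 0"
| "faces (x # xs) = simplex xs - prepend x (faces xs)"

definition chain_boundary :: "('a list \<Rightarrow>\<^sub>0 'k::field) \<Rightarrow> ('a list \<Rightarrow>\<^sub>0 'k)" (\<open>\<partial>\<close>) where
  "\<partial> = chain_extend faces"

definition push :: "('a \<Rightarrow> 'b) \<Rightarrow> ('a list \<Rightarrow>\<^sub>0 'k::field) \<Rightarrow> ('b list \<Rightarrow>\<^sub>0 'k)" where
  "push h = chain_extend (\<lambda>xs. simplex (map h xs))"

text \<open>The alternating sum of the tuples \<open>(x\<^sub>0, \<dots>, x\<^sub>i, h x\<^sub>i, \<dots>, h x\<^sub>n)\<close>, a chain homotopy from the identity to
the map induced by \<open>h\<close>.\<close>

primrec prism_simplex :: "('a \<Rightarrow> 'a) \<Rightarrow> 'a list \<Rightarrow> ('a list \<Rightarrow>\<^sub>0 'k::field)" where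
  "prism_simplex h [] = 0"
| "prism_simplex h (x # xs) = simplex (x # h x # map h xs) - prepend x (prism_simplex h xs)"

definition prism :: "('a \<Rightarrow> 'a) \<Rightarrow> ('a list \<Rightarrow>\<^sub>0 'k::field) \<Rightarrow> ('a list \<Rightarrow>\<^sub>0 'k)" where
  "prism h = chain_extend (prism_simplex h)"

lemma chain_linear_operators [simp]:
  "chain_linear (prepend x)" "chain_linear \<partial>" "chain_linear (push f)" "chain_linear (prism h)"
  unfolding prepend_def chain_boundary_def push_def prism_def by (rule linear_chain_extend)+

lemmas operator_simps = chain_linear_simps[OF chain_linear_operators(1)]
  chain_linear_simps[OF chain_linear_operators(2)] chain_linear_simps[OF chain_linear_operators(3)]
  chain_linear_simps[OF chain_linear_operators(4)]

lemma operators_simplex [simp]: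
  "prepend x (simplex xs) = simplex (x # xs)" "\<partial> (simplex xs) = faces xs"
  "push f (simplex xs) = simplex (map f xs)" "prism h (simplex xs) = prism_simplex h xs"
  unfolding prepend_def chain_boundary_def push_def prism_def by simp_all

lemma boundary_prepend: "\<partial> (prepend x c) = c - prepend x (\<partial> c)"
  by (rule chain_linear_eqI[where f = "\<lambda>c. \<partial> (prepend x c)" and g = "\<lambda>c. c - prepend x (\<partial> c)"])
    (simp_all add: chain_linear_compose chain_linear_diff chain_linear_id)

lemma boundary_faces: "\<partial> (faces xs) = 0"
  by (induction xs) (simp_all add: operator_simps boundary_prepend)

lemma boundary_boundary: "\<partial> (\<partial> c) = 0"
proof -
  have "chain_linear (\<lambda>c :: 'a list \<Rightarrow>\<^sub>0 'b. 0 :: 'a list \<Rightarrow>\<^sub>0 'b)" by (rule chain_linearI) simp_all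
  then show ?thesis
    by (rule chain_linear_eqI[where f = "\<lambda>c. \<partial> (\<partial> c)" and g = "\<lambda>c. 0", rotated])
      (simp_all add: chain_linear_compose boundary_faces)
qed

lemma push_prepend: "push h (prepend x c) = prepend (h x) (push h c)"
  by (rule chain_linear_eqI[where f = "\<lambda>c. push h (prepend x c)" and g = "\<lambda>c. prepend (h x) (push h c)"])
    (simp_all add: chain_linear_compose)

lemma push_faces: "push h (faces xs) = faces (map h xs)"
  by (induction xs) (simp_all add: operator_simps push_prepend)

lemma boundary_push: "\<partial> (push h c) = push h (\<partial> c)"
  by (rule chain_linear_eqI[where f = "\<lambda>c. \<partial> (push h c)" and g = "\<lambda>c. push h (\<partial> c)"])
    (simp_all add: chain_linear_compose push_faces)

lemma push_push: "push g (push f c) = push (g \<circ> f) c"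
  by (rule chain_linear_eqI[where f = "\<lambda>c. push g (push f c)" and g = "push (g \<circ> f)"])
    (simp_all add: chain_linear_compose)

lemma prism_prepend:
  "prism h (prepend x c) = prepend x (prepend (h x) (push h c)) - prepend x (prism h c)"
  by (rule chain_linear_eqI[where f = "\<lambda>c. prism h (prepend x c)"
        and g = "\<lambda>c. prepend x (prepend (h x) (push h c)) - prepend x (prism h c)"])
    (simp_all add: chain_linear_compose chain_linear_diff
      chain_linear_compose[where f = "\<lambda>c. prepend (h x) (push h c)"])

lemma prism_homotopy_simplex:
  "\<partial> (prism_simplex h xs) + prism h (faces xs)
    = simplex (map h xs) - (simplex xs :: 'a list \<Rightarrow>\<^sub>0 'k::field)"
proof (induction xs)
  case Nil
  then show ?case by (simp add: operator_simps)
next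
  case (Cons x xs)
  have IH: "\<partial> (prism_simplex h xs)
      = simplex (map h xs) - (simplex xs :: 'a list \<Rightarrow>\<^sub>0 'k) - prism h (faces xs)"
    by (rule iffD2[OF eq_diff_eq Cons])
  show ?case
    by (simp add: operator_simps boundary_prepend prism_prepend IH push_faces)
qed

lemma prism_homotopy: "\<partial> (prism h c) + prism h (\<partial> c) = push h c - c"
  by (rule chain_linear_eqI[where f = "\<lambda>c. \<partial> (prism h c) + prism h (\<partial> c)" and g = "\<lambda>c. push h c - c"])
    (simp_all add: chain_linear_compose chain_linear_diff chain_linear_add chain_linear_id
      prism_homotopy_simplex)

lemma faces_eq_sum: "faces xs = (\<Sum>i<length xs. Poly_Mapping.single (omit i xs) ((-1) ^ i))"
proof (induction xs)
  case (Cons x xs)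
  have single: "prepend x (Poly_Mapping.single ys a) = Poly_Mapping.single (x # ys) a" for ys and a :: 'b
  proof -
    have s: "Poly_Mapping.single zs a = chain_scale a (simplex zs)" for zs :: "'a list"
      by (rule poly_mapping_eqI) (simp add: lookup_single when_def)
    show ?thesis by (simp only: s operator_simps operators_simplex)
  qed
  have "(\<Sum>i<length (x # xs). Poly_Mapping.single (omit i (x # xs)) ((-1) ^ i :: 'b))
      = simplex xs + (\<Sum>i<length xs. Poly_Mapping.single (x # omit i xs) (- ((-1) ^ i)))"
    unfolding length_Cons sum.lessThan_Suc_shift by (simp add: omit_def)
  also have "\<dots> = faces (x # xs)"
    by (simp add: Cons operator_simps single single_uminus sum_negf)
  finally show ?case by simp
qed simp

text \<open>In positive degrees the augmentation is invisible.\<close>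

lemma boundary_eq:
  assumes "\<And>xs. xs \<in> Poly_Mapping.keys c \<Longrightarrow> length xs = n + 1" "n > 0"
  shows "boundary n c = \<partial> c"
proof -
  have "(\<Sum>i\<le>n. Poly_Mapping.single (omit i xs) (a * (-1) ^ i)) = chain_scale a (faces xs)"
    if "length xs = n + 1" for xs :: "'a list" and a :: 'b
  proof -
    have "Poly_Mapping.single y (a * b) = chain_scale a (Poly_Mapping.single y b)" for y :: "'a list" and b
      by (rule poly_mapping_eqI) (simp add: lookup_single when_def)
    then show ?thesis
      using that by (simp add: faces_eq_sum chain.scale_sum_right lessThan_Suc_atMost)
  qed
  then show ?thesis using assms by (simp add: boundary_def chain_boundary_def chain_extend_def)
qed

lemma keys_faces: "Poly_Mapping.keys (faces xs) \<subseteq> (\<lambda>i. omit i xs) ` {..<length xs}"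
  unfolding faces_eq_sum by (rule order_trans[OF keys_sum]) (auto split: if_splits)

lemma keys_diff_prepend:
  "Poly_Mapping.keys (a - prepend x b) \<subseteq> Poly_Mapping.keys a \<union> (#) x ` Poly_Mapping.keys b"
proof -
  have "Poly_Mapping.keys (a - prepend x b) \<subseteq> Poly_Mapping.keys a \<union> Poly_Mapping.keys (prepend x b)"
    by (auto simp: in_keys_iff lookup_minus)
  moreover have "Poly_Mapping.keys (prepend x b) \<subseteq> (#) x ` Poly_Mapping.keys b"
    unfolding prepend_def by (rule order_trans[OF keys_chain_extend]) auto
  ultimately show ?thesis by blast
qed

lemma keys_prism_simplex:
  "Poly_Mapping.keys (prism_simplex h xs :: 'a list \<Rightarrow>\<^sub>0 'k::field) \<subseteq>
    (\<lambda>i. take (Suc i) xs @ map h (drop i xs)) ` {..<length xs}"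
proof (induction xs)
  case (Cons x xs)
  let ?p = "prism_simplex h xs :: 'a list \<Rightarrow>\<^sub>0 'k"
  have "Poly_Mapping.keys (prism_simplex h (x # xs) :: 'a list \<Rightarrow>\<^sub>0 'k) \<subseteq>
      {x # h x # map h xs} \<union> (#) x ` Poly_Mapping.keys ?p"
    using keys_diff_prepend[of "simplex (x # h x # map h xs)" x ?p] by simp
  also have "\<dots> \<subseteq> {x # h x # map h xs} \<union>
      (#) x ` (\<lambda>i. take (Suc i) xs @ map h (drop i xs)) ` {..<length xs}"
    using Cons by blast
  also have "\<dots> \<subseteq> (\<lambda>i. take (Suc i) (x # xs) @ map h (drop i (x # xs))) ` {..<length (x # xs)}"
  proof
    fix ys assume "ys \<in> {x # h x # map h xs} \<union>
      (#) x ` (\<lambda>i. take (Suc i) xs @ map h (drop i xs)) ` {..<length xs}"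
    then consider "ys = x # h x # map h xs"
      | i where "i < length xs" "ys = x # take (Suc i) xs @ map h (drop i xs)" by auto
    then show "ys \<in> (\<lambda>i. take (Suc i) (x # xs) @ map h (drop i (x # xs))) ` {..<length (x # xs)}"
    proof cases
      case 1
      then show ?thesis by (intro image_eqI[of _ _ 0]) auto
    next
      case 2
      then show ?thesis by (intro image_eqI[of _ _ "Suc i"]) auto
    qed
  qed
  finally show ?case .
qed simp

section \<open>Homology as a subquotient of the chain space\<close>

lemma (in vector_space) subquotient_quotient_module:
  assumes "subspace Z" "subspace B" "B \<subseteq> Z"
    and M: "carrier M = Z" "add M = (+)" "\<And>a x. a \<odot>\<^bsub>M\<^esub> x = scale a x"
  shows "subquotient scale Z B (quotient_module M B)"
proof -
  have coset: "B +>\<^bsub>M\<^esub> x = coset B x" for x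
    by (auto simp: a_r_coset_def r_coset_def coset_def M)
  have mem: "x \<in> coset B x" for x unfolding coset_def using subspace_0[OF assms(2)] by force
  show ?thesis
  proof (intro_locales, unfold subquotient_axioms_def, intro conjI allI impI)
    show "carrier (quotient_module M B) = coset B ` Z"
      by (simp add: quotient_module_def A_RCOSETS_def RCOSETS_def r_coset_def coset_def M
          UNION_singleton_eq_range)
    show "coset B x \<oplus>\<^bsub>quotient_module M B\<^esub> coset B y = coset B (x + y)" for x y
    proof -
      have "coset B x \<oplus>\<^bsub>quotient_module M B\<^esub> coset B y = {(b + x) + (b' + y) |b b'. b \<in> B \<and> b' \<in> B}"
        by (auto simp: quotient_module_def set_add_def set_mult_def M coset_def)
      also have "\<dots> = coset B (x + y)"
      proof (intro equalityI subsetI)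
        fix w assume "w \<in> {(b + x) + (b' + y) |b b'. b \<in> B \<and> b' \<in> B}"
        then obtain b b' where "b \<in> B" "b' \<in> B" "w = (b + b') + (x + y)" by (auto simp: algebra_simps)
        then show "w \<in> coset B (x + y)" unfolding coset_def using subspace_add[OF assms(2)] by blast
      next
        fix w assume "w \<in> coset B (x + y)"
        then obtain b where "b \<in> B" "w = (b + x) + (0 + y)" by (auto simp: coset_def algebra_simps)
        then show "w \<in> {(b + x) + (b' + y) |b b'. b \<in> B \<and> b' \<in> B}"
          using subspace_0[OF assms(2)] by blast
      qed
      finally show ?thesis .
    qed
    show "a \<odot>\<^bsub>quotient_module M B\<^esub> coset B x = coset B (scale a x)" for a x
    proof -
      have "coset B (scale a w) = coset B (scale a x)" if "w \<in> coset B x" for w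
      proof (rule coset_eq_coset_iff[OF assms(2), THEN iffD2])
        obtain b where "b \<in> B" "w = b + x" using \<open>w \<in> coset B x\<close> by (auto simp: coset_def)
        then show "scale a w - scale a x \<in> B"
          using subspace_scale[OF assms(2), of b a] by (simp add: scale_right_distrib)
      qed
      then have "(\<Union>w\<in>coset B x. coset B (scale a w)) = coset B (scale a x)"
        using mem[of x] by blast
      then show ?thesis by (simp add: quotient_module_def coset M)
    qed
  qed (use assms in \<open>auto simp: quotient_module_def\<close>)
qed

lemma carrier_chain_module:
  "carrier (chain_module n X) = {c. Poly_Mapping.keys c \<subseteq> {xs \<in> X. length xs = n + 1}}"
  by (simp add: chain_module_def)

lemma subspace_chains:
  "chain.subspace (carrier (chain_module n X :: ('k::field, 'v list \<Rightarrow>\<^sub>0 'k) module))"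
proof -
  have "Poly_Mapping.keys (c + c') \<subseteq> A" if "Poly_Mapping.keys c \<subseteq> A" "Poly_Mapping.keys c' \<subseteq> A"
    for c c' :: "'v list \<Rightarrow>\<^sub>0 'k" and A
    using that Poly_Mapping.keys_add[of c c'] by blast
  moreover have "Poly_Mapping.keys (chain_scale a c) \<subseteq> A" if "Poly_Mapping.keys c \<subseteq> A"
    for a :: 'k and c :: "'v list \<Rightarrow>\<^sub>0 'k" and A
    using that keys_chain_scale[of a c] by blast
  ultimately show ?thesis unfolding carrier_chain_module by (intro chain.subspaceI) auto
qed

lemma boundary_chain:
  assumes "c \<in> carrier (chain_module (n + 1) X)"
  shows "boundary (n + 1) c = \<partial> c"
  using assms by (intro boundary_eq) (auto simp: carrier_chain_module)

lemma boundaries_eq: "boundaries n X = \<partial> ` carrier (chain_module (n + 1) X)"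
  unfolding boundaries_def by (rule image_cong[OF refl]) (rule boundary_chain)

lemma cycles_eq:
  "cycles n X = {c \<in> carrier (chain_module n X). n = 0 \<or> \<partial> c = 0}"
proof (cases n)
  case (Suc m)
  then show ?thesis by (auto simp: cycles_def boundary_chain[unfolded Suc_eq_plus1[symmetric]])
qed (auto simp: cycles_def boundary_def)

lemma subspace_boundaries: "chain.subspace (boundaries n X)"
  unfolding boundaries_eq by (rule chain_pair.linear_subspace_image[OF chain_linear_operators(2) subspace_chains])

lemma subspace_cycles: "chain.subspace (cycles n X)"
  unfolding cycles_eq using subspace_chains[of n X]
  by (auto simp: chain.subspace_def operator_simps)

lemma boundaries_subset_cycles:
  assumes "directed_simplicial_complex X"
  shows "boundaries n X \<subseteq> (cycles n X :: ('v list \<Rightarrow>\<^sub>0 'k::field) set)"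
proof
  fix b :: "'v list \<Rightarrow>\<^sub>0 'k" assume "b \<in> boundaries n X"
  then obtain c where c: "c \<in> carrier (chain_module (n + 1) X)" "b = \<partial> c" by (auto simp: boundaries_eq)
  have "Poly_Mapping.keys b \<subseteq> (\<Union>xs\<in>Poly_Mapping.keys c. Poly_Mapping.keys (faces xs :: 'v list \<Rightarrow>\<^sub>0 'k))"
    unfolding c(2) chain_boundary_def by (rule keys_chain_extend)
  also have "\<dots> \<subseteq> {xs \<in> X. length xs = n + 1}"
  proof (intro UN_least order_trans[OF keys_faces] subsetI)
    fix xs ys assume "xs \<in> Poly_Mapping.keys c" "ys \<in> (\<lambda>i. omit i xs) ` {..<length xs}"
    then obtain i where i: "xs \<in> X" "length xs = n + 2" "i < length xs" "ys = omit i xs"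
      using c(1) by (auto simp: carrier_chain_module)
    then have "omit i xs \<in> X" using assms by (auto simp: directed_simplicial_complex_def)
    then show "ys \<in> {xs \<in> X. length xs = n + 1}" using i by (auto simp: omit_def)
  qed
  finally show "b \<in> cycles n X"
    by (simp add: cycles_eq carrier_chain_module c(2) boundary_boundary)
qed

lemma homology_class_eq: "homology_class n X c = coset (boundaries n X) c"
  by (auto simp: homology_class_def a_r_coset_def r_coset_def coset_def chain_module_def)

lemma subquotient_homology:
  assumes "directed_simplicial_complex X"
  shows "subquotient chain_scale (cycles n X) (boundaries n X) (homology n X)"
  unfolding homology_def
  by (rule chain.subquotient_quotient_module[OF subspace_cycles subspace_boundaries
        boundaries_subset_cycles[OF assms]])
    (simp_all add: chain_module_def chain_scale_def)

text \<open>Adding the boundaries makes this a subspace between boundaries and cycles whose quotient by the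
boundaries is directed homology.\<close>

definition directed_representatives ::
  "nat \<Rightarrow> 'v list set \<Rightarrow> ('v list \<Rightarrow>\<^sub>0 'k::linordered_field) set" where
  "directed_representatives n X =
     {x + y |x y. x \<in> chain.span (directed_cycles n X) \<and> y \<in> boundaries n X}"

lemma subspace_directed_representatives: "chain.subspace (directed_representatives n X)"
  unfolding directed_representatives_def
  by (rule chain.subspace_sums[OF chain.subspace_span subspace_boundaries])

lemma span_directed_cycles_subset: "chain.span (directed_cycles n X) \<subseteq> cycles n X"
  by (rule chain.span_minimal[OF _ subspace_cycles]) (auto simp: directed_cycles_def)

lemma directed_representatives_subset_cycles:
  assumes "directed_simplicial_complex X"
  shows "directed_representatives n X \<subseteq> cycles n X"
  using boundaries_subset_cycles[OF assms, of n] span_directed_cycles_subset[of n X]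
    chain.subspace_add[OF subspace_cycles[of n X]]
  unfolding directed_representatives_def by blast

lemma boundaries_subset_directed_representatives:
  "boundaries n X \<subseteq> directed_representatives n X"
  unfolding directed_representatives_def using chain.span_zero by force

text \<open>Taking classes is linear, so the span of the classes consists of the classes of the span.\<close>

lemma carrier_directed_homology:
  fixes X :: "'v list set"
  assumes X: "directed_simplicial_complex X"
  shows "carrier (directed_homology n X :: ('k::linordered_field, _) module)
    = coset (boundaries n X) ` chain.span (directed_cycles n X)"
proof -
  let ?H = "homology n X :: ('k, ('v list \<Rightarrow>\<^sub>0 'k) set) module"
  let ?B = "boundaries n X :: ('v list \<Rightarrow>\<^sub>0 'k) set"
  let ?D = "directed_cycles n X :: ('v list \<Rightarrow>\<^sub>0 'k) set"
  interpret H: subquotient chain_scale "cycles n X" ?B ?H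
    by (rule subquotient_homology[OF X])
  interpret V: vectorspace "class_ring :: 'k ring" ?H by (rule H.vectorspace_M)
  have DZ: "?D \<subseteq> cycles n X" by (auto simp: directed_cycles_def)
  have gen: "homology_class n X ` ?D = coset ?B ` ?D" by (simp add: homology_class_eq)
  have DH: "coset ?B ` ?D \<subseteq> carrier ?H" using DZ by (auto simp: H.carrier_M)
  have "V.span (coset ?B ` ?D) = coset ?B ` chain.span ?D"
  proof (intro equalityI subsetI)
    fix C assume "C \<in> V.span (coset ?B ` ?D)"
    then obtain a A where A: "finite A" "A \<subseteq> coset ?B ` ?D" "C = V.lincomb a A"
      unfolding V.span_def by auto
    let ?r = "inv_into ?D (coset ?B)"
    have r: "?r E \<in> ?D" "coset ?B (?r E) = E" if "E \<in> A" for E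
      using that A(2) by (auto simp: inv_into_into f_inv_into_f subset_iff)
    have "C = coset ?B (\<Sum>E\<in>A. chain_scale (a E) (?r E))"
      unfolding A(3) by (rule H.lincomb_coset[OF A(1)]) (use r DZ in auto)
    moreover have "(\<Sum>E\<in>A. chain_scale (a E) (?r E)) \<in> chain.span ?D"
      using r by (intro chain.span_sum chain.span_scale chain.span_base)
    ultimately show "C \<in> coset ?B ` chain.span ?D" by blast
  next
    have sub: "submodule class_ring (V.span (coset ?B ` ?D)) ?H"
      by (rule V.is_module[OF V.span_is_subspace[OF DH]])
    let ?U = "{x \<in> cycles n X. coset ?B x \<in> V.span (coset ?B ` ?D)}"
    have "chain.span ?D \<subseteq> ?U"
    proof (rule chain.span_minimal)
      show "?D \<subseteq> ?U" using DZ V.span_mem[OF DH] by auto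
      show "chain.subspace ?U"
      proof (rule chain.subspaceI)
        show "0 \<in> ?U"
          using submodule.zero_closed[OF sub] chain.subspace_0[OF subspace_cycles]
          by (simp add: H.coset_0 H.zero_M)
        show "x + y \<in> ?U" if "x \<in> ?U" "y \<in> ?U" for x y
          using that submodule.m_closed[OF sub] chain.subspace_add[OF subspace_cycles]
          by (auto simp: H.add_M[symmetric])
        show "chain_scale a x \<in> ?U" if "x \<in> ?U" for a x
          using that submodule.smult_closed[OF sub, of a] chain.subspace_scale[OF subspace_cycles]
          by (auto simp: H.smult_M[symmetric])
      qed
    qed
    then show "C \<in> V.span (coset ?B ` ?D)" if "C \<in> coset ?B ` chain.span ?D" for C
      using that by auto
  qed
  then show ?thesis by (simp add: directed_homology_def gen)
qed

lemma subquotient_directed_homology: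
  fixes X :: "'v list set"
  assumes X: "directed_simplicial_complex X"
  shows "subquotient chain_scale (directed_representatives n X) (boundaries n X)
    (directed_homology n X :: ('k::linordered_field, _) module)"
proof -
  let ?B = "boundaries n X :: ('v list \<Rightarrow>\<^sub>0 'k) set"
  let ?D = "directed_cycles n X :: ('v list \<Rightarrow>\<^sub>0 'k) set"
  interpret H: subquotient chain_scale "cycles n X" ?B "homology n X"
    by (rule subquotient_homology[OF X])
  note RZ = subsetD[OF directed_representatives_subset_cycles[OF X]]
  have "coset ?B ` chain.span ?D = coset ?B ` directed_representatives n X"
  proof (intro equalityI subsetI)
    fix C assume "C \<in> coset ?B ` directed_representatives n X"
    then obtain x y where "x \<in> chain.span ?D" "y \<in> ?B" "C = coset ?B (x + y)"
      by (auto simp: directed_representatives_def)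
    moreover from this have "C = coset ?B x" by (simp add: H.coset_eq_iff)
    ultimately show "C \<in> coset ?B ` chain.span ?D" by blast
  next
    fix C assume "C \<in> coset ?B ` chain.span ?D"
    then obtain x where x: "x \<in> chain.span ?D" "C = coset ?B x" by auto
    then have "x + 0 \<in> directed_representatives n X"
      unfolding directed_representatives_def using chain.subspace_0[OF subspace_boundaries] by blast
    then show "C \<in> coset ?B ` directed_representatives n X" using x by simp
  qed
  then have carrier: "carrier (directed_homology n X) = coset ?B ` directed_representatives n X"
    by (simp add: carrier_directed_homology[OF X])
  show ?thesis
  proof (intro_locales, unfold subquotient_axioms_def, intro conjI allI impI)
    show "coset ?B x \<oplus>\<^bsub>directed_homology n X\<^esub> coset ?B y = coset ?B (x + y)"
      if "x \<in> directed_representatives n X" "y \<in> directed_representatives n X" for x y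
      using H.add_M[OF RZ RZ] that by (simp add: directed_homology_def)
    show "a \<odot>\<^bsub>directed_homology n X\<^esub> coset ?B x = coset ?B (chain_scale a x)"
      if "x \<in> directed_representatives n X" for a x
      using H.smult_M[OF RZ] that by (simp add: directed_homology_def)
    show "\<zero>\<^bsub>directed_homology n X\<^esub> = ?B" using H.zero_M by (simp add: directed_homology_def)
    show "carrier (directed_homology n X) = coset ?B ` directed_representatives n X"
      by (rule carrier)
  qed (rule subspace_directed_representatives subspace_boundaries
      boundaries_subset_directed_representatives)+
qed

lemma homology_incl_coset:
  assumes "boundaries n X \<subseteq> (boundaries n Y :: ('v list \<Rightarrow>\<^sub>0 'k::field) set)"
    and Y: "directed_simplicial_complex Y"
  shows "homology_incl n Y (coset (boundaries n X) x) = coset (boundaries n Y :: ('v list \<Rightarrow>\<^sub>0 'k) set) x"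
proof -
  let ?BX = "boundaries n X :: ('v list \<Rightarrow>\<^sub>0 'k) set"
  let ?BY = "boundaries n Y :: ('v list \<Rightarrow>\<^sub>0 'k) set"
  interpret H: subquotient chain_scale "cycles n Y" ?BY "homology n Y"
    by (rule subquotient_homology[OF Y])
  have "coset ?BY w = coset ?BY x" if "w \<in> coset ?BX x" for w
  proof -
    obtain b where "b \<in> ?BX" "w = b + x" using \<open>w \<in> coset ?BX x\<close> by (auto simp: coset_def)
    then show ?thesis using assms(1) by (auto simp: H.coset_eq_iff)
  qed
  moreover have "x \<in> coset ?BX x"
    unfolding coset_def using chain.subspace_0[OF subspace_boundaries, of n X] by force
  ultimately show ?thesis unfolding homology_incl_def homology_class_eq by blast
qed

section \<open>Critical values of a filtration\<close>

text \<open>The elements of \<open>D\<close> in increasing order serve as critical values.\<close>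

lemma (in persistent_subquotient) critical_values_exist:
  assumes D: "finite D" "D \<noteq> {}"
    and const: "\<And>s t. s \<le> t \<Longrightarrow> (\<And>v. v \<in> D \<Longrightarrow> v \<le> s \<longleftrightarrow> v \<le> t) \<Longrightarrow> Z s = Z t \<and> B s = B t"
    and trivial: "\<And>t. (\<And>v. v \<in> D \<Longrightarrow> t < v) \<Longrightarrow> Z t = {0}"
  shows "\<exists>m \<delta>. P.critical_values m \<delta>"
proof -
  define \<delta> where "\<delta> i = sorted_list_of_set D ! i" for i
  define m where "m = card D - 1"
  have len: "length (sorted_list_of_set D) = Suc m" using D by (simp add: m_def card_gt_0_iff)
  have less: "\<delta> i < \<delta> j" if "i < j" "j \<le> m" for i j
    unfolding \<delta>_def using strict_sorted_list_of_set[of D] that len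
    by (intro sorted_wrt_nth_less[of "(<)"]) auto
  have le: "\<delta> i \<le> \<delta> j" if "i \<le> j" "j \<le> m" for i j
    using less[of i j] that by (cases "i = j") auto
  have mem: "\<exists>i\<le>m. v = \<delta> i" if "v \<in> D" for v
    using that D len unfolding \<delta>_def
    by (metis in_set_conv_nth less_Suc_eq_le set_sorted_list_of_set)
  have bij: "bij_betw (\<nu> s t) (carrier (M s)) (carrier (M t))"
    if st: "s \<le> t" and eq: "\<And>v. v \<in> D \<Longrightarrow> v \<le> s \<longleftrightarrow> v \<le> t" for s t
  proof -
    have "Z s = Z t" "B s = B t" using const[OF st eq] by auto
    then have "bij_betw id (carrier (M s)) (carrier (M t))" by (simp add: carrier_M)
    moreover have "\<nu> s t C = id C" if "C \<in> carrier (M s)" for C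
      using that \<nu>_coset[OF st] \<open>B s = B t\<close> by (auto simp: carrier_M)
    ultimately show ?thesis by (rule bij_betw_cong[THEN iffD2, rotated])
  qed
  have "P.critical_values m \<delta>"
    unfolding P.critical_values_def
  proof (intro conjI allI impI)
    show "strict_mono_on {..m} \<delta>" using less by (intro strict_mono_onI) auto
    show "carrier (M t) = {\<zero>\<^bsub>M t\<^esub>}" if "t < \<delta> 0" for t
    proof -
      have "t < v" if "v \<in> D" for v
        using mem[OF that] le[of 0] \<open>t < \<delta> 0\<close> by fastforce
      then have "Z t = {0}" by (rule trivial)
      then show ?thesis
        using coset_eq_zero_iff[of t 0] subspace_0[OF subspace_B] by (simp add: carrier_M)
    qed
    fix s t assume h: "s \<le> t \<and>
        ((\<exists>i\<in>{1..m}. s \<in> {\<delta> (i - 1)..<\<delta> i} \<and> t \<in> {\<delta> (i - 1)..<\<delta> i}) \<or>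
         (s \<in> {\<delta> m..} \<and> t \<in> {\<delta> m..}))"
    show "bij_betw (\<nu> s t) (carrier (M s)) (carrier (M t))"
    proof (rule bij)
      show "s \<le> t" using h by simp
      fix v assume "v \<in> D"
      then obtain j where j: "j \<le> m" "v = \<delta> j" using mem by blast
      from h show "v \<le> s \<longleftrightarrow> v \<le> t"
      proof (elim conjE disjE bexE)
        fix i assume i: "i \<in> {1..m}" "s \<in> {\<delta> (i - 1)..<\<delta> i}" "t \<in> {\<delta> (i - 1)..<\<delta> i}"
        show ?thesis
        proof (cases "j \<le> i - 1")
          case True
          then have "\<delta> j \<le> \<delta> (i - 1)" using i by (intro le) auto
          then show ?thesis using i j by auto
        next
          case False
          then have "\<delta> i \<le> \<delta> j" using j by (intro le) auto
          then show ?thesis using i j by auto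
        qed
      next
        assume "s \<in> {\<delta> m..}" "t \<in> {\<delta> m..}"
        then show ?thesis using le[of j m] j by auto
      qed
    qed
  qed
  then show ?thesis by blast
qed

section \<open>The homology of the directed Rips filtration\<close>

lemma rips_mono: "s \<le> t \<Longrightarrow> rips V d s \<subseteq> rips V d t"
  unfolding rips_def by (auto intro: order_trans)

lemma chains_mono: "X \<subseteq> Y \<Longrightarrow> carrier (chain_module n X) \<subseteq> carrier (chain_module n Y)"
  by (auto simp: carrier_chain_module)

lemma cycles_mono: "X \<subseteq> Y \<Longrightarrow> cycles n X \<subseteq> cycles n Y"
  by (auto simp: cycles_def carrier_chain_module)

lemma boundaries_mono: "X \<subseteq> Y \<Longrightarrow> boundaries n X \<subseteq> boundaries n Y"
  unfolding boundaries_def by (intro image_mono chains_mono)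

lemma directed_representatives_mono:
  fixes X Y :: "'v list set"
  assumes "X \<subseteq> Y"
  shows "directed_representatives n X \<subseteq> (directed_representatives n Y :: ('v list \<Rightarrow>\<^sub>0 'k::linordered_field) set)"
proof -
  have "directed_cycles n X \<subseteq> (directed_cycles n Y :: ('v list \<Rightarrow>\<^sub>0 'k) set)"
    by (auto simp: directed_cycles_def intro: subsetD[OF cycles_mono[OF assms]])
  then have "chain.span (directed_cycles n X) \<subseteq> chain.span (directed_cycles n Y :: ('v list \<Rightarrow>\<^sub>0 'k) set)"
    by (rule chain.span_mono)
  moreover have "boundaries n X \<subseteq> (boundaries n Y :: ('v list \<Rightarrow>\<^sub>0 'k) set)"
    by (rule boundaries_mono[OF assms])
  ultimately show ?thesis unfolding directed_representatives_def by blast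
qed

definition simplex_chains :: "nat \<Rightarrow> 'v set \<Rightarrow> ('v list \<Rightarrow>\<^sub>0 'k::field) set" where
  "simplex_chains n V = simplex ` {xs. set xs \<subseteq> V \<and> length xs = n + 1}"

lemma finite_simplex_chains: "finite V \<Longrightarrow> finite (simplex_chains n V)"
  unfolding simplex_chains_def by (intro finite_imageI finite_lists_length_eq)

lemma cycles_subset_span:
  "cycles n (rips V d t) \<subseteq> chain.span (simplex_chains n V :: ('v list \<Rightarrow>\<^sub>0 'k::field) set)"
proof
  fix c :: "'v list \<Rightarrow>\<^sub>0 'k" assume "c \<in> cycles n (rips V d t)"
  then have "xs \<in> {xs. set xs \<subseteq> V \<and> length xs = n + 1}" if "xs \<in> Poly_Mapping.keys c" for xs
    using that by (auto simp: cycles_def carrier_chain_module rips_def)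
  then have "(\<Sum>xs\<in>Poly_Mapping.keys c. chain_scale (Poly_Mapping.lookup c xs) (simplex xs))
      \<in> chain.span (simplex_chains n V)"
    unfolding simplex_chains_def by (intro chain.span_sum chain.span_scale chain.span_base imageI)
  then show "c \<in> chain.span (simplex_chains n V)" by (simp only: chain_sum_of_simplices[symmetric])
qed

lemma persistent_homology:
  fixes V :: "'v set"
  assumes V: "finite V"
  shows "persistent_subquotient chain_scale (\<lambda>t. cycles n (rips V d t)) (\<lambda>t. boundaries n (rips V d t))
    (\<lambda>t. homology n (rips V d t) :: ('k::field, _) module) (\<lambda>s t. homology_incl n (rips V d t))
    (simplex_chains n V)"
proof (intro persistent_subquotient.intro subquotient_filtration.intro
    subquotient_filtration_axioms.intro persistent_subquotient_axioms.intro chain.vector_space_axioms)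
  note X = directed_simplicial_complex_rips[OF V, of d]
  fix s t :: real
  show "chain.subspace (cycles n (rips V d t) :: ('v list \<Rightarrow>\<^sub>0 'k) set)" by (rule subspace_cycles)
  show "chain.subspace (boundaries n (rips V d t) :: ('v list \<Rightarrow>\<^sub>0 'k) set)" by (rule subspace_boundaries)
  show "boundaries n (rips V d t) \<subseteq> (cycles n (rips V d t) :: ('v list \<Rightarrow>\<^sub>0 'k) set)"
    by (rule boundaries_subset_cycles[OF X])
  show "subquotient chain_scale (cycles n (rips V d t)) (boundaries n (rips V d t))
      (homology n (rips V d t) :: ('k, _) module)"
    by (rule subquotient_homology[OF X])
  show "finite (simplex_chains n V :: ('v list \<Rightarrow>\<^sub>0 'k) set)" by (rule finite_simplex_chains[OF V])
  show "cycles n (rips V d t) \<subseteq> chain.span (simplex_chains n V :: ('v list \<Rightarrow>\<^sub>0 'k) set)"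
    by (rule cycles_subset_span)
  assume st: "s \<le> t"
  show "cycles n (rips V d s) \<subseteq> (cycles n (rips V d t) :: ('v list \<Rightarrow>\<^sub>0 'k) set)"
    by (rule cycles_mono[OF rips_mono[OF st]])
  show "boundaries n (rips V d s) \<subseteq> (boundaries n (rips V d t) :: ('v list \<Rightarrow>\<^sub>0 'k) set)"
    by (rule boundaries_mono[OF rips_mono[OF st]])
  show "homology_incl n (rips V d t) (coset (boundaries n (rips V d s)) x)
      = coset (boundaries n (rips V d t)) x" for x :: "'v list \<Rightarrow>\<^sub>0 'k"
    by (rule homology_incl_coset[OF boundaries_mono[OF rips_mono[OF st]] X])
qed

lemma persistent_directed_homology:
  fixes V :: "'v set"
  assumes V: "finite V"
  shows "persistent_subquotient chain_scale (\<lambda>t. directed_representatives n (rips V d t))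
    (\<lambda>t. boundaries n (rips V d t)) (\<lambda>t. directed_homology n (rips V d t) :: ('k::linordered_field, _) module)
    (\<lambda>s t. homology_incl n (rips V d t)) (simplex_chains n V)"
proof (intro persistent_subquotient.intro subquotient_filtration.intro
    subquotient_filtration_axioms.intro persistent_subquotient_axioms.intro chain.vector_space_axioms)
  note X = directed_simplicial_complex_rips[OF V, of d]
  fix s t :: real
  show "chain.subspace (directed_representatives n (rips V d t) :: ('v list \<Rightarrow>\<^sub>0 'k) set)"
    by (rule subspace_directed_representatives)
  show "chain.subspace (boundaries n (rips V d t) :: ('v list \<Rightarrow>\<^sub>0 'k) set)" by (rule subspace_boundaries)
  show "boundaries n (rips V d t) \<subseteq> (directed_representatives n (rips V d t) :: ('v list \<Rightarrow>\<^sub>0 'k) set)"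
    by (rule boundaries_subset_directed_representatives)
  show "subquotient chain_scale (directed_representatives n (rips V d t)) (boundaries n (rips V d t))
      (directed_homology n (rips V d t) :: ('k, _) module)"
    by (rule subquotient_directed_homology[OF X])
  show "finite (simplex_chains n V :: ('v list \<Rightarrow>\<^sub>0 'k) set)" by (rule finite_simplex_chains[OF V])
  show "directed_representatives n (rips V d t) \<subseteq> chain.span (simplex_chains n V :: ('v list \<Rightarrow>\<^sub>0 'k) set)"
    by (rule order_trans[OF directed_representatives_subset_cycles[OF X] cycles_subset_span])
  assume st: "s \<le> t"
  show "directed_representatives n (rips V d s)
      \<subseteq> (directed_representatives n (rips V d t) :: ('v list \<Rightarrow>\<^sub>0 'k) set)"
    by (rule directed_representatives_mono[OF rips_mono[OF st]])
  show "boundaries n (rips V d s) \<subseteq> (boundaries n (rips V d t) :: ('v list \<Rightarrow>\<^sub>0 'k) set)"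
    by (rule boundaries_mono[OF rips_mono[OF st]])
  show "homology_incl n (rips V d t) (coset (boundaries n (rips V d s)) x)
      = coset (boundaries n (rips V d t)) x" for x :: "'v list \<Rightarrow>\<^sub>0 'k"
    by (rule homology_incl_coset[OF boundaries_mono[OF rips_mono[OF st]] X])
qed

definition dissimilarities :: "'v set \<Rightarrow> ('v \<Rightarrow> 'v \<Rightarrow> real) \<Rightarrow> real set" where
  "dissimilarities V d = (\<lambda>(v, w). d v w) ` (V \<times> V)"

lemma finite_dissimilarities:
  "finite V \<Longrightarrow> finite (dissimilarities V d)" "V \<noteq> {} \<Longrightarrow> dissimilarities V d \<noteq> {}"
  by (auto simp: dissimilarities_def)

lemma rips_eq:
  assumes "\<And>v. v \<in> dissimilarities V d \<Longrightarrow> v \<le> s \<longleftrightarrow> v \<le> t"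
  shows "rips V d s = rips V d t"
proof -
  have "d (xs ! i) (xs ! j) \<le> s \<longleftrightarrow> d (xs ! i) (xs ! j) \<le> t"
    if "set xs \<subseteq> V" "j < length xs" "i \<le> j" for xs i j
    using that by (intro assms) (force simp: dissimilarities_def)
  then show ?thesis unfolding rips_def by blast
qed

lemma rips_empty:
  assumes "\<And>v. v \<in> dissimilarities V d \<Longrightarrow> t < v"
  shows "rips V d t = {}"
proof -
  have False if "xs \<in> rips V d t" for xs
  proof -
    have xs: "xs \<noteq> []" "set xs \<subseteq> V" "d (xs ! 0) (xs ! 0) \<le> t" using that by (auto simp: rips_def)
    then have "xs ! 0 \<in> V" by auto
    then have "t < d (xs ! 0) (xs ! 0)" by (intro assms) (force simp: dissimilarities_def)
    then show False using xs by simp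
  qed
  then show ?thesis by blast
qed

lemma cycles_empty: "cycles n {} = {0}"
  by (auto simp: cycles_eq carrier_chain_module operator_simps)

lemma directed_representatives_empty: "directed_representatives n {} = {0}"
proof -
  have "directed_simplicial_complex {}" by (simp add: directed_simplicial_complex_def)
  from directed_representatives_subset_cycles[OF this, of n] show ?thesis
    using chain.subspace_0[OF subspace_directed_representatives[of n "{}"]] by (auto simp: cycles_empty)
qed

section \<open>Maps of small distortion interleave the Rips filtrations\<close>

lemma push_chains:
  assumes "\<And>xs. xs \<in> X \<Longrightarrow> map h xs \<in> Y" "c \<in> carrier (chain_module n X)"
  shows "push h c \<in> carrier (chain_module n Y)"
proof -
  have "Poly_Mapping.keys (push h c) \<subseteq> map h ` Poly_Mapping.keys c"
    unfolding push_def by (rule order_trans[OF keys_chain_extend]) auto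
  also have "\<dots> \<subseteq> {xs \<in> Y. length xs = n + 1}" using assms by (auto simp: carrier_chain_module)
  finally show ?thesis by (simp add: carrier_chain_module)
qed

lemma push_cycles:
  assumes "\<And>xs. xs \<in> X \<Longrightarrow> map h xs \<in> Y" "c \<in> cycles n X"
  shows "push h c \<in> cycles n Y"
  using assms push_chains[of X h Y c n] by (auto simp: cycles_eq boundary_push operator_simps)

lemma push_boundaries:
  assumes "\<And>xs. xs \<in> X \<Longrightarrow> map h xs \<in> Y" "c \<in> boundaries n X"
  shows "push h c \<in> boundaries n Y"
proof -
  obtain b where b: "b \<in> carrier (chain_module (n + 1) X)" "c = \<partial> b"
    using assms(2) by (auto simp: boundaries_eq)
  show ?thesis unfolding boundaries_eq b(2) boundary_push[symmetric]
    by (intro imageI push_chains[OF assms(1) b(1)])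
qed

text \<open>Coefficients of simplices with the same image are added, so they stay nonnegative.\<close>

lemma push_directed_representatives:
  fixes X :: "'v list set" and c :: "'v list \<Rightarrow>\<^sub>0 'k::linordered_field"
  assumes h: "\<And>xs. xs \<in> X \<Longrightarrow> map h xs \<in> Y" and c: "c \<in> directed_representatives n X"
  shows "push h c \<in> directed_representatives n Y"
proof -
  have dir: "push h b \<in> directed_cycles n Y" if "b \<in> directed_cycles n X" for b :: "'v list \<Rightarrow>\<^sub>0 'k"
  proof -
    have "Poly_Mapping.lookup (push h b) ys \<ge> 0" for ys
      using that by (auto simp: push_def chain_extend_def lookup_sum directed_cycles_def
          lookup_single when_def intro!: sum_nonneg)
    then show ?thesis using push_cycles[OF h] that by (auto simp: directed_cycles_def)
  qed
  obtain x y where xy: "x \<in> chain.span (directed_cycles n X)" "y \<in> boundaries n X" "c = x + y"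
    using c by (auto simp: directed_representatives_def)
  have "push h ` directed_cycles n X \<subseteq> (directed_cycles n Y :: (_ \<Rightarrow>\<^sub>0 'k) set)" using dir by blast
  then have "chain.span (push h ` directed_cycles n X) \<subseteq> chain.span (directed_cycles n Y :: (_ \<Rightarrow>\<^sub>0 'k) set)"
    by (rule chain.span_mono)
  moreover have "push h x \<in> chain.span (push h ` directed_cycles n X)"
    using xy(1) chain_pair.linear_span_image[OF chain_linear_operators(3), of h "directed_cycles n X"]
    by blast
  ultimately show ?thesis
    using push_boundaries[OF h xy(2)] unfolding directed_representatives_def xy(3)
    by (auto simp: operator_simps)
qed

lemma map_rips:
  assumes "h ` V \<subseteq> W" "\<And>x y. x \<in> V \<Longrightarrow> y \<in> V \<Longrightarrow> dW (h x) (h y) \<le> dV x y + \<epsilon>" "xs \<in> rips V dV t"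
  shows "map h xs \<in> rips W dW (t + \<epsilon>)"
proof -
  have "dW (h (xs ! i)) (h (xs ! j)) \<le> t + \<epsilon>" if "j < length xs" "i \<le> j" for i j
  proof -
    have "dV (xs ! i) (xs ! j) \<le> t" "xs ! i \<in> V" "xs ! j \<in> V"
      using assms(3) that by (auto simp: rips_def subset_iff)
    then show ?thesis using assms(2)[of "xs ! i" "xs ! j"] by linarith
  qed
  moreover have "set (map h xs) \<subseteq> W" using assms(1,3) by (auto simp: rips_def image_subset_iff subset_iff)
  ultimately show ?thesis using assms(3) by (simp add: rips_def)
qed

text \<open>The hypotheses on \<open>d\<close> put all prisms over simplices at parameter \<open>t\<close> into the complex at parameter
\<open>t + \<epsilon>\<close>: a pair of vertices of a prism, taken in order, is of the form \<open>(x, y)\<close>, \<open>(x, h y)\<close> or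
\<open>(h x, h y)\<close>, where \<open>x\<close> does not come after \<open>y\<close> in the simplex.\<close>

lemma push_homologous_id:
  fixes c :: "'v list \<Rightarrow>\<^sub>0 'k::field"
  assumes h: "h ` V \<subseteq> V"
    and d1: "\<And>x y. x \<in> V \<Longrightarrow> y \<in> V \<Longrightarrow> d x (h y) \<le> d x y + \<epsilon>"
    and d2: "\<And>x y. x \<in> V \<Longrightarrow> y \<in> V \<Longrightarrow> d (h x) (h y) \<le> d x y + \<epsilon>"
    and \<epsilon>: "\<epsilon> \<ge> 0" and c: "c \<in> cycles n (rips V d t)"
  shows "push h c - c \<in> boundaries n (rips V d (t + \<epsilon>))"
proof -
  have keys: "xs \<in> rips V d t \<and> length xs = n + 1" if "xs \<in> Poly_Mapping.keys c" for xs
    using c that by (auto simp: cycles_eq carrier_chain_module)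
  \<comment> \<open>In degree \<open>0\<close> the augmented boundary of \<open>c\<close> is a multiple of the empty tuple, over which the
    prism vanishes.\<close>
  have "prism h (\<partial> c) = 0"
  proof (cases "n = 0")
    case False
    then show ?thesis using c by (simp add: cycles_eq operator_simps)
  next
    case True
    have "faces xs = (simplex [] :: 'v list \<Rightarrow>\<^sub>0 'k)" if "length xs = 1" for xs
      using that by (cases xs) (auto simp: operator_simps)
    then have "prism h (faces xs) = (0 :: 'v list \<Rightarrow>\<^sub>0 'k)" if "xs \<in> Poly_Mapping.keys c" for xs
      using keys[OF that] True by simp
    moreover have "prism h (\<partial> c) = (\<Sum>xs\<in>Poly_Mapping.keys c.
        chain_scale (Poly_Mapping.lookup c xs) (prism h (faces xs)))"
      by (simp add: chain_boundary_def chain_extend_def operator_simps)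
    ultimately show ?thesis by simp
  qed
  then have eq: "push h c - c = \<partial> (prism h c)" using prism_homotopy[of h c] by simp
  have prism_rips: "take (Suc i) xs @ map h (drop i xs) \<in> rips V d (t + \<epsilon>)"
    if xs: "xs \<in> rips V d t" and i: "i < length xs" for xs i
  proof -
    let ?ys = "take (Suc i) xs @ map h (drop i xs)"
    have xV: "xs ! k \<in> V" if "k < length xs" for k using xs that by (auto simp: rips_def)
    have xd: "d (xs ! k) (xs ! l) \<le> t" if "l < length xs" "k \<le> l" for k l
      using xs that by (auto simp: rips_def)
    have nth: "?ys ! k = (if k \<le> i then xs ! k else h (xs ! (k - 1)))" if "k < length xs + 1" for k
    proof (cases "k \<le> i")
      case True
      then show ?thesis using i by (simp add: nth_append)
    next
      case False
      have "length (take (Suc i) xs) = Suc i" using i by simp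
      moreover have "i + (k - Suc i) = k - 1" using False by simp
      ultimately show ?thesis using that i False
        by (simp only: nth_append) (simp add: not_less less_Suc_eq_le)
    qed
    have "d (?ys ! k) (?ys ! l) \<le> t + \<epsilon>" if l: "l < length xs + 1" "k \<le> l" for k l
    proof -
      consider "l \<le> i" | "k \<le> i" "i < l" | "i < k" "i < l" using l by linarith
      then show ?thesis
      proof cases
        case 1
        then show ?thesis using nth[of k] nth[of l] l xd[of l k] i \<epsilon> by auto
      next
        case 2
        then have "d (xs ! k) (h (xs ! (l - 1))) \<le> d (xs ! k) (xs ! (l - 1)) + \<epsilon>"
          using l i by (intro d1 xV) auto
        moreover have "d (xs ! k) (xs ! (l - 1)) \<le> t" using 2 l by (intro xd) auto
        ultimately show ?thesis using nth[of k] nth[of l] l 2 by auto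
      next
        case 3
        then have "d (h (xs ! (k - 1))) (h (xs ! (l - 1))) \<le> d (xs ! (k - 1)) (xs ! (l - 1)) + \<epsilon>"
          using l i by (intro d2 xV) auto
        moreover have "d (xs ! (k - 1)) (xs ! (l - 1)) \<le> t" using 3 l by (intro xd) auto
        ultimately show ?thesis using nth[of k] nth[of l] l 3 by auto
      qed
    qed
    moreover have "length ?ys = length xs + 1" using i by simp
    moreover have "set ?ys \<subseteq> V"
      using xs h by (auto simp: rips_def image_subset_iff subset_iff dest!: in_set_takeD in_set_dropD)
    moreover have "?ys \<noteq> []" using i by auto
    ultimately show ?thesis by (simp add: rips_def)
  qed
  have "Poly_Mapping.keys (prism h c) \<subseteq> (\<Union>xs\<in>Poly_Mapping.keys c.
      (\<lambda>i. take (Suc i) xs @ map h (drop i xs)) ` {..<length xs})"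
    unfolding prism_def by (intro order_trans[OF keys_chain_extend] UN_mono order_refl keys_prism_simplex)
  also have "\<dots> \<subseteq> {xs \<in> rips V d (t + \<epsilon>). length xs = n + 1 + 1}"
    using prism_rips keys by auto
  finally have "prism h c \<in> carrier (chain_module (n + 1) (rips V d (t + \<epsilon>)))"
    by (simp add: carrier_chain_module)
  then show ?thesis unfolding eq boundaries_eq by blast
qed

text \<open>The consequences of a correspondence of distortion at most \<open>\<epsilon>\<close> that the proof uses, for the two
vertex maps obtained by choosing related elements.\<close>

locale close_dissimilarities =
  fixes V :: "'v set" and dV :: "'v \<Rightarrow> 'v \<Rightarrow> real" and W :: "'w set" and dW :: "'w \<Rightarrow> 'w \<Rightarrow> real"
    and \<phi> :: "'v \<Rightarrow> 'w" and \<psi> :: "'w \<Rightarrow> 'v" and \<epsilon> :: real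
  assumes finV: "finite V" and finW: "finite W" and V_ne: "V \<noteq> {}" and W_ne: "W \<noteq> {}"
    and \<phi>: "\<phi> ` V \<subseteq> W" and \<psi>: "\<psi> ` W \<subseteq> V" and eps: "\<epsilon> \<ge> 0"
    and \<phi>_le: "\<And>x y. x \<in> V \<Longrightarrow> y \<in> V \<Longrightarrow> dW (\<phi> x) (\<phi> y) \<le> dV x y + \<epsilon>"
    and \<psi>_le: "\<And>x y. x \<in> W \<Longrightarrow> y \<in> W \<Longrightarrow> dV (\<psi> x) (\<psi> y) \<le> dW x y + \<epsilon>"
    and \<psi>\<phi>_le: "\<And>x y. x \<in> V \<Longrightarrow> y \<in> V \<Longrightarrow> dV x (\<psi> (\<phi> y)) \<le> dV x y + 2 * \<epsilon>"
    and \<phi>\<psi>_le: "\<And>x y. x \<in> W \<Longrightarrow> y \<in> W \<Longrightarrow> dW x (\<phi> (\<psi> y)) \<le> dW x y + 2 * \<epsilon>"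
begin

lemma map_\<phi>: "xs \<in> rips V dV t \<Longrightarrow> map \<phi> xs \<in> rips W dW (t + \<epsilon>)"
  by (rule map_rips[where dV = dV and dW = dW and \<epsilon> = \<epsilon>, OF \<phi> \<phi>_le])

lemma map_\<psi>: "xs \<in> rips W dW t \<Longrightarrow> map \<psi> xs \<in> rips V dV (t + \<epsilon>)"
  by (rule map_rips[where dV = dW and dW = dV and \<epsilon> = \<epsilon>, OF \<psi> \<psi>_le])

lemma push_\<psi>_push_\<phi>:
  assumes "c \<in> cycles n (rips V dV t)"
  shows "push \<psi> (push \<phi> c) - c \<in> boundaries n (rips V dV (t + 2 * \<epsilon>))"
  unfolding push_push
proof (rule push_homologous_id[OF _ _ _ _ assms])
  show "(\<psi> \<circ> \<phi>) ` V \<subseteq> V" using \<phi> \<psi> by auto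
  show "dV x ((\<psi> \<circ> \<phi>) y) \<le> dV x y + 2 * \<epsilon>" if "x \<in> V" "y \<in> V" for x y
    using \<psi>\<phi>_le that by simp
  show "dV ((\<psi> \<circ> \<phi>) x) ((\<psi> \<circ> \<phi>) y) \<le> dV x y + 2 * \<epsilon>" if "x \<in> V" "y \<in> V" for x y
    using \<phi>_le[OF that] \<psi>_le[of "\<phi> x" "\<phi> y"] \<phi> that by fastforce
qed (use eps in auto)

lemma push_\<phi>_push_\<psi>:
  assumes "c \<in> cycles n (rips W dW t)"
  shows "push \<phi> (push \<psi> c) - c \<in> boundaries n (rips W dW (t + 2 * \<epsilon>))"
  unfolding push_push
proof (rule push_homologous_id[OF _ _ _ _ assms])
  show "(\<phi> \<circ> \<psi>) ` W \<subseteq> W" using \<phi> \<psi> by auto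
  show "dW x ((\<phi> \<circ> \<psi>) y) \<le> dW x y + 2 * \<epsilon>" if "x \<in> W" "y \<in> W" for x y
    using \<phi>\<psi>_le that by simp
  show "dW ((\<phi> \<circ> \<psi>) x) ((\<phi> \<circ> \<psi>) y) \<le> dW x y + 2 * \<epsilon>" if "x \<in> W" "y \<in> W" for x y
    using \<psi>_le[OF that] \<phi>_le[of "\<psi> x" "\<psi> y"] \<psi> that by fastforce
qed (use eps in auto)

lemma homology_interleaving:
  "interleaving (chain_scale :: 'k::field \<Rightarrow> _) (\<lambda>t. cycles n (rips V dV t)) (\<lambda>t. boundaries n (rips V dV t))
    chain_scale (\<lambda>t. cycles n (rips W dW t)) (\<lambda>t. boundaries n (rips W dW t)) (push \<phi>) (push \<psi>) \<epsilon>"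
  by (intro interleaving.intro interleaving_axioms.intro chain_linear_operators(3) eps
      persistent_subquotient.axioms(1)[OF persistent_homology[OF finV]]
      persistent_subquotient.axioms(1)[OF persistent_homology[OF finW]])
    (erule push_cycles[rotated] push_boundaries[rotated] map_\<phi> map_\<psi>
      push_\<psi>_push_\<phi> push_\<phi>_push_\<psi>)+

lemma directed_homology_interleaving:
  "interleaving (chain_scale :: 'k::linordered_field \<Rightarrow> _)
    (\<lambda>t. directed_representatives n (rips V dV t)) (\<lambda>t. boundaries n (rips V dV t))
    chain_scale (\<lambda>t. directed_representatives n (rips W dW t)) (\<lambda>t. boundaries n (rips W dW t))
    (push \<phi>) (push \<psi>) \<epsilon>"
proof -
  have cycle: "c \<in> cycles n (rips U d t)"
    if "finite U" "c \<in> directed_representatives n (rips U d t)" for U :: "'u set" and d t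
      and c :: "'u list \<Rightarrow>\<^sub>0 'k"
    using that directed_representatives_subset_cycles[OF directed_simplicial_complex_rips[OF that(1)]]
    by blast
  show ?thesis
    by (intro interleaving.intro interleaving_axioms.intro chain_linear_operators(3) eps
        persistent_subquotient.axioms(1)[OF persistent_directed_homology[OF finV]]
        persistent_subquotient.axioms(1)[OF persistent_directed_homology[OF finW]])
      (erule push_directed_representatives[rotated] push_boundaries[rotated] map_\<phi> map_\<psi>
        push_\<psi>_push_\<phi>[OF cycle[OF finV]] push_\<phi>_push_\<psi>[OF cycle[OF finW]])+
qed

end

lemma Dgm_interval_basis:
  fixes V :: "'v set"
  assumes V: "finite V" "V \<noteq> {}"
  shows "\<exists>(L :: (('v list \<Rightarrow>\<^sub>0 'k::linordered_field) set \<times> nat) set) \<beta> e z.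
    subquotient_filtration.interval_basis chain_scale
      (\<lambda>t. cycles n (rips V d t) :: ('v list \<Rightarrow>\<^sub>0 'k) set)
      (\<lambda>t. boundaries n (rips V d t)) L \<beta> e z \<and>
    Dgm TYPE('k) n V d = image_mset (\<lambda>l. (ereal (\<beta> l), e l)) (mset_set L)"
proof -
  interpret persistent_subquotient chain_scale "\<lambda>t. cycles n (rips V d t)"
    "\<lambda>t. boundaries n (rips V d t)" "\<lambda>t. homology n (rips V d t) :: ('k, _) module"
    "\<lambda>s t. homology_incl n (rips V d t)" "simplex_chains n V"
    by (rule persistent_homology[OF V(1)])
  have "\<exists>m \<delta>. P.critical_values m \<delta>"
  proof (rule critical_values_exist)
    show "finite (dissimilarities V d)" "dissimilarities V d \<noteq> {}"
      using V by (simp_all add: finite_dissimilarities)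
    show "cycles n (rips V d s) = cycles n (rips V d t) \<and>
        boundaries n (rips V d s) = boundaries n (rips V d t)"
      if "\<And>v. v \<in> dissimilarities V d \<Longrightarrow> v \<le> s \<longleftrightarrow> v \<le> t" for s t
    proof -
      have "rips V d s = rips V d t" by (rule rips_eq) (rule that)
      then show ?thesis by simp
    qed
    show "cycles n (rips V d t) = {0}" if "\<And>v. v \<in> dissimilarities V d \<Longrightarrow> t < v" for t
    proof -
      have "rips V d t = {}" by (rule rips_empty) (rule that)
      then show ?thesis by (simp add: cycles_empty)
    qed
  qed
  then obtain m \<delta> where "P.critical_values m \<delta>" by blast
  from persistence_diagram_interval_basis[OF this] show ?thesis unfolding Dgm_def .
qed

lemma Dgm_dir_interval_basis:
  fixes V :: "'v set"
  assumes V: "finite V" "V \<noteq> {}"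
  shows "\<exists>(L :: (('v list \<Rightarrow>\<^sub>0 'k::linordered_field) set \<times> nat) set) \<beta> e z.
    subquotient_filtration.interval_basis chain_scale
      (\<lambda>t. directed_representatives n (rips V d t) :: ('v list \<Rightarrow>\<^sub>0 'k) set)
      (\<lambda>t. boundaries n (rips V d t)) L \<beta> e z \<and>
    Dgm_dir TYPE('k) n V d = image_mset (\<lambda>l. (ereal (\<beta> l), e l)) (mset_set L)"
proof -
  interpret persistent_subquotient chain_scale "\<lambda>t. directed_representatives n (rips V d t)"
    "\<lambda>t. boundaries n (rips V d t)" "\<lambda>t. directed_homology n (rips V d t) :: ('k, _) module"
    "\<lambda>s t. homology_incl n (rips V d t)" "simplex_chains n V"
    by (rule persistent_directed_homology[OF V(1)])
  have "\<exists>m \<delta>. P.critical_values m \<delta>"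
  proof (rule critical_values_exist)
    show "finite (dissimilarities V d)" "dissimilarities V d \<noteq> {}"
      using V by (simp_all add: finite_dissimilarities)
    show "directed_representatives n (rips V d s) = directed_representatives n (rips V d t) \<and>
        boundaries n (rips V d s) = boundaries n (rips V d t)"
      if "\<And>v. v \<in> dissimilarities V d \<Longrightarrow> v \<le> s \<longleftrightarrow> v \<le> t" for s t
    proof -
      have "rips V d s = rips V d t" by (rule rips_eq) (rule that)
      then show ?thesis by simp
    qed
    show "directed_representatives n (rips V d t) = {0}" if "\<And>v. v \<in> dissimilarities V d \<Longrightarrow> t < v" for t
    proof -
      have "rips V d t = {}" by (rule rips_empty) (rule that)
      then show ?thesis by (simp add: directed_representatives_empty)
    qed
  qed
  then obtain m \<delta> where "P.critical_values m \<delta>" by blast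
  from persistence_diagram_interval_basis[OF this] show ?thesis unfolding Dgm_dir_def .
qed

lemma (in close_dissimilarities) Dgm_stable:
  "bottleneck_dist (Dgm TYPE('k::linordered_field) n V dV) (Dgm TYPE('k) n W dW) \<le> ereal \<epsilon>"
proof -
  obtain L :: "(('v list \<Rightarrow>\<^sub>0 'k) set \<times> nat) set" and \<beta> e z where
    M: "subquotient_filtration.interval_basis chain_scale
      (\<lambda>t. cycles n (rips V dV t) :: ('v list \<Rightarrow>\<^sub>0 'k) set)
      (\<lambda>t. boundaries n (rips V dV t)) L \<beta> e z"
    "Dgm TYPE('k) n V dV = image_mset (\<lambda>l. (ereal (\<beta> l), e l)) (mset_set L)"
    using Dgm_interval_basis[OF finV V_ne, where 'k = 'k] by blast
  obtain L' :: "(('w list \<Rightarrow>\<^sub>0 'k) set \<times> nat) set" and \<beta>' e' z' where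
    N: "subquotient_filtration.interval_basis chain_scale
      (\<lambda>t. cycles n (rips W dW t) :: ('w list \<Rightarrow>\<^sub>0 'k) set)
      (\<lambda>t. boundaries n (rips W dW t)) L' \<beta>' e' z'"
    "Dgm TYPE('k) n W dW = image_mset (\<lambda>l. (ereal (\<beta>' l), e' l)) (mset_set L')"
    using Dgm_interval_basis[OF finW W_ne, where 'k = 'k] by blast
  show ?thesis unfolding M(2) N(2)
    by (rule interleaving.bottleneck_dist_le[OF homology_interleaving M(1) N(1)])
qed

lemma (in close_dissimilarities) Dgm_dir_stable:
  "bottleneck_dist (Dgm_dir TYPE('k::linordered_field) n V dV) (Dgm_dir TYPE('k) n W dW) \<le> ereal \<epsilon>"
proof -
  obtain L :: "(('v list \<Rightarrow>\<^sub>0 'k) set \<times> nat) set" and \<beta> e z where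
    M: "subquotient_filtration.interval_basis chain_scale
      (\<lambda>t. directed_representatives n (rips V dV t) :: ('v list \<Rightarrow>\<^sub>0 'k) set)
      (\<lambda>t. boundaries n (rips V dV t)) L \<beta> e z"
    "Dgm_dir TYPE('k) n V dV = image_mset (\<lambda>l. (ereal (\<beta> l), e l)) (mset_set L)"
    using Dgm_dir_interval_basis[OF finV V_ne, where 'k = 'k] by blast
  obtain L' :: "(('w list \<Rightarrow>\<^sub>0 'k) set \<times> nat) set" and \<beta>' e' z' where
    N: "subquotient_filtration.interval_basis chain_scale
      (\<lambda>t. directed_representatives n (rips W dW t) :: ('w list \<Rightarrow>\<^sub>0 'k) set)
      (\<lambda>t. boundaries n (rips W dW t)) L' \<beta>' e' z'"
    "Dgm_dir TYPE('k) n W dW = image_mset (\<lambda>l. (ereal (\<beta>' l), e' l)) (mset_set L')"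
    using Dgm_dir_interval_basis[OF finW W_ne, where 'k = 'k] by blast
  show ?thesis unfolding M(2) N(2)
    by (rule interleaving.bottleneck_dist_le[OF directed_homology_interleaving M(1) N(1)])
qed

section \<open>The stability theorem\<close>

lemma distortion_bound:
  assumes "finite \<theta>" "(v1, w1) \<in> \<theta>" "(v2, w2) \<in> \<theta>"
  shows "\<bar>dV v1 v2 - dW w1 w2\<bar> \<le> distortion dV dW \<theta>"
proof -
  let ?S = "{\<bar>dV v1 v2 - dW w1 w2\<bar> | v1 w1 v2 w2. (v1, w1) \<in> \<theta> \<and> (v2, w2) \<in> \<theta>}"
  have "?S = (\<lambda>((v1, w1), (v2, w2)). \<bar>dV v1 v2 - dW w1 w2\<bar>) ` (\<theta> \<times> \<theta>)" by force
  then have "finite ?S" using assms(1) by simp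
  then show ?thesis unfolding distortion_def using assms by (intro Max_ge) auto
qed

lemma close_dissimilarities_of_optimal_correspondence:
  assumes "finite V" "V \<noteq> {}" "finite W" "W \<noteq> {}"
  shows "\<exists>\<phi> \<psi>. close_dissimilarities V dV W dW \<phi> \<psi> (2 * corr_dist V dV W dW)"
proof -
  have "correspondences V W \<subseteq> Pow (V \<times> W)" by (auto simp: correspondences_def)
  then have "finite (correspondences V W)" using assms finite_subset by blast
  moreover have "V \<times> W \<in> correspondences V W" using assms by (auto simp: correspondences_def)
  ultimately have "Min (distortion dV dW ` correspondences V W) \<in> distortion dV dW ` correspondences V W"
    by (intro Min_in) auto
  then obtain \<theta> where \<theta>: "\<theta> \<in> correspondences V W" "2 * corr_dist V dV W dW = distortion dV dW \<theta>"
    by (auto simp: corr_dist_def)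
  have sub: "\<theta> \<subseteq> V \<times> W" "fst ` \<theta> = V" "snd ` \<theta> = W" using \<theta>(1) by (auto simp: correspondences_def)
  have "finite \<theta>" using sub(1) assms by (auto intro: finite_subset)
  note dist = distortion_bound[OF this, of _ _ _ _ dV dW]
  have "\<exists>w. (v, w) \<in> \<theta>" if "v \<in> V" for v using that sub(2) by force
  then obtain \<phi> where \<phi>: "\<And>v. v \<in> V \<Longrightarrow> (v, \<phi> v) \<in> \<theta>" by metis
  have "\<exists>v. (v, w) \<in> \<theta>" if "w \<in> W" for w using that sub(3) by force
  then obtain \<psi> where \<psi>: "\<And>w. w \<in> W \<Longrightarrow> (\<psi> w, w) \<in> \<theta>" by metis
  have \<phi>W: "\<phi> v \<in> W" if "v \<in> V" for v using \<phi>[OF that] sub(1) by auto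
  have \<psi>V: "\<psi> w \<in> V" if "w \<in> W" for w using \<psi>[OF that] sub(1) by auto
  have "close_dissimilarities V dV W dW \<phi> \<psi> (distortion dV dW \<theta>)"
  proof
    obtain v where "v \<in> V" using assms by blast
    then show "0 \<le> distortion dV dW \<theta>" using dist[OF \<phi> \<phi>, of v v] by simp
    show "dW (\<phi> x) (\<phi> y) \<le> dV x y + distortion dV dW \<theta>" if "x \<in> V" "y \<in> V" for x y
      using dist[OF \<phi>[OF that(1)] \<phi>[OF that(2)]] by linarith
    show "dV (\<psi> x) (\<psi> y) \<le> dW x y + distortion dV dW \<theta>" if "x \<in> W" "y \<in> W" for x y
      using dist[OF \<psi>[OF that(1)] \<psi>[OF that(2)]] by linarith
    show "dV x (\<psi> (\<phi> y)) \<le> dV x y + 2 * distortion dV dW \<theta>" if "x \<in> V" "y \<in> V" for x y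
      using dist[OF \<phi>[OF that(1)] \<psi>[OF \<phi>W[OF that(2)]]] dist[OF \<phi>[OF that(1)] \<phi>[OF that(2)]]
      by linarith
    show "dW x (\<phi> (\<psi> y)) \<le> dW x y + 2 * distortion dV dW \<theta>" if "x \<in> W" "y \<in> W" for x y
      using dist[OF \<psi>[OF that(1)] \<phi>[OF \<psi>V[OF that(2)]]] dist[OF \<psi>[OF that(1)] \<psi>[OF that(2)]]
      by linarith
  qed (use assms \<phi>W \<psi>V in auto)
  then show ?thesis unfolding \<theta>(2) by blast
qed

theorem theorem4p19:
  fixes V :: "'v set" and W :: "'w set"
    and dV :: "'v \<Rightarrow> 'v \<Rightarrow> real" and dW :: "'w \<Rightarrow> 'w \<Rightarrow> real"
    and n :: nat
  assumes "finite V" and "V \<noteq> {}" and "finite W" and "W \<noteq> {}"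
  shows
    "(bottleneck_dist (Dgm TYPE(rat) n V dV) (Dgm TYPE(rat) n W dW)
        \<le> ereal (2 * corr_dist V dV W dW) \<and>
      bottleneck_dist (Dgm_dir TYPE(rat) n V dV) (Dgm_dir TYPE(rat) n W dW)
        \<le> ereal (2 * corr_dist V dV W dW)) \<and>
     (bottleneck_dist (Dgm TYPE(real) n V dV) (Dgm TYPE(real) n W dW)
        \<le> ereal (2 * corr_dist V dV W dW) \<and>
      bottleneck_dist (Dgm_dir TYPE(real) n V dV) (Dgm_dir TYPE(real) n W dW)
        \<le> ereal (2 * corr_dist V dV W dW))"
proof -
  obtain \<phi> \<psi> where "close_dissimilarities V dV W dW \<phi> \<psi> (2 * corr_dist V dV W dW)"
    using close_dissimilarities_of_optimal_correspondence[OF assms] by blast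
  then interpret close_dissimilarities V dV W dW \<phi> \<psi> "2 * corr_dist V dV W dW" .
  show ?thesis by (intro conjI Dgm_stable Dgm_dir_stable)
qed

end
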